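(* Let $\Lambda$ be a two-sided Noetherian ring satisfying the two-sided $(2,2)$-condition (equivalently, such that $\operatorname{ref}\Lambda$ is quasi-abelian). Then: (1) $\operatorname{ref}\Lambda$ coincides with the category of second syzygies in $\operatorname{mod}\Lambda$. (2) $\operatorname{ref}\Lambda\subset\operatorname{mod}\Lambda$ is closed under kernels and extensions. (3) The inclusion $\operatorname{ref}\Lambda\subset\operatorname{mod}\Lambda$ has a left adjoint given by the double dual $X\mapsto X^{\ast\ast}$.
   Context: Rings are associative, unital, not necessarily commutative. $\operatorname{mod}\Lambda$ is the category of finitely generated (left) $\Lambda$-modules, $\operatorname{Mod}\Lambda$ the category of all $\Lambda$-modules. $(-)^\ast$ denotes $\operatorname{Hom}_\Lambda(-,\Lambda)$ or $\operatorname{Hom}_{\Lambda^{\mathrm{op}}}(-,\Lambda)$. A module $M\in\operatorname{mod}\Lambda$ is reflexive if the evaluation map $M\to M^{\ast\ast}$ is an isomorphism; $\operatorname{ref}\Lambda\subset\operatorname{mod}\Lambda$ is the full subcategory of reflexive modules. $X\in\operatorname{mod}\Lambda$ is a second syzygy if there is an exact sequence $0\to X\to Q^0\to Q^1$ with $Q^0,Q^1$ finitely generated projective. $\Lambda$ satisfies the $(2,2)$-condition if in the minimal injective resolution $0\to\Lambda\to I^0\to I^1\to\cdots$ of $\Lambda$ in $\operatorname{Mod}\Lambda$, the flat dimensions of $I^0$ and $I^1$ are $<2$; the two-sided $(2,2)$-condition means both $\Lambda$ and $\Lambda^{\mathrm{op}}$ satisfy the $(2,2)$-condition. An additive category is quasi-abelian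 if every morphism has a kernel and a cokernel, the push-out of a kernel along any morphism is a kernel, and the pull-back of a cokernel along any morphism is a cokernel. *)

theory Defs
  imports "HOL-Algebra.Free_Abelian_Groups" "HOL-Algebra.Module" "HOL-Algebra.Generated_Groups"
    "HOL-Algebra.AbelCoset"
begin

section \<open>Modules over a not necessarily commutative ring\<close>

text \<open>
  The library locale for modules requires a commutative ring, so the axioms are restated over
  an arbitrary unital ring. The record type (whose multiplicative fields carry no
  information) and the locale \<open>submodule\<close>, which does not mention commutativity, are the
  library's. Right modules over a ring are left modules over its opposite ring.
\<close>

locale left_module = R?: ring R + M?: abelian_group M
  for R :: "'a ring" (structure) and M :: "('a, 'm) module" (structure) +
  assumes smult_closed:
      "\<lbrakk>a \<in> carrier R; x \<in> carrier M\<rbrakk> \<Longrightarrow> a \<odot>\<^bsub>M\<^esub> x \<in> carrier M"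
    and smult_l_distr:
      "\<lbrakk>a \<in> carrier R; b \<in> carrier R; x \<in> carrier M\<rbrakk> \<Longrightarrow>
        (a \<oplus> b) \<odot>\<^bsub>M\<^esub> x = a \<odot>\<^bsub>M\<^esub> x \<oplus>\<^bsub>M\<^esub> b \<odot>\<^bsub>M\<^esub> x"
    and smult_r_distr:
      "\<lbrakk>a \<in> carrier R; x \<in> carrier M; y \<in> carrier M\<rbrakk> \<Longrightarrow>
        a \<odot>\<^bsub>M\<^esub> (x \<oplus>\<^bsub>M\<^esub> y) = a \<odot>\<^bsub>M\<^esub> x \<oplus>\<^bsub>M\<^esub> a \<odot>\<^bsub>M\<^esub> y"
    and smult_assoc:
      "\<lbrakk>a \<in> carrier R; b \<in> carrier R; x \<in> carrier M\<rbrakk> \<Longrightarrow>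
        (a \<otimes> b) \<odot>\<^bsub>M\<^esub> x = a \<odot>\<^bsub>M\<^esub> (b \<odot>\<^bsub>M\<^esub> x)"
    and smult_one:
      "x \<in> carrier M \<Longrightarrow> \<one> \<odot>\<^bsub>M\<^esub> x = x"

definition op_ring :: "'a ring \<Rightarrow> 'a ring" where
  "op_ring R = R\<lparr>monoid.mult := \<lambda>x y. y \<otimes>\<^bsub>R\<^esub> x\<rparr>"

definition regular_module :: "'a ring \<Rightarrow> ('a, 'a) module" where
  "regular_module R = \<lparr>carrier = carrier R, monoid.mult = monoid.mult R, one = \<one>\<^bsub>R\<^esub>,
     zero = \<zero>\<^bsub>R\<^esub>, add = add R, smult = monoid.mult R\<rparr>"

text \<open>Homomorphisms are extensional functions, so that this set is exactly Hom.\<close>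

definition mod_hom :: "'a ring \<Rightarrow> ('a, 'm) module \<Rightarrow> ('a, 'n) module \<Rightarrow> ('m \<Rightarrow> 'n) set" where
  "mod_hom R M N = {f \<in> carrier M \<rightarrow>\<^sub>E carrier N.
     (\<forall>x\<in>carrier M. \<forall>y\<in>carrier M. f (x \<oplus>\<^bsub>M\<^esub> y) = f x \<oplus>\<^bsub>N\<^esub> f y) \<and>
     (\<forall>a\<in>carrier R. \<forall>x\<in>carrier M. f (a \<odot>\<^bsub>M\<^esub> x) = a \<odot>\<^bsub>N\<^esub> f x)}"

definition fin_gen :: "'a ring \<Rightarrow> ('a, 'm) module \<Rightarrow> bool" where
  "fin_gen R M \<longleftrightarrow> (\<exists>S. finite S \<and> S \<subseteq> carrier M \<and>
     (\<forall>H. submodule H R M \<and> S \<subseteq> H \<longrightarrow> H = carrier M))"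

text \<open>The objects of mod, with carriers in the type \<open>'m\<close>.\<close>

definition fg_modules :: "'a ring \<Rightarrow> ('a, 'm) module set" where
  "fg_modules R = {M. left_module R M \<and> fin_gen R M}"

definition left_noetherian :: "'a ring \<Rightarrow> bool" where
  "left_noetherian R \<longleftrightarrow> ring R \<and>
     (\<forall>H. submodule H R (regular_module R) \<longrightarrow> fin_gen R ((regular_module R)\<lparr>carrier := H\<rparr>))"

definition two_sided_noetherian :: "'a ring \<Rightarrow> bool" where
  "two_sided_noetherian R \<longleftrightarrow> left_noetherian R \<and> left_noetherian (op_ring R)"


section \<open>Injective, projective and flat modules\<close>

text \<open>
  HOL cannot quantify over types inside a formula, so the type variable \<open>'u\<close> below serves as a
  universe: \<open>Mod R\<close> is the category of modules whose carrier is a set of elements of \<open>'u\<close>. If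
  \<open>'u\<close> is infinite and \<open>R\<close> embeds into it, then every left or right ideal of \<open>R\<close>, every finite
  power of \<open>R\<close>, and the free cover of every module in \<open>'u\<close> have isomorphic copies in \<open>'u\<close>. Hence
  (Baer's criterion and the ideal criterion for flatness) testing against modules in \<open>'u\<close> gives
  the usual notions of injective, projective and flat module and of flat dimension.
\<close>

definition injective_module :: "'a ring \<Rightarrow> ('a, 'u) module \<Rightarrow> bool" where
  "injective_module R E \<longleftrightarrow> left_module R E \<and>
     (\<forall>(A :: ('a, 'u) module) (B :: ('a, 'u) module) i f.
        left_module R A \<and> left_module R B \<and> i \<in> mod_hom R A B \<and> inj_on i (carrier A) \<and>
        f \<in> mod_hom R A E \<longrightarrow>
        (\<exists>g \<in> mod_hom R B E. \<forall>x\<in>carrier A. g (i x) = f x))"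

definition projective_module :: "'a ring \<Rightarrow> ('a, 'u) module \<Rightarrow> bool" where
  "projective_module R P \<longleftrightarrow> left_module R P \<and>
     (\<forall>(A :: ('a, 'u) module) (B :: ('a, 'u) module) p f.
        left_module R A \<and> left_module R B \<and> p \<in> mod_hom R A B \<and> p ` carrier A = carrier B \<and>
        f \<in> mod_hom R P B \<longrightarrow>
        (\<exists>g \<in> mod_hom R P A. \<forall>x\<in>carrier P. p (g x) = f x))"

text \<open>
  The tensor product of a right module \<open>A\<close> (a left module over \<open>op_ring R\<close>) and a left module
  \<open>M\<close>: the free abelian group on \<open>A \<times> M\<close> modulo the subgroup generated by the bilinearity and
  balancing relations. Here \<open>r \<odot>\<^bsub>A\<^esub> a\<close> is the right action of \<open>r\<close> on \<open>a\<close>.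
\<close>

definition tensor_relations ::
    "'a ring \<Rightarrow> ('a, 'n) module \<Rightarrow> ('a, 'm) module \<Rightarrow> ('n \<times> 'm \<Rightarrow>\<^sub>0 int) set" where
  "tensor_relations R A M = generate (free_Abelian_group (carrier A \<times> carrier M))
     ({frag_of (a \<oplus>\<^bsub>A\<^esub> b, x) - frag_of (a, x) - frag_of (b, x) | a b x.
         a \<in> carrier A \<and> b \<in> carrier A \<and> x \<in> carrier M} \<union>
      {frag_of (a, x \<oplus>\<^bsub>M\<^esub> y) - frag_of (a, x) - frag_of (a, y) | a x y.
         a \<in> carrier A \<and> x \<in> carrier M \<and> y \<in> carrier M} \<union>
      {frag_of (r \<odot>\<^bsub>A\<^esub> a, x) - frag_of (a, r \<odot>\<^bsub>M\<^esub> x) | r a x.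
         r \<in> carrier R \<and> a \<in> carrier A \<and> x \<in> carrier M})"

definition tensor_product ::
    "'a ring \<Rightarrow> ('a, 'n) module \<Rightarrow> ('a, 'm) module \<Rightarrow> ('n \<times> 'm \<Rightarrow>\<^sub>0 int) set monoid" where
  "tensor_product R A M =
     free_Abelian_group (carrier A \<times> carrier M) Mod tensor_relations R A M"

text \<open>
  The induced map \<open>i \<otimes> id : A \<otimes> M \<rightarrow> B \<otimes> M\<close> on cosets. The cosets united below all coincide, since
  the induced map on free abelian groups sends relations to relations.
\<close>

definition tensor_map ::
    "'a ring \<Rightarrow> ('a, 'n) module \<Rightarrow> ('a, 'k) module \<Rightarrow> ('n \<Rightarrow> 'k) \<Rightarrow> ('a, 'm) module \<Rightarrow>
     ('n \<times> 'm \<Rightarrow>\<^sub>0 int) set \<Rightarrow> ('k \<times> 'm \<Rightarrow>\<^sub>0 int) set" where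
  "tensor_map R A B i M = (\<lambda>X \<in> carrier (tensor_product R A M).
     \<Union>z\<in>X. tensor_relations R B M #>\<^bsub>free_Abelian_group (carrier B \<times> carrier M)\<^esub>
       frag_extend (\<lambda>(a, x). frag_of (i a, x)) z)"

definition flat_module :: "'a ring \<Rightarrow> ('a, 'u) module \<Rightarrow> bool" where
  "flat_module R M \<longleftrightarrow> left_module R M \<and>
     (\<forall>(A :: ('a, 'u) module) (B :: ('a, 'u) module) i.
        left_module (op_ring R) A \<and> left_module (op_ring R) B \<and>
        i \<in> mod_hom (op_ring R) A B \<and> inj_on i (carrier A) \<longrightarrow>
        inj_on (tensor_map R A B i M) (carrier (tensor_product R A M)))"

text \<open>\<open>flat_dim_less R M n\<close>: there is a flat resolution
  \<open>0 \<rightarrow> F (n - 1) \<rightarrow> \<dots> \<rightarrow> F 0 \<rightarrow> M \<rightarrow> 0\<close>.\<close>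

definition flat_dim_less :: "'a ring \<Rightarrow> ('a, 'u) module \<Rightarrow> nat \<Rightarrow> bool" where
  "flat_dim_less R M n \<longleftrightarrow> left_module R M \<and>
     (\<exists>(F :: nat \<Rightarrow> ('a, 'u) module) p d.
        (\<forall>k. flat_module R (F k)) \<and>
        (\<forall>k\<ge>n. carrier (F k) = {\<zero>\<^bsub>F k\<^esub>}) \<and>
        p \<in> mod_hom R (F 0) M \<and> p ` carrier (F 0) = carrier M \<and>
        (\<forall>k. d k \<in> mod_hom R (F (Suc k)) (F k)) \<and>
        d 0 ` carrier (F 1) = a_kernel (F 0) M p \<and>
        (\<forall>k. d (Suc k) ` carrier (F (Suc (Suc k))) = a_kernel (F (Suc k)) (F k) (d k)))"


section \<open>Minimal injective resolutions and the (2,2)-condition\<close>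

definition essential_submodule :: "'a ring \<Rightarrow> 'm set \<Rightarrow> ('a, 'm) module \<Rightarrow> bool" where
  "essential_submodule R H M \<longleftrightarrow> submodule H R M \<and>
     (\<forall>K. submodule K R M \<and> K \<noteq> {\<zero>\<^bsub>M\<^esub>} \<longrightarrow> H \<inter> K \<noteq> {\<zero>\<^bsub>M\<^esub>})"

text \<open>The resolution \<open>0 \<rightarrow> M \<rightarrow> I 0 \<rightarrow> I 1 \<rightarrow> \<dots>\<close> is minimal if every \<open>I n\<close> is an injective
  envelope of the kernel of \<open>I n \<rightarrow> I (n + 1)\<close>.\<close>

definition minimal_injective_resolution ::
    "'a ring \<Rightarrow> ('a, 'm) module \<Rightarrow> (nat \<Rightarrow> ('a, 'u) module) \<Rightarrow> ('m \<Rightarrow> 'u) \<Rightarrow>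
     (nat \<Rightarrow> 'u \<Rightarrow> 'u) \<Rightarrow> bool" where
  "minimal_injective_resolution R M I e d \<longleftrightarrow>
     (\<forall>n. injective_module R (I n)) \<and>
     e \<in> mod_hom R M (I 0) \<and> inj_on e (carrier M) \<and>
     (\<forall>n. d n \<in> mod_hom R (I n) (I (Suc n))) \<and>
     e ` carrier M = a_kernel (I 0) (I 1) (d 0) \<and>
     (\<forall>n. d n ` carrier (I n) = a_kernel (I (Suc n)) (I (Suc (Suc n))) (d (Suc n))) \<and>
     (\<forall>n. essential_submodule R (a_kernel (I n) (I (Suc n)) (d n)) (I n))"

text \<open>
  Minimal injective resolutions are unique up to isomorphism. For a left Noetherian ring the
  terms have cardinality at most \<open>max |R| \<aleph>\<^sub>0\<close>, so they are found in any infinite universe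
  containing a copy of \<open>R\<close>; conversely the map \<open>e\<close> embeds \<open>R\<close> into \<open>'u\<close>, so this condition
  itself makes the universe large enough.
\<close>

definition flat_dim_condition :: "'u itself \<Rightarrow> 'a ring \<Rightarrow> nat \<Rightarrow> nat \<Rightarrow> bool" where
  "flat_dim_condition U R l n \<longleftrightarrow>
     (\<exists>(I :: nat \<Rightarrow> ('a, 'u) module) e d.
        minimal_injective_resolution R (regular_module R) I e d \<and>
        (\<forall>i<n. flat_dim_less R (I i) l))"

definition two_sided_22_condition :: "'u itself \<Rightarrow> 'a ring \<Rightarrow> bool" where
  "two_sided_22_condition U R \<longleftrightarrow>
     flat_dim_condition U R 2 2 \<and> flat_dim_condition U (op_ring R) 2 2"


section \<open>Duals, reflexive modules and second syzygies\<close>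

text \<open>
  The dual of a left \<open>R\<close>-module, as a left module over \<open>op_ring R\<close>: \<open>R\<close> acts on the values of a
  functional by right multiplication. The multiplicative fields are irrelevant. Note that
  \<open>op_ring (op_ring R) = R\<close>, so that the double dual is again a left \<open>R\<close>-module.
\<close>

definition dual :: "'a ring \<Rightarrow> ('a, 'm) module \<Rightarrow> ('a, 'm \<Rightarrow> 'a) module" where
  "dual R M = \<lparr>carrier = mod_hom R M (regular_module R),
     monoid.mult = undefined, one = undefined,
     zero = (\<lambda>x\<in>carrier M. \<zero>\<^bsub>R\<^esub>),
     add = (\<lambda>f g. \<lambda>x\<in>carrier M. f x \<oplus>\<^bsub>R\<^esub> g x),
     smult = (\<lambda>a f. \<lambda>x\<in>carrier M. f x \<otimes>\<^bsub>R\<^esub> a)\<rparr>"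

definition dual_map ::
    "'a ring \<Rightarrow> ('a, 'm) module \<Rightarrow> ('a, 'n) module \<Rightarrow> ('m \<Rightarrow> 'n) \<Rightarrow> ('n \<Rightarrow> 'a) \<Rightarrow> ('m \<Rightarrow> 'a)" where
  "dual_map R M N f = (\<lambda>g\<in>carrier (dual R N). compose (carrier M) g f)"

definition double_dual ::
    "'a ring \<Rightarrow> ('a, 'm) module \<Rightarrow> ('a, ('m \<Rightarrow> 'a) \<Rightarrow> 'a) module" where
  "double_dual R M = dual (op_ring R) (dual R M)"

definition double_dual_map ::
    "'a ring \<Rightarrow> ('a, 'm) module \<Rightarrow> ('a, 'n) module \<Rightarrow> ('m \<Rightarrow> 'n) \<Rightarrow>
     (('m \<Rightarrow> 'a) \<Rightarrow> 'a) \<Rightarrow> (('n \<Rightarrow> 'a) \<Rightarrow> 'a)" where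
  "double_dual_map R M N f = dual_map (op_ring R) (dual R N) (dual R M) (dual_map R M N f)"

definition evaluation :: "'a ring \<Rightarrow> ('a, 'm) module \<Rightarrow> 'm \<Rightarrow> (('m \<Rightarrow> 'a) \<Rightarrow> 'a)" where
  "evaluation R M = (\<lambda>x\<in>carrier M. \<lambda>f\<in>carrier (dual R M). f x)"

text \<open>The evaluation map is always linear, so it is an isomorphism iff it is bijective.\<close>

definition reflexive_modules :: "'a ring \<Rightarrow> ('a, 'm) module set" where
  "reflexive_modules R = {M \<in> fg_modules R.
     bij_betw (evaluation R M) (carrier M) (carrier (double_dual R M))}"

definition second_syzygies :: "'a ring \<Rightarrow> ('a, 'u) module set" where
  "second_syzygies R = {X \<in> fg_modules R.
     \<exists>(P :: ('a, 'u) module) (Q :: ('a, 'u) module) i f.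
       P \<in> fg_modules R \<and> projective_module R P \<and> Q \<in> fg_modules R \<and> projective_module R Q \<and>
       i \<in> mod_hom R X P \<and> inj_on i (carrier X) \<and>
       f \<in> mod_hom R P Q \<and> i ` carrier X = a_kernel P Q f}"


section \<open>Closure properties and the adjunction\<close>

text \<open>The kernel \<open>K\<close> is taken among all modules, so that its finite generation is part of
  the closure property.\<close>

definition closed_under_kernels :: "'a ring \<Rightarrow> ('a, 'u) module set \<Rightarrow> bool" where
  "closed_under_kernels R C \<longleftrightarrow>
     (\<forall>K X Y i f. left_module R K \<and> X \<in> C \<and> Y \<in> C \<and> f \<in> mod_hom R X Y \<and>
        i \<in> mod_hom R K X \<and> inj_on i (carrier K) \<and> i ` carrier K = a_kernel X Y f \<longrightarrow> K \<in> C)"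

definition closed_under_extensions :: "'a ring \<Rightarrow> ('a, 'u) module set \<Rightarrow> bool" where
  "closed_under_extensions R C \<longleftrightarrow>
     (\<forall>X E Z i p. X \<in> C \<and> E \<in> fg_modules R \<and> Z \<in> C \<and>
        i \<in> mod_hom R X E \<and> inj_on i (carrier X) \<and>
        p \<in> mod_hom R E Z \<and> p ` carrier E = carrier Z \<and>
        i ` carrier X = a_kernel E Z p \<longrightarrow> E \<in> C)"

text \<open>
  \<open>F\<close> and \<open>Fm\<close> are the object and morphism parts of a functor from mod to the full subcategory
  ref. The values of \<open>F\<close> may live in another type, as they do for the double dual.
\<close>

definition functor_mod_to_ref ::
    "'a ring \<Rightarrow> (('a, 'u) module \<Rightarrow> ('a, 'v) module) \<Rightarrow>
     (('a, 'u) module \<Rightarrow> ('a, 'u) module \<Rightarrow> ('u \<Rightarrow> 'u) \<Rightarrow> ('v \<Rightarrow> 'v)) \<Rightarrow> bool" where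
  "functor_mod_to_ref R F Fm \<longleftrightarrow>
     (\<forall>X\<in>fg_modules R. F X \<in> reflexive_modules R) \<and>
     (\<forall>X\<in>fg_modules R. \<forall>Y\<in>fg_modules R. \<forall>f\<in>mod_hom R X Y.
        Fm X Y f \<in> mod_hom R (F X) (F Y)) \<and>
     (\<forall>X\<in>fg_modules R. Fm X X (\<lambda>x\<in>carrier X. x) = (\<lambda>x\<in>carrier (F X). x)) \<and>
     (\<forall>X\<in>fg_modules R. \<forall>Y\<in>fg_modules R. \<forall>Z\<in>fg_modules R.
        \<forall>f\<in>mod_hom R X Y. \<forall>g\<in>mod_hom R Y Z.
        Fm X Z (compose (carrier X) g f) = compose (carrier (F X)) (Fm Y Z g) (Fm X Y f))"

text \<open>\<open>\<Phi> X Y : Hom(F X, Y) \<rightarrow> Hom(X, Y)\<close>, for \<open>X\<close> in mod and \<open>Y\<close> in ref, is a bijection natural in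
  both variables.\<close>

definition left_adjoint_to_ref_inclusion ::
    "'a ring \<Rightarrow> (('a, 'u) module \<Rightarrow> ('a, 'v) module) \<Rightarrow>
     (('a, 'u) module \<Rightarrow> ('a, 'u) module \<Rightarrow> ('u \<Rightarrow> 'u) \<Rightarrow> ('v \<Rightarrow> 'v)) \<Rightarrow>
     (('a, 'u) module \<Rightarrow> ('a, 'u) module \<Rightarrow> ('v \<Rightarrow> 'u) \<Rightarrow> ('u \<Rightarrow> 'u)) \<Rightarrow> bool" where
  "left_adjoint_to_ref_inclusion R F Fm \<Phi> \<longleftrightarrow>
     functor_mod_to_ref R F Fm \<and>
     (\<forall>X\<in>fg_modules R. \<forall>Y\<in>reflexive_modules R.
        bij_betw (\<Phi> X Y) (mod_hom R (F X) Y) (mod_hom R X Y)) \<and>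
     (\<forall>X\<in>fg_modules R. \<forall>X'\<in>fg_modules R. \<forall>Y\<in>reflexive_modules R.
        \<forall>k\<in>mod_hom R X' X. \<forall>g\<in>mod_hom R (F X) Y.
        \<Phi> X' Y (compose (carrier (F X')) g (Fm X' X k)) = compose (carrier X') (\<Phi> X Y g) k) \<and>
     (\<forall>X\<in>fg_modules R. \<forall>Y\<in>reflexive_modules R. \<forall>Y'\<in>reflexive_modules R.
        \<forall>h\<in>mod_hom R Y Y'. \<forall>g\<in>mod_hom R (F X) Y.
        \<Phi> X Y' (compose (carrier (F X)) h g) = compose (carrier X) h (\<Phi> X Y g))"

end

theory Submission
  imports Defs
begin

text \<open>
  Let \<open>K\<close> be the kernel of a map from a finitely generated module \<open>W\<close> to a free module of finite
  rank, with cokernel \<open>N\<close>. The cokernel \<open>L\<close> of the restriction map from the dual of \<open>W\<close> to the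
  dual of \<open>K\<close> embeds into \<open>Ext\<^sup>2(N, R)\<close>. If \<open>J\<close> is injective of flat dimension less than two, then
  \<open>Hom(L, J)\<close> is a quotient of \<open>Hom(Ext\<^sup>2(N, R), J) = Tor\<^sub>2(J, N) = 0\<close>. For the first two terms
  \<open>J\<close> of the injective resolution of the ring this gives \<open>Hom(L, R) = 0 = Ext\<^sup>1(L, R)\<close>: the map
  from the double dual of \<open>K\<close> to that of \<open>W\<close> is injective, and a functional on the dual of \<open>W\<close>
  that vanishes on the functionals restricting to zero comes from the double dual of \<open>K\<close>.
  The first fact makes kernels of maps between reflexive modules reflexive, and hence duals and
  second syzygies; both together give the five lemma argument for extensions. For the adjunction,
  maps out of a double dual are determined on the image of the evaluation because duals are reflexive.
\<close>

section \<open>Modules and homomorphisms\<close>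

text \<open>The modules of the homological argument, such as Ext groups, duals and the cokernel of a
  restriction map, do not have carriers in \<open>'u\<close>, whereas injectivity and flatness speak
  of test modules there. Hence no derived functor occurs. A chain R^m -> R^n -> R^q of matrices,
  exact in the middle, stands for the resolution of \<open>N\<close>; a functional on a dual becomes
  a row of m elements of an injective module; and only free modules and their submodules are copied
  into \<open>'u\<close>, along an injection that the resolution of the ring provides. The degree
  two comes from the image I of \<open>W\<close> in the free module: \<open>L\<close> embeds into
  Ext^1(I, R), and I is a first syzygy of \<open>N\<close>. As for sides, a functional on the dual
  of a left module is a map of right modules. So kernels and extensions of left modules draw on the
  flat dimension condition over \<open>op_ring R\<close>, reflexivity of the dual of a left module
  on the one over \<open>R\<close>, and the left adjoint on both.\<close>

lemma op_ring_simps [simp]: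
  "carrier (op_ring R) = carrier R" "\<zero>\<^bsub>op_ring R\<^esub> = \<zero>\<^bsub>R\<^esub>" "\<one>\<^bsub>op_ring R\<^esub> = \<one>\<^bsub>R\<^esub>"
  "x \<oplus>\<^bsub>op_ring R\<^esub> y = x \<oplus>\<^bsub>R\<^esub> y" "x \<otimes>\<^bsub>op_ring R\<^esub> y = y \<otimes>\<^bsub>R\<^esub> x"
  "op_ring (op_ring R) = R"
  by (simp_all add: op_ring_def)

lemma ring_op_ring [simp]:
  assumes "ring R"
  shows "ring (op_ring R)"
proof -
  interpret ring R by fact
  have "\<exists>y\<in>carrier R. y \<oplus>\<^bsub>R\<^esub> x = \<zero>\<^bsub>R\<^esub>" if "x \<in> carrier R" for x
    using that by (intro bexI[of _ "\<ominus>\<^bsub>R\<^esub> x"]) (auto simp: l_neg)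
  then show ?thesis
    by (intro ringI abelian_groupI monoidI) (auto simp: m_assoc l_distr r_distr a_ac)
qed

lemma regular_module_simps [simp]:
  "carrier (regular_module R) = carrier R" "\<zero>\<^bsub>regular_module R\<^esub> = \<zero>\<^bsub>R\<^esub>"
  "x \<oplus>\<^bsub>regular_module R\<^esub> y = x \<oplus>\<^bsub>R\<^esub> y" "x \<odot>\<^bsub>regular_module R\<^esub> y = x \<otimes>\<^bsub>R\<^esub> y"
  by (simp_all add: regular_module_def)

text \<open>The scalar -1 provides additive inverses, so an instance verifies one equation for them
  instead of exhibiting an inverse in each new structure.\<close>

lemma left_moduleI:
  assumes "ring R"
    and "\<zero>\<^bsub>M\<^esub> \<in> carrier M"
    and "\<And>x y. x \<in> carrier M \<Longrightarrow> y \<in> carrier M \<Longrightarrow> x \<oplus>\<^bsub>M\<^esub> y \<in> carrier M"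
    and "\<And>x y z. x \<in> carrier M \<Longrightarrow> y \<in> carrier M \<Longrightarrow> z \<in> carrier M \<Longrightarrow>
      (x \<oplus>\<^bsub>M\<^esub> y) \<oplus>\<^bsub>M\<^esub> z = x \<oplus>\<^bsub>M\<^esub> (y \<oplus>\<^bsub>M\<^esub> z)"
    and "\<And>x y. x \<in> carrier M \<Longrightarrow> y \<in> carrier M \<Longrightarrow> x \<oplus>\<^bsub>M\<^esub> y = y \<oplus>\<^bsub>M\<^esub> x"
    and "\<And>x. x \<in> carrier M \<Longrightarrow> \<zero>\<^bsub>M\<^esub> \<oplus>\<^bsub>M\<^esub> x = x"
    and "\<And>a x. a \<in> carrier R \<Longrightarrow> x \<in> carrier M \<Longrightarrow> a \<odot>\<^bsub>M\<^esub> x \<in> carrier M"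
    and "\<And>x. x \<in> carrier M \<Longrightarrow> (\<ominus>\<^bsub>R\<^esub> \<one>\<^bsub>R\<^esub>) \<odot>\<^bsub>M\<^esub> x \<oplus>\<^bsub>M\<^esub> x = \<zero>\<^bsub>M\<^esub>"
    and "\<And>a b x. a \<in> carrier R \<Longrightarrow> b \<in> carrier R \<Longrightarrow> x \<in> carrier M \<Longrightarrow>
      (a \<oplus>\<^bsub>R\<^esub> b) \<odot>\<^bsub>M\<^esub> x = a \<odot>\<^bsub>M\<^esub> x \<oplus>\<^bsub>M\<^esub> b \<odot>\<^bsub>M\<^esub> x"
    and "\<And>a x y. a \<in> carrier R \<Longrightarrow> x \<in> carrier M \<Longrightarrow> y \<in> carrier M \<Longrightarrow>
      a \<odot>\<^bsub>M\<^esub> (x \<oplus>\<^bsub>M\<^esub> y) = a \<odot>\<^bsub>M\<^esub> x \<oplus>\<^bsub>M\<^esub> a \<odot>\<^bsub>M\<^esub> y"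
    and "\<And>a b x. a \<in> carrier R \<Longrightarrow> b \<in> carrier R \<Longrightarrow> x \<in> carrier M \<Longrightarrow>
      (a \<otimes>\<^bsub>R\<^esub> b) \<odot>\<^bsub>M\<^esub> x = a \<odot>\<^bsub>M\<^esub> (b \<odot>\<^bsub>M\<^esub> x)"
    and "\<And>x. x \<in> carrier M \<Longrightarrow> \<one>\<^bsub>R\<^esub> \<odot>\<^bsub>M\<^esub> x = x"
  shows "left_module R M"
proof -
  interpret ring R by fact
  have "\<exists>y\<in>carrier M. y \<oplus>\<^bsub>M\<^esub> x = \<zero>\<^bsub>M\<^esub>" if "x \<in> carrier M" for x
    using that assms(7,8) by (intro bexI[of _ "(\<ominus>\<^bsub>R\<^esub> \<one>\<^bsub>R\<^esub>) \<odot>\<^bsub>M\<^esub> x"]) auto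
  then have "abelian_group M"
    using assms(2-6) by (intro abelian_groupI) auto
  then show ?thesis
    unfolding left_module_def left_module_axioms_def using assms by auto
qed

lemma left_module_ring: "left_module R M \<Longrightarrow> ring R"
  by (simp add: left_module_def)

lemma left_module_regular:
  assumes "ring R"
  shows "left_module R (regular_module R)"
proof -
  interpret ring R by fact
  show ?thesis
    by (rule left_moduleI)
      (auto simp: assms m_assoc l_distr r_distr a_ac l_minus r_neg)
qed

context left_module
begin

lemma smult_zero_left [simp]: "x \<in> carrier M \<Longrightarrow> \<zero> \<odot>\<^bsub>M\<^esub> x = \<zero>\<^bsub>M\<^esub>"
  by (metis M.add.l_cancel_one' R.add.r_cancel_one R.add.one_closed smult_closed smult_l_distr)

lemma smult_zero_right [simp]: "a \<in> carrier R \<Longrightarrow> a \<odot>\<^bsub>M\<^esub> \<zero>\<^bsub>M\<^esub> = \<zero>\<^bsub>M\<^esub>"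
  by (metis M.add.l_cancel_one' M.add.r_cancel_one M.add.one_closed smult_closed smult_r_distr)

lemma smult_minus_one: "x \<in> carrier M \<Longrightarrow> (\<ominus> \<one>) \<odot>\<^bsub>M\<^esub> x = \<ominus>\<^bsub>M\<^esub> x"
  by (metis M.minus_equality R.a_inv_closed R.l_neg R.one_closed smult_closed smult_l_distr smult_one
      smult_zero_left)

lemma smult_minus_right: 
  assumes "a \<in> carrier R" "x \<in> carrier M" 
  shows "a \<odot>\<^bsub>M\<^esub> (\<ominus>\<^bsub>M\<^esub> x) = \<ominus>\<^bsub>M\<^esub> (a \<odot>\<^bsub>M\<^esub> x)"
proof -
  have "a \<odot>\<^bsub>M\<^esub> (\<ominus>\<^bsub>M\<^esub> x) \<oplus>\<^bsub>M\<^esub> a \<odot>\<^bsub>M\<^esub> x = \<zero>\<^bsub>M\<^esub>"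
    using assms by (simp add: smult_r_distr[symmetric] M.l_neg)
  then show ?thesis 
    using assms by (simp add: M.minus_equality smult_closed)
qed

text \<open>Negation is multiplication by -1 and therefore needs no premise of its own.\<close>

lemma submoduleI:
  assumes "H \<subseteq> carrier M" "\<zero>\<^bsub>M\<^esub> \<in> H"
    and add: "\<And>x y. x \<in> H \<Longrightarrow> y \<in> H \<Longrightarrow> x \<oplus>\<^bsub>M\<^esub> y \<in> H"
    and smult: "\<And>a x. a \<in> carrier R \<Longrightarrow> x \<in> H \<Longrightarrow> a \<odot>\<^bsub>M\<^esub> x \<in> H"
  shows "submodule H R M"
proof -
  have "\<ominus>\<^bsub>M\<^esub> x \<in> H" if "x \<in> H" for x
    using smult[of "\<ominus> \<one>" x] that assms(1) by (auto simp: smult_minus_one)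
  then show ?thesis
    using assms by (unfold_locales) (auto simp: a_inv_def)
qed

lemma left_module_submodule:
  assumes "submodule H R M"
  shows "left_module R (M\<lparr>carrier := H\<rparr>)"
proof -
  interpret H: submodule H R M by fact
  have [simp]: "x \<in> carrier M" if "x \<in> H" for x
    using H.subset that by auto
  have [simp]: "\<zero>\<^bsub>M\<^esub> \<in> H" "\<And>x y. x \<in> H \<Longrightarrow> y \<in> H \<Longrightarrow> x \<oplus>\<^bsub>M\<^esub> y \<in> H"
    using H.one_closed H.m_closed by auto
  show ?thesis
    by (rule left_moduleI)
      (auto simp: R.ring_axioms M.a_ac smult_l_distr smult_r_distr smult_assoc smult_one
        smult_minus_one M.r_neg)
qed

end

section \<open>Homomorphisms as extensional maps\<close>

lemma mod_homI:
  assumes "f \<in> carrier M \<rightarrow>\<^sub>E carrier N"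
    and "\<And>x y. x \<in> carrier M \<Longrightarrow> y \<in> carrier M \<Longrightarrow> f (x \<oplus>\<^bsub>M\<^esub> y) = f x \<oplus>\<^bsub>N\<^esub> f y"
    and "\<And>a x. a \<in> carrier R \<Longrightarrow> x \<in> carrier M \<Longrightarrow> f (a \<odot>\<^bsub>M\<^esub> x) = a \<odot>\<^bsub>N\<^esub> f x"
  shows "f \<in> mod_hom R M N"
  using assms by (auto simp: mod_hom_def)

lemma mod_hom_restrictI:
  assumes "left_module R M" "\<And>x. x \<in> carrier M \<Longrightarrow> f x \<in> carrier N"
    and "\<And>x y. x \<in> carrier M \<Longrightarrow> y \<in> carrier M \<Longrightarrow> f (x \<oplus>\<^bsub>M\<^esub> y) = f x \<oplus>\<^bsub>N\<^esub> f y"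
    and "\<And>a x. a \<in> carrier R \<Longrightarrow> x \<in> carrier M \<Longrightarrow> f (a \<odot>\<^bsub>M\<^esub> x) = a \<odot>\<^bsub>N\<^esub> f x"
  shows "(\<lambda>x\<in>carrier M. f x) \<in> mod_hom R M N"
proof -
  interpret left_module R M by fact
  show ?thesis
    using assms by (intro mod_homI) (auto simp: smult_closed)
qed

lemma mod_hom_closed: "f \<in> mod_hom R M N \<Longrightarrow> x \<in> carrier M \<Longrightarrow> f x \<in> carrier N"
  by (auto simp: mod_hom_def)

lemma mod_hom_add:
  "f \<in> mod_hom R M N \<Longrightarrow> x \<in> carrier M \<Longrightarrow> y \<in> carrier M \<Longrightarrow> f (x \<oplus>\<^bsub>M\<^esub> y) = f x \<oplus>\<^bsub>N\<^esub> f y"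
  by (auto simp: mod_hom_def)

lemma mod_hom_smult:
  "f \<in> mod_hom R M N \<Longrightarrow> a \<in> carrier R \<Longrightarrow> x \<in> carrier M \<Longrightarrow> f (a \<odot>\<^bsub>M\<^esub> x) = a \<odot>\<^bsub>N\<^esub> f x"
  by (auto simp: mod_hom_def)

lemma mod_hom_extensional: "f \<in> mod_hom R M N \<Longrightarrow> x \<notin> carrier M \<Longrightarrow> f x = undefined"
  by (auto simp: mod_hom_def)

lemma mod_hom_eqI:
  assumes "f \<in> mod_hom R M N" "g \<in> mod_hom R M N'" "\<And>x. x \<in> carrier M \<Longrightarrow> f x = g x"
  shows "f = g"
  using assms by (metis ext mod_hom_extensional)

lemma mod_hom_compose:
  assumes "f \<in> mod_hom R L M" "g \<in> mod_hom R M N" "left_module R L"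
  shows "compose (carrier L) g f \<in> mod_hom R L N"
  using assms unfolding compose_def
  by (intro mod_hom_restrictI) (auto simp: mod_hom_add mod_hom_smult mod_hom_closed)

lemma mod_hom_id:
  assumes "left_module R M"
  shows "(\<lambda>x\<in>carrier M. x) \<in> mod_hom R M M"
  using assms by (intro mod_hom_restrictI) auto

lemma mod_hom_zero:
  assumes "f \<in> mod_hom R M N" "left_module R M" "left_module R N"
  shows "f \<zero>\<^bsub>M\<^esub> = \<zero>\<^bsub>N\<^esub>"
proof -
  interpret M: left_module R M by fact
  interpret N: left_module R N by fact
  show ?thesis
    using mod_hom_smult[OF assms(1), of "\<zero>\<^bsub>R\<^esub>" "\<zero>\<^bsub>M\<^esub>"] mod_hom_closed[OF assms(1), of "\<zero>\<^bsub>M\<^esub>"]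
    by simp
qed

lemma mod_hom_minus:
  assumes "f \<in> mod_hom R M N" "left_module R M" "left_module R N" "x \<in> carrier M"
  shows "f (\<ominus>\<^bsub>M\<^esub> x) = \<ominus>\<^bsub>N\<^esub> f x"
proof -
  interpret M: left_module R M by fact
  interpret N: left_module R N by fact
  show ?thesis
    using mod_hom_smult[OF assms(1), of "\<ominus>\<^bsub>R\<^esub> \<one>\<^bsub>R\<^esub>" x] mod_hom_closed[OF assms(1), of x] assms(4)
    by (simp add: M.smult_minus_one N.smult_minus_one)
qed

lemma mod_hom_diff:
  assumes "f \<in> mod_hom R M N" "left_module R M" "left_module R N" "x \<in> carrier M" "y \<in> carrier M"
  shows "f (x \<ominus>\<^bsub>M\<^esub> y) = f x \<ominus>\<^bsub>N\<^esub> f y"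
proof -
  interpret M: left_module R M by fact
  show ?thesis
    using assms by (simp add: a_minus_def mod_hom_add mod_hom_minus)
qed

lemma (in abelian_group) minus_eq_zero_iff:
  "x \<in> carrier G \<Longrightarrow> y \<in> carrier G \<Longrightarrow> x \<ominus> y = \<zero> \<longleftrightarrow> x = y"
  unfolding a_minus_def by (metis a_comm a_inv_closed local.minus_minus minus_equality r_neg)

lemma mod_hom_inj_onI:
  assumes "f \<in> mod_hom R M N" "left_module R M" "left_module R N"
    and "\<And>x. x \<in> carrier M \<Longrightarrow> f x = \<zero>\<^bsub>N\<^esub> \<Longrightarrow> x = \<zero>\<^bsub>M\<^esub>"
  shows "inj_on f (carrier M)"
proof (rule inj_onI)
  interpret M: left_module R M by fact
  interpret N: left_module R N by fact
  fix x y assume xy: "x \<in> carrier M" "y \<in> carrier M" "f x = f y"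
  then have "f (x \<ominus>\<^bsub>M\<^esub> y) = \<zero>\<^bsub>N\<^esub>"
    using mod_hom_closed[OF assms(1)] by (simp add: mod_hom_diff[OF assms(1-3)] N.minus_eq_zero_iff)
  then show "x = y"
    using assms(4)[of "x \<ominus>\<^bsub>M\<^esub> y"] xy by (simp add: M.minus_eq_zero_iff)
qed

lemma mod_hom_kernel_trivial:
  assumes "f \<in> mod_hom R M N" "left_module R M" "left_module R N" "inj_on f (carrier M)"
    and "x \<in> carrier M" "f x = \<zero>\<^bsub>N\<^esub>"
  shows "x = \<zero>\<^bsub>M\<^esub>"
proof -
  interpret M: left_module R M by fact
  show ?thesis 
    using assms mod_hom_zero[OF assms(1-3)] by (metis M.zero_closed inj_onD)
qed

lemma submodule_image:
  assumes "f \<in> mod_hom R M N" "left_module R M" "left_module R N"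
  shows "submodule (f ` carrier M) R N"
proof -
  interpret M: left_module R M by fact
  interpret N: left_module R N by fact
  show ?thesis
  proof (rule N.submoduleI)
    show "f ` carrier M \<subseteq> carrier N"
      using mod_hom_closed[OF assms(1)] by auto
    show "\<zero>\<^bsub>N\<^esub> \<in> f ` carrier M"
      using mod_hom_zero[OF assms] by (metis M.zero_closed image_eqI)
    show "x \<oplus>\<^bsub>N\<^esub> y \<in> f ` carrier M" if "x \<in> f ` carrier M" "y \<in> f ` carrier M" for x y
      using that by (auto simp: mod_hom_add[OF assms(1), symmetric])
    show "a \<odot>\<^bsub>N\<^esub> x \<in> f ` carrier M" if "a \<in> carrier R" "x \<in> f ` carrier M" for a x
      using that by (auto simp: mod_hom_smult[OF assms(1), symmetric] M.smult_closed)
  qed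
qed

subsection \<open>Linear combinations\<close>

text \<open>Terms are indexed by an initial segment of the naturals, so identities go by induction
  on the length and a matrix is a plain function of two indices. Values of \<open>r\<close> and
  \<open>w\<close> from \<open>n\<close> onwards have no influence.\<close>

primrec lincomb :: "('a, 'm) module \<Rightarrow> nat \<Rightarrow> (nat \<Rightarrow> 'a) \<Rightarrow> (nat \<Rightarrow> 'm) \<Rightarrow> 'm" where
  "lincomb M 0 r w = \<zero>\<^bsub>M\<^esub>"
| "lincomb M (Suc n) r w = lincomb M n r w \<oplus>\<^bsub>M\<^esub> r n \<odot>\<^bsub>M\<^esub> w n"

lemma lincomb_cong:
  assumes "\<And>i. i < n \<Longrightarrow> r i = s i" "\<And>i. i < n \<Longrightarrow> w i = v i"
  shows "lincomb M n r w = lincomb M n s v"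
  using assms by (induction n) auto

lemma lincomb_hom:
  assumes "f \<in> mod_hom R M N" "left_module R M" "left_module R N"
    and "\<And>i. i < n \<Longrightarrow> r i \<in> carrier R" "\<And>i. i < n \<Longrightarrow> w i \<in> carrier M"
  shows "lincomb M n r w \<in> carrier M \<and> f (lincomb M n r w) = lincomb N n r (\<lambda>i. f (w i))"
proof -
  interpret M: left_module R M by fact
  show ?thesis
    using assms(4,5)
    by (induction n)
      (auto simp: mod_hom_zero[OF assms(1-3)] mod_hom_add[OF assms(1)] mod_hom_smult[OF assms(1)] M.smult_closed)
qed

lemmas mod_hom_lincomb = lincomb_hom[THEN conjunct2]

context left_module
begin

lemma lincomb_closed [intro, simp]:
  assumes "\<And>i. i < n \<Longrightarrow> r i \<in> carrier R" "\<And>i. i < n \<Longrightarrow> w i \<in> carrier M"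
  shows "lincomb M n r w \<in> carrier M"
  using assms by (induction n) (auto simp: smult_closed)

lemma lincomb_add_left:
  assumes "\<And>i. i < n \<Longrightarrow> r i \<in> carrier R" "\<And>i. i < n \<Longrightarrow> s i \<in> carrier R"
    and "\<And>i. i < n \<Longrightarrow> w i \<in> carrier M"
  shows "lincomb M n (\<lambda>i. r i \<oplus> s i) w = lincomb M n r w \<oplus>\<^bsub>M\<^esub> lincomb M n s w"
  using assms by (induction n) (auto simp: smult_closed smult_l_distr M.a_ac)

lemma lincomb_add_right:
  assumes "\<And>i. i < n \<Longrightarrow> r i \<in> carrier R" "\<And>i. i < n \<Longrightarrow> v i \<in> carrier M"
    and "\<And>i. i < n \<Longrightarrow> w i \<in> carrier M"
  shows "lincomb M n r (\<lambda>i. v i \<oplus>\<^bsub>M\<^esub> w i) = lincomb M n r v \<oplus>\<^bsub>M\<^esub> lincomb M n r w"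
  using assms by (induction n) (auto simp: smult_closed smult_r_distr M.a_ac)

lemma lincomb_smult:
  assumes "a \<in> carrier R" "\<And>i. i < n \<Longrightarrow> r i \<in> carrier R" "\<And>i. i < n \<Longrightarrow> w i \<in> carrier M"
  shows "lincomb M n (\<lambda>i. a \<otimes> r i) w = a \<odot>\<^bsub>M\<^esub> lincomb M n r w"
  using assms by (induction n) (auto simp: smult_closed smult_r_distr smult_assoc)

lemma lincomb_zero_left [simp]:
  assumes "\<And>i. i < n \<Longrightarrow> w i \<in> carrier M"
  shows "lincomb M n (\<lambda>i. \<zero>) w = \<zero>\<^bsub>M\<^esub>"
  using assms by (induction n) auto

lemma lincomb_zero_right [simp]:
  assumes "\<And>i. i < n \<Longrightarrow> r i \<in> carrier R"
  shows "lincomb M n r (\<lambda>i. \<zero>\<^bsub>M\<^esub>) = \<zero>\<^bsub>M\<^esub>"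
  using assms by (induction n) auto

text \<open>Associativity of the matrix product: \<open>r\<close> times (\<open>s\<close> times
  \<open>x\<close>) is (\<open>r\<close> times \<open>s\<close>) times \<open>x\<close>. The order
  of the factors is kept because \<open>R\<close> need not commute.\<close>

lemma lincomb_lincomb:
  assumes "\<And>i. i < n \<Longrightarrow> r i \<in> carrier R" "\<And>i j. i < n \<Longrightarrow> j < q \<Longrightarrow> s i j \<in> carrier R"
    and "\<And>j. j < q \<Longrightarrow> x j \<in> carrier M"
  shows "lincomb M n r (\<lambda>i. lincomb M q (s i) x) =
    lincomb M q (\<lambda>j. lincomb (regular_module R) n r (\<lambda>i. s i j)) x"
proof -
  interpret RR: left_module R "regular_module R"
    by (rule left_module_regular) (rule R.ring_axioms)
  show ?thesis
    using assms(1,2)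
  proof (induction n)
    case (Suc n)
    have [simp]: "lincomb (regular_module R) n r (\<lambda>i. s i j) \<in> carrier R" if "j < q" for j
      using RR.lincomb_closed[of n r "\<lambda>i. s i j"] Suc.prems that by simp
    have "lincomb M q (\<lambda>j. lincomb (regular_module R) (Suc n) r (\<lambda>i. s i j)) x =
      lincomb M q (\<lambda>j. lincomb (regular_module R) n r (\<lambda>i. s i j)) x \<oplus>\<^bsub>M\<^esub>
        lincomb M q (\<lambda>j. r n \<otimes> s n j) x"
      using Suc.prems assms(3) by (simp add: lincomb_add_left)
    then show ?case
      using Suc assms(3) by (simp add: lincomb_smult)
  qed (use assms(3) in simp)
qed

lemma lincomb_unit_left:
  assumes "j < n" "\<And>i. i < n \<Longrightarrow> w i \<in> carrier M"
  shows "lincomb M n (\<lambda>i. if i = j then \<one> else \<zero>) w = w j"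
proof -
  \<comment> \<open>Partial sums make the induction possible: they are zero up to position
    \<open>j\<close> and constant afterwards.\<close>
  have "lincomb M m (\<lambda>i. if i = j then \<one> else \<zero>) w = (if j < m then w j else \<zero>\<^bsub>M\<^esub>)"
    if "m \<le> n" for m
    using that assms by (induction m) (auto simp: smult_one less_Suc_eq)
  then show ?thesis
    using assms by simp
qed

lemma lincomb_append:
  "lincomb M (m + n) r w = lincomb M m r w \<oplus>\<^bsub>M\<^esub> lincomb M n (\<lambda>i. r (m + i)) (\<lambda>i. w (m + i))"
  if "\<And>i. i < m + n \<Longrightarrow> r i \<in> carrier R" "\<And>i. i < m + n \<Longrightarrow> w i \<in> carrier M"
  using that by (induction n) (auto simp: M.a_assoc smult_closed)

end

lemma lincomb_regular_unit_right:
  assumes "ring R" "j < n" "\<And>i. i < n \<Longrightarrow> r i \<in> carrier R"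
  shows "lincomb (regular_module R) n r (\<lambda>i. if i = j then \<one>\<^bsub>R\<^esub> else \<zero>\<^bsub>R\<^esub>) = r j"
proof -
  interpret ring R by fact
  have "lincomb (regular_module R) m r (\<lambda>i. if i = j then \<one>\<^bsub>R\<^esub> else \<zero>\<^bsub>R\<^esub>) =
      (if j < m then r j else \<zero>\<^bsub>R\<^esub>)" if "m \<le> n" for m
    using that assms(3) assms(2) by (induction m) (auto simp: less_Suc_eq)
  then show ?thesis
    using assms by simp
qed

text \<open>Generators are the first \<open>n\<close> terms of a sequence, so that coefficients with
  respect to them can serve as matrix rows.\<close>

definition generates :: "'a ring \<Rightarrow> ('a, 'm) module \<Rightarrow> nat \<Rightarrow> (nat \<Rightarrow> 'm) \<Rightarrow> bool" where
  "generates R M n w \<longleftrightarrow> (\<forall>i<n. w i \<in> carrier M) \<and>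
     (\<forall>x\<in>carrier M. \<exists>r. (\<forall>i<n. r i \<in> carrier R) \<and> x = lincomb M n r w)"

lemma (in left_module) submodule_span:
  assumes "\<And>i. i < n \<Longrightarrow> w i \<in> carrier M"
  shows "submodule {lincomb M n r w | r. \<forall>i<n. r i \<in> carrier R} R M"
proof (rule submoduleI)
  let ?H = "{lincomb M n r w | r. \<forall>i<n. r i \<in> carrier R}"
  show "?H \<subseteq> carrier M"
    using assms by auto
  show "\<zero>\<^bsub>M\<^esub> \<in> ?H"
    using lincomb_zero_left[of n w, symmetric] assms
    by (intro CollectI exI[of _ "\<lambda>i. \<zero>"]) auto
  show "x \<oplus>\<^bsub>M\<^esub> y \<in> ?H" if x: "x \<in> ?H" and y: "y \<in> ?H" for x y
  proof -
    obtain r s where "\<forall>i<n. r i \<in> carrier R" "\<forall>i<n. s i \<in> carrier R"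
      "x = lincomb M n r w" "y = lincomb M n s w"
      using x y by blast
    with assms show ?thesis
      by (intro CollectI exI[of _ "\<lambda>i. r i \<oplus> s i"]) (simp add: lincomb_add_left)
  qed
  show "a \<odot>\<^bsub>M\<^esub> x \<in> ?H" if a: "a \<in> carrier R" and x: "x \<in> ?H" for a x
  proof -
    obtain r where "\<forall>i<n. r i \<in> carrier R" "x = lincomb M n r w"
      using x by blast
    with assms a show ?thesis
      by (intro CollectI exI[of _ "\<lambda>i. a \<otimes> r i"]) (simp add: lincomb_smult)
  qed
qed

text \<open>The span of a list is the least submodule containing it. This trades the quantifier over
  submodules in \<open>fin_gen\<close> for explicit coefficients, the form in which finite
  generation is used from here on.\<close>

lemma (in left_module) fin_gen_iff: "fin_gen R M \<longleftrightarrow> (\<exists>n w. generates R M n w)"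
proof
  assume "fin_gen R M"
  then obtain S where S: "finite S" "S \<subseteq> carrier M"
      "\<forall>H. submodule H R M \<and> S \<subseteq> H \<longrightarrow> H = carrier M"
    unfolding fin_gen_def by metis
  obtain w and n :: nat where w: "S = w ` {..<n}"
    using finite_imp_nat_seg_image_inj_on[OF S(1)] by (auto simp: lessThan_def)
  have wM: "w i \<in> carrier M" if "i < n" for i
    using that S(2) w by auto
  let ?H = "{lincomb M n r w | r. \<forall>i<n. r i \<in> carrier R}"
  have "w j \<in> ?H" if "j < n" for j
    using lincomb_unit_left[OF that wM, symmetric]
    by (intro CollectI exI[of _ "\<lambda>i. if i = j then \<one> else \<zero>"]) auto
  then have "?H = carrier M"
    using S(3) submodule_span[of n w, OF wM] w by (metis (no_types, lifting) image_subsetI lessThan_iff)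
  then have "\<forall>x\<in>carrier M. \<exists>r. (\<forall>i<n. r i \<in> carrier R) \<and> x = lincomb M n r w"
    by auto
  then have "generates R M n w"
    by (simp add: generates_def wM)
  then show "\<exists>n w. generates R M n w"
    by blast
next
  assume "\<exists>n w. generates R M n w"
  then obtain n w where g: "generates R M n w" by blast
  have "H = carrier M" if H: "submodule H R M" "w ` {..<n} \<subseteq> H" for H
  proof
    interpret H: submodule H R M by fact
    show "H \<subseteq> carrier M" using H.subset by simp
    have "lincomb M m r w \<in> H" if "\<forall>i<m. r i \<in> carrier R" "m \<le> n" for m r
      using that H(2) H.one_closed H.m_closed by (induction m) (auto simp: image_subset_iff)
    then show "carrier M \<subseteq> H"
      using g unfolding generates_def by auto
  qed
  then show "fin_gen R M"
    unfolding fin_gen_def using g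
    by (intro exI[of _ "w ` {..<n}"]) (auto simp: generates_def)
qed


subsection \<open>Powers, transported copies and duals\<close>

text \<open>Tuples are extensional on \<open>{..<n}\<close>, which makes equality of tuples equality
  of functions; every operation restricts its result accordingly.\<close>

definition power_module :: "('a, 'm) module \<Rightarrow> nat \<Rightarrow> ('a, nat \<Rightarrow> 'm) module" where
  "power_module M n = \<lparr>carrier = {..<n} \<rightarrow>\<^sub>E carrier M, monoid.mult = undefined, one = undefined,
     zero = (\<lambda>i\<in>{..<n}. \<zero>\<^bsub>M\<^esub>), add = (\<lambda>v w. \<lambda>i\<in>{..<n}. v i \<oplus>\<^bsub>M\<^esub> w i),
     smult = (\<lambda>a v. \<lambda>i\<in>{..<n}. a \<odot>\<^bsub>M\<^esub> v i)\<rparr>"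

lemma power_module_simps:
  "carrier (power_module M n) = {..<n} \<rightarrow>\<^sub>E carrier M"
  "\<zero>\<^bsub>power_module M n\<^esub> = (\<lambda>i\<in>{..<n}. \<zero>\<^bsub>M\<^esub>)"
  "v \<oplus>\<^bsub>power_module M n\<^esub> w = (\<lambda>i\<in>{..<n}. v i \<oplus>\<^bsub>M\<^esub> w i)"
  "a \<odot>\<^bsub>power_module M n\<^esub> v = (\<lambda>i\<in>{..<n}. a \<odot>\<^bsub>M\<^esub> v i)"
  by (simp_all add: power_module_def)

lemma left_module_power_module:
  assumes "left_module R M"
  shows "left_module R (power_module M n)"
proof -
  interpret left_module R M by fact
  have [simp]: "v i \<in> carrier M" if "v \<in> {..<n} \<rightarrow>\<^sub>E carrier M" "i < n" for v i
    using that by auto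
  have [simp]: "v i = undefined" if "v \<in> {..<n} \<rightarrow>\<^sub>E carrier M" "\<not> i < n" for v i
    using that by auto
  show ?thesis
    by (rule left_moduleI)
      (auto simp: power_module_simps R.ring_axioms smult_closed smult_l_distr smult_r_distr
        smult_assoc smult_one smult_minus_one fun_eq_iff M.a_ac M.r_neg)
qed

lemma lincomb_power_module:
  assumes "k < n"
  shows "lincomb (power_module M n) m r w k = lincomb M m r (\<lambda>i. w i k)"
  using assms by (induction m) (auto simp: power_module_simps)

abbreviation free_module :: "'a ring \<Rightarrow> nat \<Rightarrow> ('a, nat \<Rightarrow> 'a) module" where
  "free_module R n \<equiv> power_module (regular_module R) n"

abbreviation unit_vector :: "'a ring \<Rightarrow> nat \<Rightarrow> nat \<Rightarrow> nat \<Rightarrow> 'a" where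
  "unit_vector R n j \<equiv> (\<lambda>i\<in>{..<n}. if i = j then \<one>\<^bsub>R\<^esub> else \<zero>\<^bsub>R\<^esub>)"

lemma unit_vector_closed [simp]:
  assumes "ring R"
  shows "unit_vector R n j \<in> carrier (free_module R n)"
proof -
  interpret ring R by fact
  show ?thesis
    by (auto simp: power_module_simps)
qed

lemma lincomb_unit_vector:
  assumes "ring R" "v \<in> carrier (free_module R n)"
  shows "lincomb (free_module R n) n v (unit_vector R n) = v"
proof
  fix k
  interpret F: left_module R "free_module R n"
    by (intro left_module_power_module left_module_regular) fact
  have v: "v i \<in> carrier R" if "i < n" for i
    using assms that by (auto simp: power_module_simps)
  show "lincomb (free_module R n) n v (unit_vector R n) k = v k"
  proof (cases "k < n")
    case True
    have "lincomb (regular_module R) n v (\<lambda>i. unit_vector R n i k) =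
      lincomb (regular_module R) n v (\<lambda>i. if i = k then \<one>\<^bsub>R\<^esub> else \<zero>\<^bsub>R\<^esub>)"
      using True by (intro lincomb_cong) auto
    with True v show ?thesis
      by (simp add: lincomb_power_module lincomb_regular_unit_right[OF assms(1)])
  next
    \<comment> \<open>From \<open>n\<close> onwards both tuples have the default value
      \<open>undefined\<close>, the left one because it belongs to the extensional carrier.\<close>
    case False
    have "lincomb (free_module R n) n v (unit_vector R n)
        \<in> carrier (free_module R n)" (is "?l \<in> _")
      by (intro F.lincomb_closed v unit_vector_closed assms(1))
    then have "?l k = undefined"
      using False unfolding power_module_simps(1) by (intro PiE_arb[of ?l]) auto
    moreover have "v k = undefined"
      using False assms(2) by (auto simp: power_module_simps(1))
    ultimately show ?thesis
      by (rule trans[OF _ sym])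
  qed
qed

lemma generates_unit_vector:
  assumes "ring R"
  shows "generates R (free_module R n) n (unit_vector R n)"
  unfolding generates_def
proof (intro conjI allI impI ballI)
  fix v assume v: "v \<in> carrier (free_module R n)"
  then show "\<exists>r. (\<forall>i<n. r i \<in> carrier R) \<and>
      v = lincomb (free_module R n) n r (unit_vector R n)"
    using lincomb_unit_vector[OF assms v, symmetric]
    by (intro exI[of _ v] conjI) (auto simp: power_module_simps(1))
qed (use assms in simp)

text \<open>The map out of a free module that sends the standard basis to \<open>w\<close>. For
  generators \<open>w\<close> it is the free cover from which presentations start.\<close>

definition free_map :: "'a ring \<Rightarrow> ('a, 'm) module \<Rightarrow> nat \<Rightarrow> (nat \<Rightarrow> 'm) \<Rightarrow> (nat \<Rightarrow> 'a) \<Rightarrow> 'm" where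
  "free_map R M n w = (\<lambda>v\<in>carrier (free_module R n). lincomb M n v w)"

lemma free_map_hom:
  assumes "left_module R M" "\<And>i. i < n \<Longrightarrow> w i \<in> carrier M"
  shows "free_map R M n w \<in> mod_hom R (free_module R n) M"
proof -
  interpret M: left_module R M by fact
  let ?F = "free_module R n"
  have F: "left_module R ?F"
    by (intro left_module_power_module left_module_regular M.R.ring_axioms)
  have v: "v i \<in> carrier R" if "v \<in> carrier ?F" "i < n" for v i
    using that by (auto simp: power_module_simps)
  show ?thesis
    unfolding free_map_def
  proof (rule mod_hom_restrictI[OF F])
    show "lincomb M n v w \<in> carrier M" if "v \<in> carrier ?F" for v
      using v[OF that] assms(2) by simp
    show "lincomb M n (u \<oplus>\<^bsub>?F\<^esub> v) w = lincomb M n u w \<oplus>\<^bsub>M\<^esub> lincomb M n v w"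
      if "u \<in> carrier ?F" "v \<in> carrier ?F" for u v
    proof -
      have "lincomb M n (u \<oplus>\<^bsub>?F\<^esub> v) w = lincomb M n (\<lambda>i. u i \<oplus>\<^bsub>R\<^esub> v i) w"
        by (rule lincomb_cong) (auto simp: power_module_simps)
      then show ?thesis
        using v[OF that(1)] v[OF that(2)] assms(2) by (simp add: M.lincomb_add_left)
    qed
    show "lincomb M n (a \<odot>\<^bsub>?F\<^esub> v) w = a \<odot>\<^bsub>M\<^esub> lincomb M n v w"
      if "a \<in> carrier R" "v \<in> carrier ?F" for a v
    proof -
      have "lincomb M n (a \<odot>\<^bsub>?F\<^esub> v) w = lincomb M n (\<lambda>i. a \<otimes>\<^bsub>R\<^esub> v i) w"
        by (rule lincomb_cong) (auto simp: power_module_simps)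
      then show ?thesis
        using v[OF that(2)] that(1) assms(2) by (simp add: M.lincomb_smult)
    qed
  qed
qed

text \<open>Transport of structure along a map \<open>h\<close> that is meant to be injective. It
  moves free modules from the type of tuples into the universe \<open>'u\<close>, where injectivity,
  projectivity and flatness can be tested. The operations go back along a chosen inverse of
  \<open>h\<close>.\<close>

definition image_module :: "('m \<Rightarrow> 'n) \<Rightarrow> ('a, 'm) module \<Rightarrow> ('a, 'n) module" where
  "image_module h M = (let g = inv_into (carrier M) h in
     \<lparr>carrier = h ` carrier M, monoid.mult = undefined, one = undefined, zero = h \<zero>\<^bsub>M\<^esub>,
       add = (\<lambda>x y. h (g x \<oplus>\<^bsub>M\<^esub> g y)), smult = (\<lambda>a x. h (a \<odot>\<^bsub>M\<^esub> g x))\<rparr>)"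

lemma image_module_simps:
  assumes "inj_on h (carrier M)" "x \<in> carrier M" "y \<in> carrier M"
  shows "h x \<oplus>\<^bsub>image_module h M\<^esub> h y = h (x \<oplus>\<^bsub>M\<^esub> y)"
    "a \<odot>\<^bsub>image_module h M\<^esub> h x = h (a \<odot>\<^bsub>M\<^esub> x)"
  using assms by (simp_all add: image_module_def Let_def)

lemma image_module_zero_carrier [simp]:
  "\<zero>\<^bsub>image_module h M\<^esub> = h \<zero>\<^bsub>M\<^esub>" "carrier (image_module h M) = h ` carrier M"
  by (simp_all add: image_module_def Let_def)

lemma left_module_image_module:
  assumes "left_module R M" "inj_on h (carrier M)"
  shows "left_module R (image_module h M)"
proof -
  interpret left_module R M by fact
  show ?thesis
    by (rule left_moduleI)
      (auto simp: image_module_simps[OF assms(2)] R.ring_axioms smult_closed smult_l_distr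
        smult_r_distr smult_assoc smult_one smult_minus_one M.a_ac M.r_neg)
qed

lemma image_module_hom:
  assumes "left_module R M" "inj_on h (carrier M)"
  shows "restrict h (carrier M) \<in> mod_hom R M (image_module h M)"
  by (rule mod_hom_restrictI) (auto simp: assms image_module_simps)

lemma image_module_inv_hom:
  assumes "left_module R M" "inj_on h (carrier M)"
  shows "restrict (inv_into (carrier M) h) (h ` carrier M) \<in> mod_hom R (image_module h M) M"
proof -
  interpret left_module R M by fact
  have "restrict (inv_into (carrier M) h) (carrier (image_module h M)) \<in> mod_hom R (image_module h M) M"
    by (rule mod_hom_restrictI)
      (auto simp: left_module_image_module[OF assms] assms image_module_simps[OF assms(2)] smult_closed)
  then show ?thesis by simp
qed

section \<open>Dual modules and the evaluation map\<close>

lemma dual_simps: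
  "carrier (dual R M) = mod_hom R M (regular_module R)"
  "\<zero>\<^bsub>dual R M\<^esub> = (\<lambda>x\<in>carrier M. \<zero>\<^bsub>R\<^esub>)"
  "f \<oplus>\<^bsub>dual R M\<^esub> g = (\<lambda>x\<in>carrier M. f x \<oplus>\<^bsub>R\<^esub> g x)"
  "a \<odot>\<^bsub>dual R M\<^esub> f = (\<lambda>x\<in>carrier M. f x \<otimes>\<^bsub>R\<^esub> a)"
  by (simp_all add: dual_def)

lemma dual_closed: "f \<in> carrier (dual R M) \<Longrightarrow> x \<in> carrier M \<Longrightarrow> f x \<in> carrier R"
  using mod_hom_closed[of f R M "regular_module R" x] by (simp add: dual_simps)

lemma dual_add: 
  "f \<in> carrier (dual R M) \<Longrightarrow> x \<in> carrier M \<Longrightarrow> y \<in> carrier M \<Longrightarrow> f (x \<oplus>\<^bsub>M\<^esub> y) = f x \<oplus>\<^bsub>R\<^esub> f y"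
  using mod_hom_add[of f R M "regular_module R" x y] by (simp add: dual_simps)

lemma dual_smult: 
  "f \<in> carrier (dual R M) \<Longrightarrow> a \<in> carrier R \<Longrightarrow> x \<in> carrier M \<Longrightarrow> f (a \<odot>\<^bsub>M\<^esub> x) = a \<otimes>\<^bsub>R\<^esub> f x"
  using mod_hom_smult[of f R M "regular_module R" a x] by (simp add: dual_simps)

lemma dual_undefined: "f \<in> carrier (dual R M) \<Longrightarrow> x \<notin> carrier M \<Longrightarrow> f x = undefined"
  using mod_hom_extensional[of f R M "regular_module R" x] by (simp add: dual_simps)

lemma dual_eqI:
  "f \<in> carrier (dual R M) \<Longrightarrow> g \<in> carrier (dual R M) \<Longrightarrow> (\<And>x. x \<in> carrier M \<Longrightarrow> f x = g x) \<Longrightarrow> f = g"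
  by (simp add: dual_simps mod_hom_eqI)

lemma dual_restrictI:
  assumes "left_module R M" "\<And>x. x \<in> carrier M \<Longrightarrow> f x \<in> carrier R"
    and "\<And>x y. x \<in> carrier M \<Longrightarrow> y \<in> carrier M \<Longrightarrow> f (x \<oplus>\<^bsub>M\<^esub> y) = f x \<oplus>\<^bsub>R\<^esub> f y"
    and "\<And>a x. a \<in> carrier R \<Longrightarrow> x \<in> carrier M \<Longrightarrow> f (a \<odot>\<^bsub>M\<^esub> x) = a \<otimes>\<^bsub>R\<^esub> f x"
  shows "(\<lambda>x\<in>carrier M. f x) \<in> carrier (dual R M)"
  unfolding dual_simps using assms by (intro mod_hom_restrictI) auto

lemma left_module_dual:
  assumes "left_module R M"
  shows "left_module (op_ring R) (dual R M)"
proof -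
  interpret left_module R M by fact
  show ?thesis
  proof (rule left_moduleI)
    show "\<zero>\<^bsub>dual R M\<^esub> \<in> carrier (dual R M)"
      unfolding dual_simps(2) by (rule dual_restrictI) (auto simp: assms)
    show "f \<oplus>\<^bsub>dual R M\<^esub> g \<in> carrier (dual R M)"
      if "f \<in> carrier (dual R M)" "g \<in> carrier (dual R M)" for f g
      unfolding dual_simps(3) using that
      by (intro dual_restrictI) (auto simp: assms dual_add dual_smult dual_closed[of _ R M] R.a_ac R.r_distr)
    show "a \<odot>\<^bsub>dual R M\<^esub> f \<in> carrier (dual R M)"
      if "a \<in> carrier (op_ring R)" "f \<in> carrier (dual R M)" for a f
      unfolding dual_simps(4) using that
      by (intro dual_restrictI) (auto simp: assms dual_add dual_smult dual_closed[of _ R M] R.m_assoc R.l_distr)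
  next
    fix f assume f: "f \<in> carrier (dual R M)"
    \<comment> \<open>Reversing the multiplication leaves the additive group alone, so -1 is the
      same in both rings.\<close>
    have "\<ominus>\<^bsub>op_ring R\<^esub> \<one>\<^bsub>op_ring R\<^esub> = \<ominus>\<^bsub>R\<^esub> \<one>\<^bsub>R\<^esub>"
      unfolding a_inv_def m_inv_def by (simp add: op_ring_def)
    then show "(\<ominus>\<^bsub>op_ring R\<^esub> \<one>\<^bsub>op_ring R\<^esub>) \<odot>\<^bsub>dual R M\<^esub> f \<oplus>\<^bsub>dual R M\<^esub> f = \<zero>\<^bsub>dual R M\<^esub>"
      using f by (auto simp: dual_simps(2-4) fun_eq_iff dual_closed[OF f] R.r_minus R.l_neg)
  qed (auto simp: R.ring_axioms dual_simps(2-4) fun_eq_iff dual_closed[of _ R M] R.a_ac R.r_distr R.l_distr R.m_assoc dual_undefined[of _ R M])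
qed

lemma left_module_double_dual:
  assumes "left_module R M"
  shows "left_module R (double_dual R M)"
  using left_module_dual[OF left_module_dual[OF assms]] by (simp add: double_dual_def)

lemma evaluation_hom:
  assumes "left_module R M"
  shows "evaluation R M \<in> mod_hom R M (double_dual R M)"
proof -
  interpret left_module R M by fact
  have "(\<lambda>f\<in>carrier (dual R M). f x) \<in> carrier (double_dual R M)" if "x \<in> carrier M" for x
    unfolding double_dual_def using that
    by (intro dual_restrictI left_module_dual assms) (auto simp: dual_simps(3,4) dual_closed[of _ R M])
  then show ?thesis
    unfolding evaluation_def
    by (intro mod_hom_restrictI)
      (auto simp: assms double_dual_def dual_simps(3,4)[where R="op_ring R"] dual_add dual_smult fun_eq_iff smult_closed)
qed

lemma evaluation_apply [simp]:
  "x \<in> carrier M \<Longrightarrow> f \<in> carrier (dual R M) \<Longrightarrow> evaluation R M x f = f x"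
  by (simp add: evaluation_def)


subsection \<open>Finite generation\<close>

lemma submoduleD:
  assumes "submodule H R M"
  shows "H \<subseteq> carrier M" "\<zero>\<^bsub>M\<^esub> \<in> H" "\<And>x y. x \<in> H \<Longrightarrow> y \<in> H \<Longrightarrow> x \<oplus>\<^bsub>M\<^esub> y \<in> H"
    "\<And>x. x \<in> H \<Longrightarrow> \<ominus>\<^bsub>M\<^esub> x \<in> H" "\<And>a x. a \<in> carrier R \<Longrightarrow> x \<in> H \<Longrightarrow> a \<odot>\<^bsub>M\<^esub> x \<in> H"
proof -
  interpret submodule H R M by fact
  show "H \<subseteq> carrier M" by (rule subset[simplified])
  show "\<zero>\<^bsub>M\<^esub> \<in> H" using one_closed by simp
  show "x \<oplus>\<^bsub>M\<^esub> y \<in> H" if "x \<in> H" "y \<in> H" for x y using m_closed[OF that] by simp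
  show "\<ominus>\<^bsub>M\<^esub> x \<in> H" if "x \<in> H" for x using m_inv_closed[OF that] by (simp add: a_inv_def)
  show "a \<odot>\<^bsub>M\<^esub> x \<in> H" if "a \<in> carrier R" "x \<in> H" for a x using that by simp
qed

lemma submodule_lincomb_closed:
  assumes "submodule H R M" "\<And>i. i < n \<Longrightarrow> r i \<in> carrier R" "\<And>i. i < n \<Longrightarrow> w i \<in> H"
  shows "lincomb M n r w \<in> H"
  using assms(2,3) by (induction n) (auto intro!: submoduleD[OF assms(1)])

lemma lincomb_carrier_update [simp]: "lincomb (M\<lparr>carrier := H\<rparr>) n r w = lincomb M n r w"
  by (induction n) auto

lemma a_kernel_iff: "x \<in> a_kernel M N f \<longleftrightarrow> x \<in> carrier M \<and> f x = \<zero>\<^bsub>N\<^esub>"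
  by (simp add: a_kernel_def')

lemma submodule_a_kernel:
  assumes "f \<in> mod_hom R M N" "left_module R M" "left_module R N"
  shows "submodule (a_kernel M N f) R M"
proof -
  interpret M: left_module R M by fact
  interpret N: left_module R N by fact
  show ?thesis
    by (rule M.submoduleI)
      (auto simp: a_kernel_iff mod_hom_zero[OF assms] mod_hom_add[OF assms(1)]
        mod_hom_smult[OF assms(1)] M.smult_closed)
qed

lemma generates_closed: "generates R M n w \<Longrightarrow> i < n \<Longrightarrow> w i \<in> carrier M"
  by (simp add: generates_def)

lemma generatesE:
  assumes "generates R M n w" "x \<in> carrier M"
  obtains r where "\<And>i. i < n \<Longrightarrow> r i \<in> carrier R" "x = lincomb M n r w"
  using assms unfolding generates_def by metis

lemma free_map_surj:
  assumes "left_module R M" "generates R M n w"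
  shows "free_map R M n w ` carrier (free_module R n) = carrier M"
proof
  note hom = free_map_hom[OF assms(1) generates_closed[OF assms(2)]]
  show "free_map R M n w ` carrier (free_module R n) \<subseteq> carrier M"
    using mod_hom_closed[OF hom] by auto
  show "carrier M \<subseteq> free_map R M n w ` carrier (free_module R n)"
  proof
    fix x assume "x \<in> carrier M"
    then obtain r where r: "\<And>i. i < n \<Longrightarrow> r i \<in> carrier R" "x = lincomb M n r w"
      using generatesE[OF assms(2)] by blast
    have "restrict r {..<n} \<in> carrier (free_module R n)"
      using r(1) by (auto simp: power_module_simps)
    moreover have "lincomb M n (restrict r {..<n}) w = lincomb M n r w"
      by (rule lincomb_cong) auto
    ultimately show "x \<in> free_map R M n w ` carrier (free_module R n)"
      using r(2) by (intro image_eqI[of _ _ "restrict r {..<n}"]) (auto simp: free_map_def)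
  qed
qed

lemma lincomb_concat:
  assumes "left_module R M"
    and "\<And>i. i < m \<Longrightarrow> r i \<in> carrier R" "\<And>i. i < m \<Longrightarrow> v i \<in> carrier M"
    and "\<And>i. i < n \<Longrightarrow> s i \<in> carrier R" "\<And>i. i < n \<Longrightarrow> w i \<in> carrier M"
  shows "lincomb M (m + n) (\<lambda>i. if i < m then r i else s (i - m))
      (\<lambda>i. if i < m then v i else w (i - m)) = lincomb M m r v \<oplus>\<^bsub>M\<^esub> lincomb M n s w"
proof -
  interpret left_module R M by fact
  have 1: "lincomb M m (\<lambda>i. if i < m then r i else s (i - m)) (\<lambda>i. if i < m then v i else w (i - m))
      = lincomb M m r v"
    by (rule lincomb_cong) auto
  show ?thesis
    using assms by (subst lincomb_append) (auto simp: 1)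
qed

lemma noetherian_submodule_generators:
  assumes noeth: "left_noetherian R" and M: "left_module R M"
    and "submodule H R M" and w: "\<And>i. i < n \<Longrightarrow> w i \<in> carrier M"
    and "\<And>x. x \<in> H \<Longrightarrow> \<exists>r. (\<forall>i<n. r i \<in> carrier R) \<and> x = lincomb M n r w"
  shows "\<exists>m v. generates R (M\<lparr>carrier := H\<rparr>) m v"
  using assms(3-)
proof (induction n arbitrary: H)
  case 0
  then show ?case
    by (intro exI[of _ 0]) (auto simp: generates_def)
next
  case (Suc n)
  interpret M: left_module R M by fact
  interpret RR: left_module R "regular_module R"
    by (rule left_module_regular) (rule M.R.ring_axioms)
  note H = submoduleD[OF Suc.prems(1)]
  have w: "w i \<in> carrier M" if "i \<le> n" for i
    using Suc.prems(2) that by simp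
  define S where "S = {lincomb M n r w | r. \<forall>i<n. r i \<in> carrier R}"
  have "submodule S R M"
    unfolding S_def by (rule M.submodule_span) (simp add: w)
  note S = submoduleD[OF this]
  have "submodule (H \<inter> S) R M"
    by (rule M.submoduleI) (use H S in auto)
  then obtain m v where gv: "generates R (M\<lparr>carrier := H \<inter> S\<rparr>) m v"
    using Suc.IH[of "H \<inter> S"] w unfolding S_def by auto
  \<comment> \<open>Leading coefficients: \<open>a\<close> belongs to \<open>I\<close> when some
    element of \<open>H\<close> is \<open>a\<close> times \<open>w n\<close> plus an element of the
    span \<open>S\<close> of the earlier generators.\<close>
  define I where "I = {a \<in> carrier R. \<exists>u\<in>S. u \<oplus>\<^bsub>M\<^esub> a \<odot>\<^bsub>M\<^esub> w n \<in> H}"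
  have subI: "submodule I R (regular_module R)"
  proof (rule RR.submoduleI)
    show "I \<subseteq> carrier (regular_module R)"
      by (auto simp: I_def)
    show "\<zero>\<^bsub>regular_module R\<^esub> \<in> I"
      using S H(2) w by (auto simp: I_def intro!: bexI[of _ "\<zero>\<^bsub>M\<^esub>"])
  next
    fix a b assume "a \<in> I" "b \<in> I"
    then obtain u u' where u: "a \<in> carrier R" "b \<in> carrier R" "u \<in> S" "u' \<in> S"
      "u \<oplus>\<^bsub>M\<^esub> a \<odot>\<^bsub>M\<^esub> w n \<in> H" "u' \<oplus>\<^bsub>M\<^esub> b \<odot>\<^bsub>M\<^esub> w n \<in> H"
      by (auto simp: I_def)
    moreover have "u \<in> carrier M" "u' \<in> carrier M"
      using u S(1) by auto
    ultimately have "(u \<oplus>\<^bsub>M\<^esub> u') \<oplus>\<^bsub>M\<^esub> (a \<oplus>\<^bsub>R\<^esub> b) \<odot>\<^bsub>M\<^esub> w n =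
        (u \<oplus>\<^bsub>M\<^esub> a \<odot>\<^bsub>M\<^esub> w n) \<oplus>\<^bsub>M\<^esub> (u' \<oplus>\<^bsub>M\<^esub> b \<odot>\<^bsub>M\<^esub> w n)"
      using w by (simp add: M.smult_l_distr M.smult_closed M.a_ac)
    with H(3)[OF u(5,6)] S(3)[OF u(3,4)] u(1,2) show "a \<oplus>\<^bsub>regular_module R\<^esub> b \<in> I"
      unfolding I_def by (auto intro!: bexI[of _ "u \<oplus>\<^bsub>M\<^esub> u'"])
  next
    fix a b assume "a \<in> carrier R" "b \<in> I"
    then obtain u where u: "a \<in> carrier R" "b \<in> carrier R" "u \<in> S" "u \<oplus>\<^bsub>M\<^esub> b \<odot>\<^bsub>M\<^esub> w n \<in> H"
      by (auto simp: I_def)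
    moreover have "u \<in> carrier M"
      using u S(1) by auto
    ultimately have "a \<odot>\<^bsub>M\<^esub> u \<oplus>\<^bsub>M\<^esub> (a \<otimes>\<^bsub>R\<^esub> b) \<odot>\<^bsub>M\<^esub> w n = a \<odot>\<^bsub>M\<^esub> (u \<oplus>\<^bsub>M\<^esub> b \<odot>\<^bsub>M\<^esub> w n)"
      using w by (simp add: M.smult_r_distr M.smult_closed M.smult_assoc)
    with H(5)[OF u(1,4)] S(5)[OF u(1,3)] u(1,2) show "a \<odot>\<^bsub>regular_module R\<^esub> b \<in> I"
      unfolding I_def by (auto intro!: bexI[of _ "a \<odot>\<^bsub>M\<^esub> u"])
  qed
  then have "fin_gen R ((regular_module R)\<lparr>carrier := I\<rparr>)"
    using noeth by (simp add: left_noetherian_def)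
  then obtain p a where ga: "generates R ((regular_module R)\<lparr>carrier := I\<rparr>) p a"
    using left_module.fin_gen_iff[OF RR.left_module_submodule[OF subI]] by auto
  have "\<exists>u. u \<in> S \<and> u \<oplus>\<^bsub>M\<^esub> a j \<odot>\<^bsub>M\<^esub> w n \<in> H" if "j < p" for j
    using generates_closed[OF ga that] by (auto simp: I_def)
  then obtain u where u: "\<And>j. j < p \<Longrightarrow> u j \<in> S" "\<And>j. j < p \<Longrightarrow> u j \<oplus>\<^bsub>M\<^esub> a j \<odot>\<^bsub>M\<^esub> w n \<in> H"
    by metis
  \<comment> \<open>\<open>y j\<close> is an element of \<open>H\<close> whose leading coefficient
    is the ideal generator \<open>a j\<close>.\<close>
  define y where "y j = u j \<oplus>\<^bsub>M\<^esub> a j \<odot>\<^bsub>M\<^esub> w n" for j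
  have yH: "y j \<in> H" "y j \<in> carrier M" if "j < p" for j
    using u(2)[OF that] H(1) by (auto simp: y_def)
  have aR: "a j \<in> carrier R" if "j < p" for j
    using generates_closed[OF ga that] by (auto simp: I_def)
  have uM: "u j \<in> carrier M" if "j < p" for j
    using u(1)[OF that] S(1) by auto
  have vH: "v i \<in> H" "v i \<in> carrier M" if "i < m" for i
    using generates_closed[OF gv that] H(1) by auto
  show ?case
  proof (intro exI, unfold generates_def, intro conjI allI impI ballI)
    fix i assume "i < m + p"
    then show "(if i < m then v i else y (i - m)) \<in> carrier (M\<lparr>carrier := H\<rparr>)"
      using vH yH by auto
  next
    fix x assume "x \<in> carrier (M\<lparr>carrier := H\<rparr>)"
    then have xH: "x \<in> H" by simp
    then obtain r where r: "\<And>i. i \<le> n \<Longrightarrow> r i \<in> carrier R" "x = lincomb M (Suc n) r w"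
      using Suc.prems(3) by (metis less_Suc_eq_le)
    have xu: "lincomb M n r w \<in> S"
      using r by (auto simp: S_def)
    then have "r n \<in> I"
      using r xH by (auto simp: I_def intro!: bexI[of _ "lincomb M n r w"])
    then obtain s where s: "\<And>i. i < p \<Longrightarrow> s i \<in> carrier R" "r n = lincomb (regular_module R) p s a"
      using generatesE[OF ga, of "r n"] by auto
    have sa: "lincomb (regular_module R) p s a \<in> carrier R"
      using r(1)[of n] s(2) by simp
    have lH: "lincomb M p s y \<in> H"
      by (rule submodule_lincomb_closed[OF Suc.prems(1)]) (use s yH in auto)
    have uS: "lincomb M p s u \<in> S"
      by (rule submodule_lincomb_closed[OF \<open>submodule S R M\<close>]) (use s u in auto)
    \<comment> \<open>The combination of the lifts with coefficients \<open>s\<close> has as its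
      leading coefficient the same combination of the ideal generators; partial sums allow the
      induction.\<close>
    have "lincomb M q s y = lincomb M q s u \<oplus>\<^bsub>M\<^esub> lincomb (regular_module R) q s a \<odot>\<^bsub>M\<^esub> w n" 
      if "q \<le> p" for q
      using that
    proof (induction q)
      case (Suc q)
      have "lincomb (regular_module R) q s a \<in> carrier R"
        using RR.lincomb_closed[of q s a] Suc.prems s aR by simp
      moreover have "lincomb M q s u \<in> carrier M"
        using Suc.prems s uM by (intro M.lincomb_closed) auto
      moreover have "s q \<in> carrier R" "a q \<in> carrier R" "u q \<in> carrier M" "w n \<in> carrier M"
        using s aR uM w Suc.prems by auto
      ultimately show ?case
        using Suc by (simp add: y_def M.smult_closed M.smult_r_distr M.smult_l_distr M.smult_assoc M.a_ac)
    qed (use w in simp)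
    then have ly: "lincomb M p s y = lincomb M p s u \<oplus>\<^bsub>M\<^esub> r n \<odot>\<^bsub>M\<^esub> w n"
      using s(2) by simp
    have cM: "lincomb M n r w \<in> carrier M" "lincomb M p s u \<in> carrier M" "r n \<odot>\<^bsub>M\<^esub> w n \<in> carrier M"
      using xu uS S(1) r(1) w M.smult_closed by auto
    \<comment> \<open>The terms at \<open>w n\<close> cancel, so the difference lies in
      \<open>S\<close> as well as in \<open>H\<close>, where the induction hypothesis has supplied
      generators.\<close>
    have "x \<ominus>\<^bsub>M\<^esub> lincomb M p s y = lincomb M n r w \<ominus>\<^bsub>M\<^esub> lincomb M p s u"
      using cM by (simp add: r(2) ly a_minus_def M.minus_add M.a_ac M.r_neg M.r_neg1 M.r_neg2)
    then have "x \<ominus>\<^bsub>M\<^esub> lincomb M p s y \<in> S"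
      using xu uS S(3,4) by (simp add: a_minus_def)
    moreover have "x \<ominus>\<^bsub>M\<^esub> lincomb M p s y \<in> H"
      using xH lH H(3,4) by (simp add: a_minus_def)
    ultimately have "x \<ominus>\<^bsub>M\<^esub> lincomb M p s y \<in> H \<inter> S"
      by simp
    then obtain t where t: "\<And>i. i < m \<Longrightarrow> t i \<in> carrier R" "x \<ominus>\<^bsub>M\<^esub> lincomb M p s y = lincomb M m t v"
      using generatesE[OF gv, of "x \<ominus>\<^bsub>M\<^esub> lincomb M p s y"] by auto
    have "x = (x \<ominus>\<^bsub>M\<^esub> lincomb M p s y) \<oplus>\<^bsub>M\<^esub> lincomb M p s y"
      using subsetD[OF H(1) xH] subsetD[OF H(1) lH] by (simp add: a_minus_def M.a_assoc M.l_neg)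
    also have "\<dots> = lincomb M (m + p) (\<lambda>i. if i < m then t i else s (i - m))
        (\<lambda>i. if i < m then v i else y (i - m))"
      unfolding t(2) by (rule lincomb_concat[OF M, symmetric]) (use t s vH yH in auto)
    finally show "\<exists>r. (\<forall>i<m + p. r i \<in> carrier R) \<and>
        x = lincomb (M\<lparr>carrier := H\<rparr>) (m + p) r (\<lambda>i. if i < m then v i else y (i - m))"
      using t s by (intro exI[of _ "\<lambda>i. if i < m then t i else s (i - m)"]) auto
  qed
qed

text \<open>The image of \<open>K\<close> lies in the span of \<open>w\<close>, so the Noetherian
  property gives it finitely many generators; injectivity carries these and the coefficients back to
  \<open>K\<close>.\<close>

lemma generates_of_inj:
  assumes "left_noetherian R" "left_module R K" "left_module R X" "generates R X n w"
    and i: "i \<in> mod_hom R K X" "inj_on i (carrier K)"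
  shows "\<exists>m v. generates R K m v"
proof -
  interpret K: left_module R K by fact
  have "\<exists>m v. generates R (X\<lparr>carrier := i ` carrier K\<rparr>) m v"
  proof (rule noetherian_submodule_generators[OF assms(1,3) submodule_image[OF i(1) assms(2,3)]])
    show "w j \<in> carrier X" if "j < n" for j
      using generates_closed[OF assms(4) that] .
    show "\<exists>r. (\<forall>j<n. r j \<in> carrier R) \<and> x = lincomb X n r w" if "x \<in> i ` carrier K" for x
      using that mod_hom_closed[OF i(1)] assms(4) unfolding generates_def by auto
  qed
  then obtain m v where g: "generates R (X\<lparr>carrier := i ` carrier K\<rparr>) m v"
    by blast
  then have "\<exists>k. k \<in> carrier K \<and> i k = v j" if "j < m" for j
    using generates_closed[OF g that] by auto
  then obtain k where k: "\<And>j. j < m \<Longrightarrow> k j \<in> carrier K" "\<And>j. j < m \<Longrightarrow> i (k j) = v j"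
    by metis
  have "generates R K m k"
    unfolding generates_def
  proof (intro conjI allI impI ballI)
    fix x assume x: "x \<in> carrier K"
    then obtain r where r: "\<And>j. j < m \<Longrightarrow> r j \<in> carrier R" "i x = lincomb X m r v"
      using generatesE[OF g, of "i x"] by auto
    have "i (lincomb K m r k) = lincomb X m r (\<lambda>j. i (k j))"
      by (rule mod_hom_lincomb[OF i(1) assms(2,3)]) (use r k in auto)
    also have "\<dots> = i x"
      unfolding r(2) by (rule lincomb_cong) (use k in auto)
    finally have "lincomb K m r k = x"
      using i(2) x K.lincomb_closed[of m r k] r(1) k(1) by (simp add: inj_on_eq_iff)
    then show "\<exists>r. (\<forall>j<m. r j \<in> carrier R) \<and> x = lincomb K m r k"
      using r(1) by (intro exI[of _ r]) auto
  qed (use k in auto)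
  then show ?thesis by blast
qed

lemma generates_surj:
  assumes "generates R M n w" "left_module R M" "left_module R N"
    and f: "f \<in> mod_hom R M N" "f ` carrier M = carrier N"
  shows "generates R N n (\<lambda>i. f (w i))"
  unfolding generates_def
proof (intro conjI allI impI ballI)
  fix y assume "y \<in> carrier N"
  then obtain x where x: "x \<in> carrier M" "y = f x"
    using f(2) by auto
  then obtain r where r: "\<And>i. i < n \<Longrightarrow> r i \<in> carrier R" "x = lincomb M n r w"
    using generatesE[OF assms(1)] by blast
  then show "\<exists>r. (\<forall>i<n. r i \<in> carrier R) \<and> y = lincomb N n r (\<lambda>i. f (w i))"
    using mod_hom_lincomb[OF f(1) assms(2,3), of n r w] generates_closed[OF assms(1)] x(2)
    by (intro exI[of _ r]) auto
qed (use mod_hom_closed[OF f(1)] generates_closed[OF assms(1)] in auto)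

text \<open>The dual of the free cover R^n -> M, once functionals on R^n are identified with their
  values on the standard basis.\<close>

definition coordinates :: "'a ring \<Rightarrow> ('a, 'm) module \<Rightarrow> nat \<Rightarrow> (nat \<Rightarrow> 'm) \<Rightarrow> ('m \<Rightarrow> 'a) \<Rightarrow> nat \<Rightarrow> 'a" where
  "coordinates R M n w = (\<lambda>f\<in>carrier (dual R M). \<lambda>i\<in>{..<n}. f (w i))"

lemma coordinates_hom:
  assumes "left_module R M" "\<And>i. i < n \<Longrightarrow> w i \<in> carrier M"
  shows "coordinates R M n w \<in>
    mod_hom (op_ring R) (dual R M) (free_module (op_ring R) n)"
  unfolding coordinates_def
  by (rule mod_hom_restrictI)
    (auto simp: left_module_dual assms power_module_simps dual_simps(3,4) dual_closed fun_eq_iff)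

lemma dual_eq_on_generators:
  assumes "left_module R M" "generates R M n w" "f \<in> carrier (dual R M)" "g \<in> carrier (dual R M)"
    and "\<And>i. i < n \<Longrightarrow> f (w i) = g (w i)"
  shows "f = g"
proof (rule dual_eqI[OF assms(3,4)])
  interpret left_module R M by fact
  have RR: "left_module R (regular_module R)"
    by (rule left_module_regular) (rule R.ring_axioms)
  fix x assume "x \<in> carrier M"
  then obtain r where r: "\<And>i. i < n \<Longrightarrow> r i \<in> carrier R" "x = lincomb M n r w"
    using generatesE[OF assms(2)] by blast
  have "h (lincomb M n r w) = lincomb (regular_module R) n r (\<lambda>i. h (w i))"
    if "h \<in> carrier (dual R M)" for h
    using that r(1) generates_closed[OF assms(2)]
    by (intro mod_hom_lincomb[OF _ assms(1) RR]) (auto simp: dual_simps)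
  then show "f x = g x"
    using assms(3-5) r(2) lincomb_cong[of n r r "\<lambda>i. f (w i)" "\<lambda>i. g (w i)"] by metis
qed

lemma coordinates_inj:
  assumes "left_module R M" "generates R M n w"
  shows "inj_on (coordinates R M n w) (carrier (dual R M))"
proof (rule inj_onI)
  fix f g assume fg: "f \<in> carrier (dual R M)" "g \<in> carrier (dual R M)"
    "coordinates R M n w f = coordinates R M n w g"
  then have "f (w i) = g (w i)" if "i < n" for i
    using that by (auto simp: coordinates_def fun_eq_iff restrict_def split: if_splits dest: spec[of _ i])
  then show "f = g"
    by (rule dual_eq_on_generators[OF assms fg(1,2)])
qed

text \<open>Values on generators embed the dual into a free module over the opposite ring, so the
  Noetherian condition on the other side applies.\<close>

lemma generates_dual:
  assumes "left_noetherian (op_ring R)" "left_module R M" "generates R M n w"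
  shows "\<exists>m \<phi>. generates (op_ring R) (dual R M) m \<phi>"
proof -
  have "ring (op_ring R)"
    using assms(1) by (simp add: left_noetherian_def)
  then show ?thesis
    using assms
    by (intro generates_of_inj[OF assms(1) left_module_dual _ generates_unit_vector
          coordinates_hom coordinates_inj])
      (auto intro: left_module_power_module left_module_regular simp: generates_closed)
qed

text \<open>Expanding elements in the dual basis gives injectivity. Dually, every functional
  \<open>h\<close> is the combination of the \<open>f i\<close> with coefficients
  \<open>h (p i)\<close>, so an element \<open>\<xi>\<close> of the double dual is determined by the
  values \<open>\<xi> (f i)\<close>.\<close>

lemma evaluation_bij_of_dual_basis:
  assumes P: "left_module R P" and p: "\<And>i. i < n \<Longrightarrow> p i \<in> carrier P"
    and f: "\<And>i. i < n \<Longrightarrow> f i \<in> carrier (dual R P)"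
    and basis: "\<And>x. x \<in> carrier P \<Longrightarrow> x = lincomb P n (\<lambda>i. f i x) p"
  shows "bij_betw (evaluation R P) (carrier P) (carrier (double_dual R P))"
proof -
  interpret P: left_module R P by fact
  interpret D: left_module "op_ring R" "dual R P"
    by (rule left_module_dual[OF P])
  have RR: "left_module R (regular_module R)"
    by (rule left_module_regular) (rule P.R.ring_axioms)
  have RO: "left_module (op_ring R) (regular_module (op_ring R))"
    by (rule left_module_regular) (simp add: P.R.ring_axioms)
  have hP: "h (lincomb P n r p) = lincomb (regular_module R) n r (\<lambda>i. h (p i))"
    if "h \<in> carrier (dual R P)" "\<And>i. i < n \<Longrightarrow> r i \<in> carrier R" for h r
    using that p by (intro mod_hom_lincomb[OF _ P RR]) (auto simp: dual_simps)
  have lc: "lincomb (dual R P) m (\<lambda>i. h (p i)) f x = lincomb (regular_module R) m (\<lambda>i. f i x) (\<lambda>i. h (p i))"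
    if "x \<in> carrier P" for h m x
    using that by (induction m) (auto simp: dual_simps)
  have h_eq: "h = lincomb (dual R P) n (\<lambda>i. h (p i)) f" if h: "h \<in> carrier (dual R P)" for h
  proof (rule dual_eqI[OF h])
    show "lincomb (dual R P) n (\<lambda>i. h (p i)) f \<in> carrier (dual R P)"
      using h f p by (intro D.lincomb_closed) (auto simp: dual_closed)
    show "h x = lincomb (dual R P) n (\<lambda>i. h (p i)) f x" if x: "x \<in> carrier P" for x
    proof -
      have "h x = h (lincomb P n (\<lambda>i. f i x) p)"
        using basis[OF x] by simp
      also have "\<dots> = lincomb (regular_module R) n (\<lambda>i. f i x) (\<lambda>i. h (p i))"
        using dual_closed[OF f x] by (intro hP h)
      finally show ?thesis using lc[OF x] by simp
    qed
  qed
  show ?thesis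
  proof (rule bij_betw_imageI)
    show "inj_on (evaluation R P) (carrier P)"
    proof (rule inj_onI)
      fix x y assume xy: "x \<in> carrier P" "y \<in> carrier P" "evaluation R P x = evaluation R P y"
      then have "f i x = f i y" if "i < n" for i
        using f[OF that] by (metis evaluation_apply)
      then show "x = y"
        using basis[OF xy(1)] basis[OF xy(2)] lincomb_cong[of n "\<lambda>i. f i x" "\<lambda>i. f i y" p p P] by metis
    qed
    show "evaluation R P ` carrier P = carrier (double_dual R P)"
    proof
      show "evaluation R P ` carrier P \<subseteq> carrier (double_dual R P)"
        using mod_hom_closed[OF evaluation_hom[OF P]] by auto
      show "carrier (double_dual R P) \<subseteq> evaluation R P ` carrier P"
      proof
        fix \<xi> assume xi: "\<xi> \<in> carrier (double_dual R P)"
        then have xi': "\<xi> \<in> carrier (dual (op_ring R) (dual R P))"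
          by (simp add: double_dual_def)
        have xiR: "\<xi> (f i) \<in> carrier R" if "i < n" for i
          using dual_closed[OF xi' f[OF that]] by simp
        \<comment> \<open>The only candidate: a preimage \<open>x\<close> has coordinates
          \<open>f i x\<close>, and these must equal \<open>\<xi> (f i)\<close>.\<close>
        define x where "x = lincomb P n (\<lambda>i. \<xi> (f i)) p"
        have x: "x \<in> carrier P"
          unfolding x_def using xiR p by simp
        have "evaluation R P x = \<xi>"
        proof (rule mod_hom_eqI)
          show "evaluation R P x \<in> mod_hom (op_ring R) (dual R P) (regular_module (op_ring R))"
            using mod_hom_closed[OF evaluation_hom[OF P] x] by (simp add: double_dual_def dual_simps)
          show "\<xi> \<in> mod_hom (op_ring R) (dual R P) (regular_module (op_ring R))"
            using xi' by (simp add: dual_simps)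
          fix h assume h: "h \<in> carrier (dual R P)"
          have "\<xi> h = \<xi> (lincomb (dual R P) n (\<lambda>i. h (p i)) f)"
            using h_eq[OF h] by simp
          also have "\<dots> = lincomb (regular_module (op_ring R)) n (\<lambda>i. h (p i)) (\<lambda>i. \<xi> (f i))"
            using xi' h p f by (intro mod_hom_lincomb[OF _ left_module_dual[OF P] RO]) (auto simp: dual_simps(1)[of "op_ring R"] dual_closed)
          \<comment> \<open>Passing back from the opposite ring exchanges the two factors of every
            term.\<close>
          also have "lincomb (regular_module (op_ring R)) m (\<lambda>i. h (p i)) (\<lambda>i. \<xi> (f i)) =
              lincomb (regular_module R) m (\<lambda>i. \<xi> (f i)) (\<lambda>i. h (p i))" for m
            by (induction m) auto
          also have "lincomb (regular_module R) n (\<lambda>i. \<xi> (f i)) (\<lambda>i. h (p i)) = h x"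
            unfolding x_def using h xiR by (intro hP[symmetric]) auto
          finally show "evaluation R P x h = \<xi> h"
            using x h by simp
        qed
        then show "\<xi> \<in> evaluation R P ` carrier P"
          using x by auto
      qed
    qed
  qed
qed


section \<open>Injective modules\<close>

text \<open>An infinite type absorbs its own square, so each induction step can code one more
  component.\<close>

lemma embed_tuples:
  fixes e :: "'a \<Rightarrow> 'u"
  assumes "infinite (UNIV :: 'u set)" "inj_on e A"
  shows "\<exists>h :: (nat \<Rightarrow> 'a) \<Rightarrow> 'u. inj_on h ({..<n} \<rightarrow>\<^sub>E A)"
proof (induction n)
  case 0
  show ?case
    by (intro exI[of _ "\<lambda>_. undefined"]) (auto simp: inj_on_def)
next
  case (Suc n)
  then obtain h :: "(nat \<Rightarrow> 'a) \<Rightarrow> 'u" where h: "inj_on h ({..<n} \<rightarrow>\<^sub>E A)"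
    by blast
  have "|UNIV \<times> UNIV :: ('u \<times> 'u) set| \<le>o |UNIV :: 'u set|"
    using card_of_Times_same_infinite[OF assms(1)] by (rule ordIso_imp_ordLeq)
  then obtain p :: "'u \<times> 'u \<Rightarrow> 'u" where p: "inj p"
    by (auto simp flip: card_of_ordLeq)
  have "inj_on (\<lambda>f. p (h (restrict f {..<n}), e (f n))) ({..<Suc n} \<rightarrow>\<^sub>E A)"
  proof (rule inj_onI)
    fix f g assume fg: "f \<in> {..<Suc n} \<rightarrow>\<^sub>E A" "g \<in> {..<Suc n} \<rightarrow>\<^sub>E A"
      "p (h (restrict f {..<n}), e (f n)) = p (h (restrict g {..<n}), e (g n))"
    have eq: "h (restrict f {..<n}) = h (restrict g {..<n})" "e (f n) = e (g n)"
      using injD[OF p, OF fg(3)] by auto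
    have "restrict f {..<n} = restrict g {..<n}"
      using h eq(1)
    proof (rule inj_onD[of h _ "restrict f {..<n}" "restrict g {..<n}"])
      show "restrict f {..<n} \<in> {..<n} \<rightarrow>\<^sub>E A" "restrict g {..<n} \<in> {..<n} \<rightarrow>\<^sub>E A"
        using PiE_mem[OF fg(1)] PiE_mem[OF fg(2)] by auto
    qed
    then have lt: "f i = g i" if "i < n" for i
      using that by (metis lessThan_iff restrict_apply')
    have "f n = g n"
      by (rule inj_onD[of e A "f n" "g n", OF assms(2) eq(2)]) (use PiE_mem[OF fg(1)] PiE_mem[OF fg(2)] in auto)
    show "f = g"
    proof (rule PiE_ext[OF fg(1,2)])
      show "f i = g i" if "i \<in> {..<Suc n}" for i
        using that lt \<open>f n = g n\<close> by (cases "i = n") auto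
    qed
  qed
  then show ?case by blast
qed

lemma embed_power_module:
  fixes e :: "'a \<Rightarrow> 'u"
  assumes "infinite (UNIV :: 'u set)" "inj_on e (carrier R)"
  shows "\<exists>h :: (nat \<Rightarrow> 'a) \<Rightarrow> 'u. inj_on h (carrier (free_module R n))"
  using embed_tuples[OF assms, of n] by (simp add: power_module_simps)

lemma injective_moduleD:
  fixes E A B :: "('a, 'u) module"
  assumes "injective_module R E" "left_module R A" "left_module R B"
    and "i \<in> mod_hom R A B" "inj_on i (carrier A)" "f \<in> mod_hom R A E"
  shows "\<exists>g\<in>mod_hom R B E. \<forall>x\<in>carrier A. g (i x) = f x"
  using assms unfolding injective_module_def by blast

text \<open>
  Stated for relations instead of partial maps, so that well-definedness only has to be checked
  at zero.
\<close>

lemma injective_extend_relation: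
  fixes E :: "('a, 'u) module" and e :: "'a \<Rightarrow> 'u"
  assumes inf: "infinite (UNIV :: 'u set)" "inj_on e (carrier R)"
    and E: "injective_module R E"
    and sub: "\<Gamma> \<subseteq> carrier (free_module R m) \<times> carrier E"
    and zero: "(\<zero>\<^bsub>free_module R m\<^esub>, \<zero>\<^bsub>E\<^esub>) \<in> \<Gamma>"
    and add: "\<And>v x w y. (v, x) \<in> \<Gamma> \<Longrightarrow> (w, y) \<in> \<Gamma> \<Longrightarrow>
      (v \<oplus>\<^bsub>free_module R m\<^esub> w, x \<oplus>\<^bsub>E\<^esub> y) \<in> \<Gamma>"
    and smult: "\<And>a v x. a \<in> carrier R \<Longrightarrow> (v, x) \<in> \<Gamma> \<Longrightarrow>
      (a \<odot>\<^bsub>free_module R m\<^esub> v, a \<odot>\<^bsub>E\<^esub> x) \<in> \<Gamma>"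
    and single: "\<And>x. (\<zero>\<^bsub>free_module R m\<^esub>, x) \<in> \<Gamma> \<Longrightarrow> x = \<zero>\<^bsub>E\<^esub>"
  shows "\<exists>c. (\<forall>i<m. c i \<in> carrier E) \<and> (\<forall>(v, x)\<in>\<Gamma>. x = lincomb E m v c)"
proof -
  interpret E: left_module R E
    using E by (simp add: injective_module_def)
  define F where "F = free_module R m"
  interpret F: left_module R F
    unfolding F_def by (intro left_module_power_module left_module_regular E.R.ring_axioms)
  define D where "D = fst ` \<Gamma>"
  have subD: "submodule D R F"
  proof (rule F.submoduleI)
    show "D \<subseteq> carrier F"
      using sub by (auto simp: D_def F_def)
    show "\<zero>\<^bsub>F\<^esub> \<in> D"
      unfolding D_def F_def by (rule image_eqI[OF _ zero]) simp
    show "v \<oplus>\<^bsub>F\<^esub> w \<in> D" if "v \<in> D" "w \<in> D" for v w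
      using that add unfolding D_def F_def by force
    show "a \<odot>\<^bsub>F\<^esub> v \<in> D" if "a \<in> carrier R" "v \<in> D" for a v
      using that smult unfolding D_def F_def by force
  qed
  \<comment> \<open>Negatives come from the scalar -1. With them, two values at the same point
    differ by a value at zero, so \<open>single\<close> makes the relation a function.\<close>
  have minus: "(\<ominus>\<^bsub>F\<^esub> v, \<ominus>\<^bsub>E\<^esub> x) \<in> \<Gamma>" if "(v, x) \<in> \<Gamma>" for v x
    using smult[of "\<ominus>\<^bsub>R\<^esub> \<one>\<^bsub>R\<^esub>" v x] that sub F.smult_minus_one E.smult_minus_one by (auto simp: F_def)
  have unique: "x = y" if "(v, x) \<in> \<Gamma>" "(v, y) \<in> \<Gamma>" for v x y
  proof -
    have "v \<in> carrier F" "x \<in> carrier E" "y \<in> carrier E"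
      using that sub by (auto simp: F_def)
    moreover have "(v \<oplus>\<^bsub>F\<^esub> \<ominus>\<^bsub>F\<^esub> v, x \<oplus>\<^bsub>E\<^esub> \<ominus>\<^bsub>E\<^esub> y) \<in> \<Gamma>"
      using add[OF that(1) minus[OF that(2)]] by (simp add: F_def)
    ultimately have "x \<ominus>\<^bsub>E\<^esub> y = \<zero>\<^bsub>E\<^esub>"
      using single[of "x \<ominus>\<^bsub>E\<^esub> y"] by (simp only: F.M.r_neg a_minus_def F_def[symmetric])
    then show "x = y"
      using \<open>x \<in> carrier E\<close> \<open>y \<in> carrier E\<close> by (simp add: E.M.minus_eq_zero_iff)
  qed
  define g where "g v = (THE x. (v, x) \<in> \<Gamma>)" for v
  have g: "g v = x" if "(v, x) \<in> \<Gamma>" for v x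
    unfolding g_def using that unique by blast
  have gD: "(v, g v) \<in> \<Gamma>" if "v \<in> D" for v
    using that g by (auto simp: D_def)
  \<comment> \<open>The free module and the domain \<open>D\<close> consist of tuples; injectivity
    of \<open>E\<close> refers to modules in \<open>'u\<close>, so both are replaced by copies along
    \<open>h\<close>.\<close>
  obtain h :: "(nat \<Rightarrow> 'a) \<Rightarrow> 'u" where h: "inj_on h (carrier F)"
    using embed_power_module[OF inf, of m] by (auto simp: F_def)
  define DM where "DM = F\<lparr>carrier := D\<rparr>"
  have DM: "left_module R DM" and DMc: "carrier DM = D"
    unfolding DM_def by (simp_all add: F.left_module_submodule[OF subD])
  have hD: "inj_on h (carrier DM)"
    unfolding DMc using h submoduleD(1)[OF subD] by (rule inj_on_subset)
  note lmD = left_module_image_module[OF DM hD]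
  note lmF = left_module_image_module[OF F.left_module_axioms h]
  \<comment> \<open>The two copies compute through inverses of \<open>h\<close> on different sets,
    so their operations have to be compared on elements written as \<open>h x'\<close>.\<close>
  have inc: "(\<lambda>x\<in>carrier (image_module h DM). x) \<in> mod_hom R (image_module h DM) (image_module h F)"
  proof (rule mod_hom_restrictI[OF lmD])
    have D: "x \<in> D \<Longrightarrow> x \<in> carrier F" for x
      using submoduleD(1)[OF subD] by blast
    show "x \<in> carrier (image_module h DM) \<Longrightarrow> x \<in> carrier (image_module h F)" for x
      using D by (auto simp: DMc)
    show "x \<oplus>\<^bsub>image_module h DM\<^esub> y = x \<oplus>\<^bsub>image_module h F\<^esub> y"
      if xy: "x \<in> carrier (image_module h DM)" "y \<in> carrier (image_module h DM)" for x y
    proof -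
      obtain x' y' where "x = h x'" "y = h y'" "x' \<in> D" "y' \<in> D"
        using xy by (auto simp: DMc)
      then show ?thesis
        using image_module_simps(1)[OF hD, of x' y'] image_module_simps(1)[OF h D D, of x' y']
        by (simp add: DMc) (simp add: DM_def)
    qed
    show "a \<odot>\<^bsub>image_module h DM\<^esub> x = a \<odot>\<^bsub>image_module h F\<^esub> x"
      if ax: "a \<in> carrier R" "x \<in> carrier (image_module h DM)" for a x
    proof -
      obtain x' where "x = h x'" "x' \<in> D"
        using ax by (auto simp: DMc)
      then show ?thesis
        using image_module_simps(2)[OF hD, of x' x'] image_module_simps(2)[OF h D D, of x' x']
        by (simp add: DMc) (simp add: DM_def)
    qed
  qed
  have "(\<lambda>x\<in>carrier DM. g x) \<in> mod_hom R DM E"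
  proof (rule mod_hom_restrictI[OF DM])
    show "g x \<in> carrier E" if "x \<in> carrier DM" for x
      using gD that sub by (auto simp: DMc)
    show "g (x \<oplus>\<^bsub>DM\<^esub> y) = g x \<oplus>\<^bsub>E\<^esub> g y" if "x \<in> carrier DM" "y \<in> carrier DM" for x y
      using g[OF add[OF gD gD], of x y] that by (simp add: DM_def F_def)
    show "g (a \<odot>\<^bsub>DM\<^esub> x) = a \<odot>\<^bsub>E\<^esub> g x" if "a \<in> carrier R" "x \<in> carrier DM" for a x
      using g[OF smult[OF that(1) gD], of x] that by (simp add: DM_def F_def)
  qed
  note gh = mod_hom_compose[OF image_module_inv_hom[OF DM hD] this lmD]
  have "inj_on (\<lambda>x\<in>carrier (image_module h DM). x) (carrier (image_module h DM))"
    by (simp add: inj_on_def)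
  from injective_moduleD[OF E lmD lmF inc this gh]
  obtain G where G: "G \<in> mod_hom R (image_module h F) E"
    "\<forall>x\<in>carrier (image_module h DM). G ((\<lambda>x\<in>carrier (image_module h DM). x) x) =
      compose (carrier (image_module h DM)) (\<lambda>x\<in>carrier DM. g x)
        (restrict (inv_into (carrier DM) h) (h ` carrier DM)) x" ..
  have Gg: "G (h v) = g v" if "v \<in> D" for v
    using bspec[OF G(2), of "h v"] that hD by (simp add: compose_def DMc)
  \<comment> \<open>A map out of a free module is given by its values on unit vectors; these values
    form the required row.\<close>
  define c where "c i = G (h (unit_vector R m i))" for i
  have uF: "unit_vector R m i \<in> carrier F" for i
    unfolding F_def by (rule unit_vector_closed) (rule E.R.ring_axioms)
  have cE: "c i \<in> carrier E" for i
    unfolding c_def using uF by (intro mod_hom_closed[OF G(1)]) simp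
  have "x = lincomb E m v c" if vx: "(v, x) \<in> \<Gamma>" for v x
  proof -
    have v: "v \<in> carrier F" "v \<in> D"
      using vx sub by (auto simp: F_def D_def intro: rev_image_eqI)
    have vR: "v i \<in> carrier R" if "i < m" for i
      using v(1) that by (auto simp: F_def power_module_simps)
    note Gh = mod_hom_compose[OF image_module_hom[OF F.left_module_axioms h] G(1) F.left_module_axioms]
    have "g v = compose (carrier F) G (restrict h (carrier F)) v"
      using v Gg by (simp add: compose_def)
    also have "\<dots> = compose (carrier F) G (restrict h (carrier F)) (lincomb F m v (unit_vector R m))"
      using lincomb_unit_vector[OF E.R.ring_axioms, of v m] v(1) by (simp add: F_def)
    also have "\<dots> = lincomb E m v (\<lambda>i. compose (carrier F) G (restrict h (carrier F)) (unit_vector R m i))"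
      using uF vR by (intro mod_hom_lincomb[OF Gh F.left_module_axioms E.left_module_axioms]) auto
    also have "\<dots> = lincomb E m v c"
      by (rule lincomb_cong) (use uF in \<open>auto simp: compose_def c_def\<close>)
    finally show ?thesis
      using g[OF vx] by simp
  qed
  then show ?thesis
    using cE by (intro exI[of _ c]) auto
qed


section \<open>Flat modules\<close>

text \<open>The image in M^n of the tensor product of the right span of \<open>L\<close> with
  \<open>M\<close>: finite sums of tuples with entries \<open>s i\<close> times \<open>x\<close>,
  where \<open>s\<close> is in \<open>L\<close>. Adding one such tuple per step gives an induction
  in which no number of summands has to be chosen. Entries from \<open>n\<close> onwards are
  unconstrained.\<close>

inductive relation_span :: "('a, 'm) module \<Rightarrow> nat \<Rightarrow> (nat \<Rightarrow> 'a) set \<Rightarrow> (nat \<Rightarrow> 'm) \<Rightarrow> bool"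
  for M :: "('a, 'm) module" and n L where
  zero: "(\<And>i. i < n \<Longrightarrow> v i = \<zero>\<^bsub>M\<^esub>) \<Longrightarrow> relation_span M n L v"
| step: "relation_span M n L v \<Longrightarrow> x \<in> carrier M \<Longrightarrow> s \<in> L \<Longrightarrow>
    (\<And>i. i < n \<Longrightarrow> w i = v i \<oplus>\<^bsub>M\<^esub> s i \<odot>\<^bsub>M\<^esub> x) \<Longrightarrow> relation_span M n L w"

lemma relation_span_cong:
  assumes "relation_span M n L v" "\<And>i. i < n \<Longrightarrow> w i = v i"
  shows "relation_span M n L w"
  using assms(1)
proof cases
  case zero
  then show ?thesis by (intro relation_span.zero) (simp add: assms(2))
next
  case (step u x s)
  show ?thesis
    by (rule relation_span.step[OF step(1-3)]) (simp add: assms(2) step(4))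
qed

lemma relation_span_mono:
  assumes "relation_span M n L v" "L \<subseteq> L'"
  shows "relation_span M n L' v"
  using assms(1)
proof induction
  case (zero v)
  then show ?case by (rule relation_span.zero)
next
  case (step v x s w)
  show ?case
    by (rule relation_span.step[OF step(5,2) subsetD[OF assms(2) step(3)] step(4)])
qed

context left_module
begin

lemma relation_span_closed:
  assumes "relation_span M n L v" "\<forall>s\<in>L. \<forall>i<n. s i \<in> carrier R" "i < n"
  shows "v i \<in> carrier M"
  using assms(1,3) by induction (auto simp: assms(2) smult_closed)

lemma relation_span_single:
  assumes "x \<in> carrier M" "s \<in> L" "\<And>i. i < n \<Longrightarrow> s i \<in> carrier R" 
    "\<And>i. i < n \<Longrightarrow> w i = s i \<odot>\<^bsub>M\<^esub> x"
  shows "relation_span M n L w"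
  by (rule relation_span.step[OF relation_span.zero, of n "\<lambda>_. \<zero>\<^bsub>M\<^esub>" M x s L])
    (use assms in \<open>auto simp: smult_closed\<close>)

lemma relation_span_add:
  assumes L: "\<forall>s\<in>L. \<forall>i<n. s i \<in> carrier R"
    and v: "relation_span M n L v" and w: "relation_span M n L w"
    and u: "\<And>i. i < n \<Longrightarrow> u i = v i \<oplus>\<^bsub>M\<^esub> w i"
  shows "relation_span M n L u"
  using w u
proof (induction arbitrary: u)
  case (zero w)
  then show ?case
    using relation_span_closed[OF v L] by (intro relation_span_cong[OF v]) auto
next
  case (step w x s w')
  show ?case
  proof (rule relation_span.step[OF step(5) step(2,3)])
    fix i assume "i < n"
    then show "u i = (v i \<oplus>\<^bsub>M\<^esub> w i) \<oplus>\<^bsub>M\<^esub> s i \<odot>\<^bsub>M\<^esub> x"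
      using relation_span_closed[OF v L, of i] relation_span_closed[OF step(1) L, of i]
        step.hyps L step.prems by (simp add: M.a_assoc smult_closed)
  qed auto
qed

lemma relation_span_minus:
  assumes L: "\<forall>s\<in>L. \<forall>i<n. s i \<in> carrier R"
    and v: "relation_span M n L v" and u: "\<And>i. i < n \<Longrightarrow> u i = \<ominus>\<^bsub>M\<^esub> v i"
  shows "relation_span M n L u"
  using v u
proof (induction arbitrary: u)
  case (zero w)
  then show ?case
    by (intro relation_span.zero) simp
next
  case (step w x s w')
  show ?case
  proof (rule relation_span.step[OF step(5)])
    fix i assume "i < n"
    then show "u i = (\<ominus>\<^bsub>M\<^esub> w i) \<oplus>\<^bsub>M\<^esub> s i \<odot>\<^bsub>M\<^esub> (\<ominus>\<^bsub>M\<^esub> x)"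
      using relation_span_closed[OF step(1) L, of i]
        step.hyps L step.prems by (simp add: M.minus_add smult_closed smult_minus_right)
  qed (use step in auto)
qed

end

lemma power_module_minus:
  assumes "left_module R M" "v \<in> carrier (power_module M n)" "i < n"
  shows "(\<ominus>\<^bsub>power_module M n\<^esub> v) i = \<ominus>\<^bsub>M\<^esub> v i"
proof -
  interpret M: left_module R M by fact
  interpret P: left_module R "power_module M n"
    by (rule left_module_power_module) fact
  have c: "u i \<in> carrier M" if "u \<in> carrier (power_module M n)" for u
    using that assms(3) by (auto simp: power_module_simps)
  have "(\<ominus>\<^bsub>power_module M n\<^esub> v \<oplus>\<^bsub>power_module M n\<^esub> v) i = \<zero>\<^bsub>power_module M n\<^esub> i"
    using assms(2) by (simp add: P.M.l_neg)
  then have "(\<ominus>\<^bsub>power_module M n\<^esub> v) i \<oplus>\<^bsub>M\<^esub> v i = \<zero>\<^bsub>M\<^esub>"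
    using assms(3) by (simp add: power_module_simps(2,3))
  then show ?thesis
    using c assms(2) by (simp add: M.M.minus_equality)
qed

section \<open>Relations defining the tensor product\<close>

lemma tensor_relations_group:
  fixes A :: "('a, 'n) module" and M :: "('a, 'm) module"
  assumes "left_module (op_ring R) A" "left_module R M"
  shows "subgroup (tensor_relations R A M) (free_Abelian_group (carrier A \<times> carrier M))"
proof -
  interpret A: left_module "op_ring R" A by fact
  interpret M: left_module R M by fact
  have diff: "u - v \<in> carrier (free_Abelian_group S)"
    if "u \<in> carrier (free_Abelian_group S)" "v \<in> carrier (free_Abelian_group S)"
    for u v and S :: "('n \<times> 'm) set"
    using that keys_diff[of u v] by auto
  show ?thesis
    unfolding tensor_relations_def
    by (rule group.generate_is_subgroup)
      (auto simp del: carrier_free_Abelian_group_iff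
        simp: A.smult_closed[simplified] M.smult_closed intro!: diff)
qed

lemma tensor_relations_generators:
  shows "a \<in> carrier A \<Longrightarrow> b \<in> carrier A \<Longrightarrow> x \<in> carrier M \<Longrightarrow>
      frag_of (a \<oplus>\<^bsub>A\<^esub> b, x) - frag_of (a, x) - frag_of (b, x) \<in> tensor_relations R A M"
    and "a \<in> carrier A \<Longrightarrow> x \<in> carrier M \<Longrightarrow> y \<in> carrier M \<Longrightarrow>
      frag_of (a, x \<oplus>\<^bsub>M\<^esub> y) - frag_of (a, x) - frag_of (a, y) \<in> tensor_relations R A M"
    and "r \<in> carrier R \<Longrightarrow> a \<in> carrier A \<Longrightarrow> x \<in> carrier M \<Longrightarrow>
      frag_of (r \<odot>\<^bsub>A\<^esub> a, x) - frag_of (a, r \<odot>\<^bsub>M\<^esub> x) \<in> tensor_relations R A M"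
  unfolding tensor_relations_def by (intro generate.incl; blast)+

text \<open>Additive form of the induction over a generated subgroup: inverses of generators are
  absorbed by closure under negation, and the generators split into the three kinds of
  relations.\<close>

lemma tensor_relations_induct [consumes 3, case_names zero add minus add_left add_right balanced]:
  fixes A :: "('a, 'n) module" and M :: "('a, 'm) module"
  assumes z: "z \<in> tensor_relations R A M"
    and A: "left_module (op_ring R) A" and M: "left_module R M"
    and zero: "P 0"
    and add: "\<And>u v. u \<in> tensor_relations R A M \<Longrightarrow> v \<in> tensor_relations R A M \<Longrightarrow>
      P u \<Longrightarrow> P v \<Longrightarrow> P (u + v)"
    and minus: "\<And>u. u \<in> tensor_relations R A M \<Longrightarrow> P u \<Longrightarrow> P (- u)"
    and "\<And>a b x. a \<in> carrier A \<Longrightarrow> b \<in> carrier A \<Longrightarrow> x \<in> carrier M \<Longrightarrow>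
      P (frag_of (a \<oplus>\<^bsub>A\<^esub> b, x) - frag_of (a, x) - frag_of (b, x))"
    and "\<And>a x y. a \<in> carrier A \<Longrightarrow> x \<in> carrier M \<Longrightarrow> y \<in> carrier M \<Longrightarrow>
      P (frag_of (a, x \<oplus>\<^bsub>M\<^esub> y) - frag_of (a, x) - frag_of (a, y))"
    and "\<And>r a x. r \<in> carrier R \<Longrightarrow> a \<in> carrier A \<Longrightarrow> x \<in> carrier M \<Longrightarrow>
      P (frag_of (r \<odot>\<^bsub>A\<^esub> a, x) - frag_of (a, r \<odot>\<^bsub>M\<^esub> x))"
  shows "P z"
proof -
  let ?G = "free_Abelian_group (carrier A \<times> carrier M)"
  note sub = tensor_relations_group[OF A M]
  show ?thesis
    using z[unfolded tensor_relations_def]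
  proof (induction rule: generate.induct)
    case one
    then show ?case using zero by simp
  next
    case (incl h)
    then show ?case using assms(7-9) by auto
  next
    case (inv h)
    then have h: "P h" using assms(7-9) by auto
    have hT: "h \<in> tensor_relations R A M"
      unfolding tensor_relations_def using inv by (rule generate.incl)
    \<comment> \<open>The inverse in the free abelian group is negation on its carrier, so
      membership of \<open>h\<close> comes first.\<close>
    then have "Poly_Mapping.keys h \<subseteq> carrier A \<times> carrier M"
      using subsetD[OF subgroup.subset[OF sub]] by simp
    then show ?case
      using minus[OF hT h] by simp
  next
    case (eng h1 h2)
    then show ?case
      using add by (simp add: tensor_relations_def)
  qed
qed


lemma a_inv_op_ring [simp]: "\<ominus>\<^bsub>op_ring R\<^esub> x = \<ominus>\<^bsub>R\<^esub> x"
  unfolding a_inv_def m_inv_def by (simp add: op_ring_def)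

lemma (in abelian_group) add_diff_diff:
  assumes "x \<in> carrier G" "y \<in> carrier G"
  shows "(x \<oplus> y) \<oplus> \<ominus> x \<oplus> \<ominus> y = \<zero>"
proof -
  have "(x \<oplus> y) \<oplus> \<ominus> x \<oplus> \<ominus> y = (x \<oplus> y) \<oplus> (\<ominus> x \<oplus> \<ominus> y)"
    using assms by (intro a_assoc) auto
  then show ?thesis
    using assms r_neg[of "x \<oplus> y"] by (simp only: minus_add a_closed)
qed

context left_module
begin

lemma smult_minus_left:
  assumes "a \<in> carrier R" "x \<in> carrier M"
  shows "(\<ominus> a) \<odot>\<^bsub>M\<^esub> x = \<ominus>\<^bsub>M\<^esub> (a \<odot>\<^bsub>M\<^esub> x)"
proof -
  have "(\<ominus> a) \<odot>\<^bsub>M\<^esub> x \<oplus>\<^bsub>M\<^esub> a \<odot>\<^bsub>M\<^esub> x = \<zero>\<^bsub>M\<^esub>"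
    using assms by (simp add: smult_l_distr[symmetric] R.l_neg)
  then show ?thesis
    using assms by (simp add: M.minus_equality smult_closed)
qed

lemma lincomb_minus_left:
  assumes "\<And>i. i < n \<Longrightarrow> r i \<in> carrier R" "\<And>i. i < n \<Longrightarrow> w i \<in> carrier M"
  shows "lincomb M n (\<lambda>i. \<ominus> r i) w = \<ominus>\<^bsub>M\<^esub> lincomb M n r w"
  using assms
proof (induction n)
  case 0
  show ?case
    by (simp add: M.minus_equality[of "\<zero>\<^bsub>M\<^esub>" "\<zero>\<^bsub>M\<^esub>"])
qed (auto simp: smult_closed smult_minus_left M.minus_add)

lemma lincomb_diff_left:
  assumes "\<And>i. i < n \<Longrightarrow> r i \<in> carrier R" "\<And>i. i < n \<Longrightarrow> s i \<in> carrier R"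
    and "\<And>i. i < n \<Longrightarrow> w i \<in> carrier M"
  shows "lincomb M n (\<lambda>i. r i \<oplus> \<ominus> s i) w = lincomb M n r w \<oplus>\<^bsub>M\<^esub> \<ominus>\<^bsub>M\<^esub> lincomb M n s w"
  using assms by (simp add: lincomb_add_left lincomb_minus_left)

end

text \<open>Right exactness of the tensor product, by hand. With \<open>L\<close> the relations
  among the generators \<open>a\<close>, the tensor product of \<open>A\<close> and \<open>F\<close>
  is F^n modulo the image of \<open>L\<close> tensor \<open>F\<close>. A choice of coordinates for
  the elements of \<open>A\<close> defines a map from formal sums to F^n that respects the tensor
  relations modulo this image, and it sends the given formal sum to \<open>x\<close> modulo the
  image.\<close>

lemma relation_span_of_tensor_relation:
  fixes A :: "('a, 'n) module" and F :: "('a, 'm) module"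
  assumes A: "left_module (op_ring R) A" and F: "left_module R F"
    and a: "generates (op_ring R) A n a" and x: "\<And>i. i < n \<Longrightarrow> x i \<in> carrier F"
    and rel: "(\<Sum>i<n. frag_of (a i, x i)) \<in> tensor_relations R A F"
  shows "relation_span F n {s. (\<forall>i<n. s i \<in> carrier R) \<and> lincomb A n s a = \<zero>\<^bsub>A\<^esub>} x"
    (is "relation_span F n ?L x")
proof -
  interpret A: left_module "op_ring R" A by fact
  interpret F: left_module R F by fact
  let ?S = "carrier A \<times> carrier F" and ?P = "power_module F n"
  interpret P: left_module R ?P
    by (rule left_module_power_module) fact
  let ?C = "carrier (free_Abelian_group ?S)"
  have aA: "a i \<in> carrier A" if "i < n" for i
    using generates_closed[OF a that] .
  have "\<exists>r. (\<forall>i<n. r i \<in> carrier R) \<and> y = lincomb A n r a" if "y \<in> carrier A" for y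
    using a that unfolding generates_def by simp
  \<comment> \<open>An arbitrary choice of coordinates, in general neither additive nor linear. Its
    defects are relations among the generators, and these belong to \<open>L\<close>.\<close>
  then obtain r where r: "\<And>y i. y \<in> carrier A \<Longrightarrow> i < n \<Longrightarrow> r y i \<in> carrier R"
      "\<And>y. y \<in> carrier A \<Longrightarrow> lincomb A n (r y) a = y"
    by metis
  define \<phi> where "\<phi> = (\<lambda>(y, x). \<lambda>i\<in>{..<n}. r y i \<odot>\<^bsub>F\<^esub> x)"
  have "\<phi> ` ?S \<subseteq> carrier (add_monoid ?P)"
    using r(1) by (auto simp: \<phi>_def power_module_simps F.smult_closed split: if_splits)
  then obtain h where h: "h \<in> hom (free_Abelian_group ?S) (add_monoid ?P)"
      "\<And>u. u \<in> ?S \<Longrightarrow> h (frag_of u) = \<phi> u"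
    using comm_group.free_Abelian_group_universal[OF P.M.a_comm_group, of \<phi> ?S] by blast
  interpret h: group_hom "free_Abelian_group ?S" "add_monoid ?P" h
    by (intro group_hom.intro group_hom_axioms.intro h(1)) (auto simp: P.M.a_group)
  have hC: "h u \<in> carrier ?P" if "u \<in> ?C" for u
    using h.hom_closed[OF that] by simp
  have hF: "h u i \<in> carrier F" if "u \<in> ?C" "i < n" for u i
    using hC[OF that(1)] that(2) by (auto simp: power_module_simps)
  have h_add: "h (u + v) i = h u i \<oplus>\<^bsub>F\<^esub> h v i" if "u \<in> ?C" "v \<in> ?C" "i < n" for u v i
    using h.hom_mult[OF that(1,2)] that(3) by (simp add: power_module_simps(3))
  have h_minus: "h (- u) i = \<ominus>\<^bsub>F\<^esub> h u i" if "u \<in> ?C" "i < n" for u i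
    using h.hom_inv[OF that(1)] that power_module_minus[OF F hC[OF that(1)] that(2)]
    by (simp add: a_inv_def[of "power_module F n"])
  have minus_C: "- u \<in> ?C" if "u \<in> ?C" for u
    using that by simp
  have diff_C: "u - v \<in> ?C" if "u \<in> ?C" "v \<in> ?C" for u v
    using that keys_diff[of u v] by auto
  have h_diff: "h (u - v) i = h u i \<oplus>\<^bsub>F\<^esub> \<ominus>\<^bsub>F\<^esub> h v i" if "u \<in> ?C" "v \<in> ?C" "i < n" for u v i
    using h_add[OF that(1) minus_C[OF that(2)] that(3)] h_minus[OF that(2,3)] by simp
  have h_frag: "h (frag_of (y, z)) i = r y i \<odot>\<^bsub>F\<^esub> z" if "y \<in> carrier A" "z \<in> carrier F" "i < n" for y z i
    using that h(2)[of "(y, z)"] by (simp add: \<phi>_def)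
  have fC: "frag_of (y, z) \<in> ?C" if "y \<in> carrier A" "z \<in> carrier F" for y z
    using that by simp
  have L: "\<forall>s\<in>?L. \<forall>i<n. s i \<in> carrier R"
    by blast
  note subC = subsetD[OF subgroup.subset[OF tensor_relations_group[OF A F]]]
  have main: "relation_span F n ?L (h u)" if "u \<in> tensor_relations R A F" for u
    using that A F
  proof (induction rule: tensor_relations_induct)
    case zero
    then show ?case
      using h.hom_one by (intro relation_span.zero) (simp add: power_module_simps)
  next
    case (add u v)
    show ?case
      by (rule F.relation_span_add[OF L add(3,4)]) (rule h_add[OF subC[OF add(1)] subC[OF add(2)]])
  next
    case (minus u)
    show ?case
      by (rule F.relation_span_minus[OF L minus(2)]) (rule h_minus[OF subC[OF minus(1)]])
  next
    case (add_left y z x)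
    \<comment> \<open>The defect of additivity of the chosen coordinates.\<close>
    let ?s = "\<lambda>i. (r (y \<oplus>\<^bsub>A\<^esub> z) i \<oplus>\<^bsub>R\<^esub> \<ominus>\<^bsub>R\<^esub> r y i) \<oplus>\<^bsub>R\<^esub> \<ominus>\<^bsub>R\<^esub> r z i"
    have yz: "y \<oplus>\<^bsub>A\<^esub> z \<in> carrier A"
      using add_left by simp
    have "lincomb A n ?s a = ((y \<oplus>\<^bsub>A\<^esub> z) \<oplus>\<^bsub>A\<^esub> \<ominus>\<^bsub>A\<^esub> y) \<oplus>\<^bsub>A\<^esub> \<ominus>\<^bsub>A\<^esub> z"
      using A.lincomb_diff_left[of n "\<lambda>i. r (y \<oplus>\<^bsub>A\<^esub> z) i \<oplus>\<^bsub>R\<^esub> \<ominus>\<^bsub>R\<^esub> r y i" "r z" a]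
        A.lincomb_diff_left[of n "r (y \<oplus>\<^bsub>A\<^esub> z)" "r y" a] r(1) aA yz add_left
      by (simp add: r(2))
    also have "\<dots> = \<zero>\<^bsub>A\<^esub>"
      using add_left by (intro A.M.add_diff_diff)
    finally have sL: "?s \<in> ?L"
      using r(1) yz add_left by simp
    show ?case
    proof (rule F.relation_span_single[OF add_left(3) sL])
      show "?s i \<in> carrier R" if "i < n" for i
        using sL that by blast
      show "h (frag_of (y \<oplus>\<^bsub>A\<^esub> z, x) - frag_of (y, x) - frag_of (z, x)) i = ?s i \<odot>\<^bsub>F\<^esub> x" if "i < n" for i
        using that add_left yz r(1)
        by (subst h_diff[OF diff_C[OF fC fC] fC]; (subst h_diff[OF fC fC])?)
          (simp_all add: h_frag F.smult_l_distr F.smult_minus_left F.smult_closed)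
    qed
  next
    \<comment> \<open>The first component, and with it the coordinates, stays fixed; additivity in
      the second component holds exactly.\<close>
    case (add_right y w x)
    show ?case
    proof (rule relation_span.zero)
      fix i assume i: "i < n"
      have wx: "w \<oplus>\<^bsub>F\<^esub> x \<in> carrier F"
        using add_right by simp
      have "h (frag_of (y, w \<oplus>\<^bsub>F\<^esub> x) - frag_of (y, w) - frag_of (y, x)) i =
        (h (frag_of (y, w \<oplus>\<^bsub>F\<^esub> x)) i \<oplus>\<^bsub>F\<^esub> \<ominus>\<^bsub>F\<^esub> h (frag_of (y, w)) i) \<oplus>\<^bsub>F\<^esub> \<ominus>\<^bsub>F\<^esub> h (frag_of (y, x)) i"
        using add_right wx i by (simp only: h_diff diff_C fC)
      also have "\<dots> = \<zero>\<^bsub>F\<^esub>"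
        using add_right i r(1)[OF add_right(1) i] wx
        by (simp add: h_frag F.smult_r_distr F.smult_closed F.M.add_diff_diff)
      finally show "h (frag_of (y, w \<oplus>\<^bsub>F\<^esub> x) - frag_of (y, w) - frag_of (y, x)) i = \<zero>\<^bsub>F\<^esub>" .
    qed
  next
    case (balanced c y x)
    \<comment> \<open>The defect of linearity. The scalar \<open>c\<close> stands on the right
      because \<open>A\<close> is a module over the opposite ring.\<close>
    let ?s = "\<lambda>i. r (c \<odot>\<^bsub>A\<^esub> y) i \<oplus>\<^bsub>R\<^esub> \<ominus>\<^bsub>R\<^esub> (r y i \<otimes>\<^bsub>R\<^esub> c)"
    have cy: "c \<odot>\<^bsub>A\<^esub> y \<in> carrier A" and cx: "c \<odot>\<^bsub>F\<^esub> x \<in> carrier F"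
      using balanced A.smult_closed[of c y] F.smult_closed[of c x] by auto
    have "lincomb A n (\<lambda>i. r y i \<otimes>\<^bsub>R\<^esub> c) a = c \<odot>\<^bsub>A\<^esub> y"
      using A.lincomb_smult[of c n "r y" a] balanced r aA by simp
    then have "lincomb A n ?s a = c \<odot>\<^bsub>A\<^esub> y \<oplus>\<^bsub>A\<^esub> \<ominus>\<^bsub>A\<^esub> (c \<odot>\<^bsub>A\<^esub> y)"
      using A.lincomb_diff_left[of n "r (c \<odot>\<^bsub>A\<^esub> y)" "\<lambda>i. r y i \<otimes>\<^bsub>R\<^esub> c" a] r aA cy balanced by simp
    then have sL: "?s \<in> ?L"
      using r(1) cy balanced by (simp add: A.M.r_neg)
    show ?case
    proof (rule F.relation_span_single[OF balanced(3) sL])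
      show "?s i \<in> carrier R" if "i < n" for i
        using sL that by blast
      show "h (frag_of (c \<odot>\<^bsub>A\<^esub> y, x) - frag_of (y, c \<odot>\<^bsub>F\<^esub> x)) i = ?s i \<odot>\<^bsub>F\<^esub> x" if i: "i < n" for i
      proof -
        have "h (frag_of (c \<odot>\<^bsub>A\<^esub> y, x) - frag_of (y, c \<odot>\<^bsub>F\<^esub> x)) i =
            h (frag_of (c \<odot>\<^bsub>A\<^esub> y, x)) i \<oplus>\<^bsub>F\<^esub> \<ominus>\<^bsub>F\<^esub> h (frag_of (y, c \<odot>\<^bsub>F\<^esub> x)) i"
          using balanced cy cx i by (intro h_diff fC)
        also have "\<dots> = ?s i \<odot>\<^bsub>F\<^esub> x"
          using balanced cy cx i r(1)[OF cy i] r(1)[OF balanced(2) i]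
          by (simp add: h_frag F.smult_l_distr F.smult_minus_left F.smult_assoc)
        finally show ?thesis .
      qed
    qed
  qed
  define \<delta> where "\<delta> i j = (if j = i then \<one>\<^bsub>R\<^esub> else \<zero>\<^bsub>R\<^esub>)" for i j :: nat
  have \<delta>: "\<delta> i j \<in> carrier R" for i j
    by (simp add: \<delta>_def)
  have sumC: "(\<Sum>j<m. frag_of (a j, x j)) \<in> ?C" if "m \<le> n" for m
    using that aA x by (intro sum_closed_free_Abelian_group) auto
  have hsum: "h (\<Sum>j<m. frag_of (a j, x j)) i = lincomb F m (\<lambda>j. r (a j) i) x" if "m \<le> n" "i < n" for m i
    using that(1)
  proof (induction m)
    case 0
    then show ?case
      using h.hom_one that(2) by (simp add: power_module_simps)
  next
    case (Suc m)
    have "h ((\<Sum>j<m. frag_of (a j, x j)) + frag_of (a m, x m)) i =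
        h (\<Sum>j<m. frag_of (a j, x j)) i \<oplus>\<^bsub>F\<^esub> h (frag_of (a m, x m)) i"
      using Suc.prems sumC[of m] aA x that(2) by (intro h_add fC) auto
    then show ?case
      using Suc aA x that(2) by (simp add: h_frag)
  qed
  \<comment> \<open>For fixed \<open>j\<close> the unit tuple at \<open>j\<close> and the chosen
    coordinates of \<open>a j\<close> both express \<open>a j\<close>, so their difference is a
    relation. Hence \<open>x\<close> minus the image of its formal sum is in the span;
    \<open>m\<close> counts the terms already added.\<close>
  let ?w = "\<lambda>m i. lincomb F m (\<lambda>j. \<delta> i j \<oplus>\<^bsub>R\<^esub> \<ominus>\<^bsub>R\<^esub> r (a j) i) x"
  have "relation_span F n ?L (?w m)" if "m \<le> n" for m
    using that
  proof (induction m)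
    case 0
    then show ?case
      by (intro relation_span.zero) simp
  next
    case (Suc m)
    have m: "m < n" using Suc.prems by simp
    have "lincomb A n (\<lambda>i. \<delta> i m) a = a m"
      using A.lincomb_unit_left[of m n a, OF m aA] by (simp add: \<delta>_def eq_commute cong: if_cong)
    then have "lincomb A n (\<lambda>i. \<delta> i m \<oplus>\<^bsub>R\<^esub> \<ominus>\<^bsub>R\<^esub> r (a m) i) a = a m \<oplus>\<^bsub>A\<^esub> \<ominus>\<^bsub>A\<^esub> a m"
      using A.lincomb_diff_left[of n "\<lambda>i. \<delta> i m" "r (a m)" a] r aA m \<delta> by simp
    then have "(\<lambda>i. \<delta> i m \<oplus>\<^bsub>R\<^esub> \<ominus>\<^bsub>R\<^esub> r (a m) i) \<in> ?L"
      using aA[OF m] r(1) \<delta> by (simp add: A.M.r_neg)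
    from relation_span.step[OF Suc.IH x[OF m] this] m show ?case
      by simp
  qed
  then have w: "relation_span F n ?L (?w n)"
    by simp
  show ?thesis
  proof (rule F.relation_span_add[OF L w main[OF rel]])
    fix i assume i: "i < n"
    have "lincomb F n (\<delta> i) x = x i"
      using F.lincomb_unit_left[of i n x, OF i x] by (simp add: \<delta>_def[abs_def])
    moreover have "lincomb F n (\<delta> i) x = lincomb F n (\<lambda>j. (\<delta> i j \<oplus>\<^bsub>R\<^esub> \<ominus>\<^bsub>R\<^esub> r (a j) i) \<oplus>\<^bsub>R\<^esub> r (a j) i) x"
      using \<delta> r(1)[OF aA i] by (intro lincomb_cong) (auto simp: F.R.a_assoc F.R.l_neg)
    moreover have "\<dots> = ?w n i \<oplus>\<^bsub>F\<^esub> lincomb F n (\<lambda>j. r (a j) i) x"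
      using \<delta> r(1)[OF aA i] x by (intro F.lincomb_add_left) auto
    ultimately show "x i = ?w n i \<oplus>\<^bsub>F\<^esub> h (\<Sum>j<n. frag_of (a j, x j)) i"
      using hsum[of n i] i by simp
  qed
qed


lemma tensor_relations_closed:
  assumes "left_module (op_ring R) A" "left_module R M"
  shows "0 \<in> tensor_relations R A M"
    and "u \<in> tensor_relations R A M \<Longrightarrow> v \<in> tensor_relations R A M \<Longrightarrow> u + v \<in> tensor_relations R A M"
    and "u \<in> tensor_relations R A M \<Longrightarrow> - u \<in> tensor_relations R A M"
proof -
  note sub = tensor_relations_group[OF assms]
  show "0 \<in> tensor_relations R A M"
    using subgroup.one_closed[OF sub] by simp
  show "u \<in> tensor_relations R A M \<Longrightarrow> v \<in> tensor_relations R A M \<Longrightarrow> u + v \<in> tensor_relations R A M"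
    using subgroup.m_closed[OF sub, of u v] by simp
  show "u \<in> tensor_relations R A M \<Longrightarrow> - u \<in> tensor_relations R A M"
    using subgroup.m_inv_closed[OF sub, of u] subsetD[OF subgroup.subset[OF sub], of u] by simp
qed

text \<open>The \<open>b i\<close> need not generate \<open>B\<close>. Flatness makes the tensor
  product with the submodule they span embed into the one with \<open>B\<close>, so the formal sum
  is already a relation over that submodule, where the \<open>b i\<close> do generate.\<close>

lemma flat_relation_span:
  fixes B :: "('a, 'u) module" and F :: "('a, 'u) module"
  assumes flat: "flat_module R F" and B: "left_module (op_ring R) B"
    and b: "\<And>i. i < n \<Longrightarrow> b i \<in> carrier B" and x: "\<And>i. i < n \<Longrightarrow> x i \<in> carrier F"
    and rel: "(\<Sum>i<n. frag_of (b i, x i)) \<in> tensor_relations R B F"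
  shows "relation_span F n {s. (\<forall>i<n. s i \<in> carrier R) \<and> lincomb B n s b = \<zero>\<^bsub>B\<^esub>} x"
proof -
  have F: "left_module R F"
    using flat by (simp add: flat_module_def)
  interpret B: left_module "op_ring R" B by fact
  interpret F: left_module R F by fact
  define H where "H = {lincomb B n r b | r. \<forall>i<n. r i \<in> carrier (op_ring R)}"
  have subH: "submodule H (op_ring R) B"
    unfolding H_def using b by (rule B.submodule_span)
  define A where "A = B\<lparr>carrier := H\<rparr>"
  have A: "left_module (op_ring R) A"
    unfolding A_def by (rule B.left_module_submodule[OF subH])
  have AB: "y \<in> carrier B" if "y \<in> carrier A" for y
    using that submoduleD(1)[OF subH] by (auto simp: A_def)
  have bH: "b i \<in> H" if "i < n" for i
    using B.lincomb_unit_left[of i n b, OF that b, symmetric] unfolding H_def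
    by (intro CollectI exI[of _ "\<lambda>j. if j = i then \<one>\<^bsub>op_ring R\<^esub> else \<zero>\<^bsub>op_ring R\<^esub>"]) auto
  have genA: "generates (op_ring R) A n b"
    unfolding generates_def using bH by (auto simp: A_def H_def)
  define i where "i = (\<lambda>y\<in>carrier A. y)"
  have i: "i \<in> mod_hom (op_ring R) A B"
    unfolding i_def by (rule mod_hom_restrictI[OF A AB]) (auto simp: A_def)
  have inj_i: "inj_on i (carrier A)"
    by (auto simp: i_def inj_on_def)
  let ?GA = "free_Abelian_group (carrier A \<times> carrier F)"
  let ?GB = "free_Abelian_group (carrier B \<times> carrier F)"
  let ?TA = "tensor_relations R A F" and ?TB = "tensor_relations R B F"
  interpret TA: subgroup ?TA ?GA
    by (rule tensor_relations_group[OF A F])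
  note TB = tensor_relations_group[OF B F]
  interpret GA: group ?GA by simp
  interpret GB: group ?GB by simp
  define f :: "('u \<times> 'u \<Rightarrow>\<^sub>0 int) \<Rightarrow> ('u \<times> 'u \<Rightarrow>\<^sub>0 int)"
    where "f = frag_extend (\<lambda>(a, x). frag_of (i a, x))"
  have f: "f 0 = 0" "f (u + v) = f u + f v" "f (- u) = - f u" "f (u - v) = f u - f v"
    "f (frag_of (a, y)) = frag_of (i a, y)" for u v a y
    by (simp_all add: f_def frag_extend_add frag_extend_minus frag_extend_diff)
  note TB_closed = tensor_relations_closed[OF B F]
  have f_TA: "f u \<in> ?TB" if "u \<in> ?TA" for u
    using that A F
  proof (induction rule: tensor_relations_induct)
    case (add_left a b x)
    have ab: "a \<oplus>\<^bsub>A\<^esub> b \<in> carrier A"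
      using add_left by (simp add: left_module.axioms(2)[OF A] abelian_monoid.a_closed abelian_group.axioms)
    then show ?case
      using add_left tensor_relations_generators(1)[of "i a" B "i b" x F R] mod_hom_closed[OF i] 
      by (simp add: f mod_hom_add[OF i, symmetric])
  next
    case (add_right a x y)
    then show ?case
      using tensor_relations_generators(2)[of "i a" B x F y R] mod_hom_closed[OF i] by (simp add: f)
  next
    case (balanced r a x)
    then show ?case
      using tensor_relations_generators(3)[of r R "i a" B x F] mod_hom_closed[OF i] 
        mod_hom_smult[OF i, of r a] by (simp add: f)
  qed (auto simp: f TB_closed)
  \<comment> \<open>The value of the induced map is a union of cosets over a nonempty set; each of
    them is the zero coset because \<open>f\<close> preserves relations and \<open>f z\<close> is
    one.\<close>
  have map_eq: "tensor_map R A B i F (?TA #>\<^bsub>?GA\<^esub> z) = ?TB"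
    if z: "z \<in> carrier ?GA" "f z \<in> ?TB" for z
  proof -
    let ?X = "?TA #>\<^bsub>?GA\<^esub> z"
    have "?X \<in> carrier (tensor_product R A F)"
      using z(1) by (auto simp: tensor_product_def FactGroup_def RCOSETS_def)
    moreover have "?TB #>\<^bsub>?GB\<^esub> f w = ?TB" if w: "w \<in> ?X" for w
    proof -
      obtain t where t: "t \<in> ?TA" "w = t + z"
        using w by (auto simp: r_coset_def)
      then have "f w \<in> ?TB"
        using f_TA[OF t(1)] z(2) TB_closed(2) by (simp add: f)
      then show ?thesis
        by (rule GB.coset_join2[OF subsetD[OF subgroup.subset[OF TB]] TB]) fact
    qed
    moreover have "?X \<noteq> {}"
      using TA.one_closed by (auto simp: r_coset_def)
    ultimately show ?thesis
      unfolding tensor_map_def by (auto simp: f_def)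
  qed
  let ?z = "\<Sum>j<n. frag_of (b j, x j)"
  have zC: "?z \<in> carrier ?GA"
    using x bH by (intro sum_closed_free_Abelian_group) (auto simp: A_def)
  have "f (\<Sum>j<m. frag_of (b j, x j)) = (\<Sum>j<m. frag_of (b j, x j))" if "m \<le> n" for m
    using that bH by (induction m) (auto simp: f i_def A_def)
  then have fz: "f ?z \<in> ?TB"
    using rel by simp
  have inj: "inj_on (tensor_map R A B i F) (carrier (tensor_product R A F))"
    using flat A B i inj_i unfolding flat_module_def by blast
  have "?TA #>\<^bsub>?GA\<^esub> ?z = ?TA #>\<^bsub>?GA\<^esub> 0"
  proof (rule inj_onD[OF inj])
    show "tensor_map R A B i F (?TA #>\<^bsub>?GA\<^esub> ?z) = tensor_map R A B i F (?TA #>\<^bsub>?GA\<^esub> 0)"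
      using map_eq[OF zC fz] map_eq[of 0] f(1) TB_closed(1) by simp
    show "?TA #>\<^bsub>?GA\<^esub> ?z \<in> carrier (tensor_product R A F)"
      using zC by (auto simp: tensor_product_def FactGroup_def RCOSETS_def)
    show "?TA #>\<^bsub>?GA\<^esub> 0 \<in> carrier (tensor_product R A F)"
      unfolding tensor_product_def FactGroup_def RCOSETS_def
      by (simp, rule bexI[of _ 0]) auto
  qed
  moreover have "?z \<in> ?TA #>\<^bsub>?GA\<^esub> ?z"
    using TA.one_closed by (auto simp: r_coset_def intro!: bexI[of _ 0])
  ultimately have "?z \<in> ?TA"
    by (auto simp: r_coset_def)
  from relation_span_of_tensor_relation[OF A F genA x this]
  show ?thesis
    by (simp add: A_def)
qed

text \<open>Modulo relations the formal sum equals the sum over \<open>j\<close> of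
  \<open>e j\<close> tensor the combination of the \<open>x i\<close> with coefficients
  \<open>\<beta> i j\<close>, and that combination is zero. The facts \<open>left\<close> and
  \<open>right\<close> expand the first component and collect the second.\<close>

lemma tensor_relation_of_relations:
  fixes B :: "('a, 'n) module" and F :: "('a, 'm) module"
  assumes B: "left_module (op_ring R) B" and F: "left_module R F"
    and e: "\<And>j. j < q \<Longrightarrow> e j \<in> carrier B" and x: "\<And>i. i < n \<Longrightarrow> x i \<in> carrier F"
    and \<beta>: "\<And>i j. i < n \<Longrightarrow> j < (q::nat) \<Longrightarrow> \<beta> i j \<in> carrier R"
    and rel: "\<And>j. j < q \<Longrightarrow> lincomb F n (\<lambda>i. \<beta> i j) x = \<zero>\<^bsub>F\<^esub>"
  shows "(\<Sum>i<n. frag_of (lincomb B q (\<beta> i) e, x i)) \<in> tensor_relations R B F"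
proof -
  interpret B: left_module "op_ring R" B by fact
  interpret F: left_module R F by fact
  let ?T = "tensor_relations R B F"
  note T0 = tensor_relations_closed(1)[OF B F] and Tadd = tensor_relations_closed(2)[OF B F]
    and Tminus = tensor_relations_closed(3)[OF B F]
  have Tdiff: "u - v \<in> ?T" if "u \<in> ?T" "v \<in> ?T" for u v
    using Tadd[OF that(1) Tminus[OF that(2)]] by simp
  have Tsum: "(\<Sum>i<m. u i) \<in> ?T" if "\<And>i. i < m \<Longrightarrow> u i \<in> ?T" for m and u :: "nat \<Rightarrow> _"
    using that by (induction m) (auto simp: T0 Tadd)
  have eB: "lincomb B p s e \<in> carrier B" if "p \<le> q" "\<And>j. j < q \<Longrightarrow> s j \<in> carrier R" for p s
    using that e by (intro B.lincomb_closed) auto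
  have left0: "frag_of (\<zero>\<^bsub>B\<^esub>, y) \<in> ?T" if "y \<in> carrier F" for y
    using Tminus[OF tensor_relations_generators(1)[of "\<zero>\<^bsub>B\<^esub>" B "\<zero>\<^bsub>B\<^esub>" y F R]] that by simp
  have right0: "frag_of (y, \<zero>\<^bsub>F\<^esub>) \<in> ?T" if "y \<in> carrier B" for y
    using Tminus[OF tensor_relations_generators(2)[of y B "\<zero>\<^bsub>F\<^esub>" F "\<zero>\<^bsub>F\<^esub>" R]] that by simp
  have left: "frag_of (lincomb B p s e, y) - (\<Sum>j<p. frag_of (e j, s j \<odot>\<^bsub>F\<^esub> y)) \<in> ?T"
    if y: "y \<in> carrier F" and s: "\<And>j. j < q \<Longrightarrow> s j \<in> carrier R" and p: "p \<le> q" for p s y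
    using p
  proof (induction p)
    case 0
    then show ?case using left0[OF y] by simp
  next
    case (Suc p)
    then have p: "p < q" by simp
    have se: "s p \<odot>\<^bsub>B\<^esub> e p \<in> carrier B"
      using B.smult_closed[of "s p" "e p"] s[OF p] e[OF p] by simp
    have 1: "frag_of (lincomb B p s e \<oplus>\<^bsub>B\<^esub> s p \<odot>\<^bsub>B\<^esub> e p, y) - frag_of (lincomb B p s e, y)
        - frag_of (s p \<odot>\<^bsub>B\<^esub> e p, y) \<in> ?T"
      using eB[of p s] s p se y by (intro tensor_relations_generators(1)) auto
    have 2: "frag_of (s p \<odot>\<^bsub>B\<^esub> e p, y) - frag_of (e p, s p \<odot>\<^bsub>F\<^esub> y) \<in> ?T"
      using s[OF p] e[OF p] y by (intro tensor_relations_generators(3))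
    from Tadd[OF Tadd[OF 1 2] Suc.IH] p show ?case
      by (simp add: algebra_simps)
  qed
  have right: "(\<Sum>i<m. frag_of (y, r i \<odot>\<^bsub>F\<^esub> x i)) - frag_of (y, lincomb F m r x) \<in> ?T"
    if y: "y \<in> carrier B" and r: "\<And>i. i < n \<Longrightarrow> r i \<in> carrier R" and m: "m \<le> n" for m r y
    using m
  proof (induction m)
    case 0
    then show ?case using Tminus[OF right0[OF y]] by simp
  next
    case (Suc m)
    then have m: "m < n" by simp
    have l: "lincomb F m r x \<in> carrier F"
      using m r x by (intro F.lincomb_closed) auto
    have 1: "frag_of (y, lincomb F m r x \<oplus>\<^bsub>F\<^esub> r m \<odot>\<^bsub>F\<^esub> x m) - frag_of (y, lincomb F m r x)
        - frag_of (y, r m \<odot>\<^bsub>F\<^esub> x m) \<in> ?T"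
      using l y F.smult_closed[OF r[OF m] x[OF m]] by (intro tensor_relations_generators(2)) auto
    from Tdiff[OF Suc.IH 1] m show ?case
      by (simp add: algebra_simps)
  qed
  have "(\<Sum>i<n. frag_of (lincomb B q (\<beta> i) e, x i) - (\<Sum>j<q. frag_of (e j, \<beta> i j \<odot>\<^bsub>F\<^esub> x i))) \<in> ?T"
    using \<beta> x by (intro Tsum left) auto
  moreover have "(\<Sum>j<q. \<Sum>i<n. frag_of (e j, \<beta> i j \<odot>\<^bsub>F\<^esub> x i)) \<in> ?T"
  proof (rule Tsum)
    fix j assume j: "j < q"
    show "(\<Sum>i<n. frag_of (e j, \<beta> i j \<odot>\<^bsub>F\<^esub> x i)) \<in> ?T"
      using Tadd[OF right[of "e j" "\<lambda>i. \<beta> i j" n] right0[of "e j"]] e[OF j] \<beta> j rel[OF j] by simp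
  qed
  moreover have "(\<Sum>j<q. \<Sum>i<n. frag_of (e j, \<beta> i j \<odot>\<^bsub>F\<^esub> x i)) =
      (\<Sum>i<n. \<Sum>j<q. frag_of (e j, \<beta> i j \<odot>\<^bsub>F\<^esub> x i))"
    by (rule sum.swap)
  ultimately have "(\<Sum>i<n. frag_of (lincomb B q (\<beta> i) e, x i) - (\<Sum>j<q. frag_of (e j, \<beta> i j \<odot>\<^bsub>F\<^esub> x i)))
      + (\<Sum>i<n. \<Sum>j<q. frag_of (e j, \<beta> i j \<odot>\<^bsub>F\<^esub> x i)) \<in> ?T"
    using Tadd by simp
  then show ?thesis
    by (simp add: sum_subtractf)
qed

text \<open>The equational criterion for flatness: solutions in \<open>F\<close> of a linear system
  over \<open>R\<close> come from solutions in \<open>R\<close>. The rows of \<beta> are taken as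
  elements of the right module R^q. The equations make the sum of row \<open>i\<close> tensor
  \<open>x i\<close> vanish, and relations among the rows are the solutions in
  \<open>R\<close>.\<close>

lemma flat_equational:
  fixes F :: "('a, 'u) module" and e :: "'a \<Rightarrow> 'u"
  assumes inf: "infinite (UNIV :: 'u set)" "inj_on e (carrier R)"
    and flat: "flat_module R F" and x: "\<And>i. i < n \<Longrightarrow> x i \<in> carrier F"
    and \<beta>: "\<And>i j. i < n \<Longrightarrow> j < (q::nat) \<Longrightarrow> \<beta> i j \<in> carrier R"
    and rel: "\<And>j. j < q \<Longrightarrow> lincomb F n (\<lambda>i. \<beta> i j) x = \<zero>\<^bsub>F\<^esub>"
  shows "relation_span F n {s. (\<forall>i<n. s i \<in> carrier R) \<and>
    (\<forall>j<q. lincomb (regular_module (op_ring R)) n s (\<lambda>i. \<beta> i j) = \<zero>\<^bsub>R\<^esub>)} x"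
proof -
  have F: "left_module R F"
    using flat by (simp add: flat_module_def)
  let ?P = "free_module (op_ring R) q"
  have ring: "ring (op_ring R)"
    using left_module_ring[OF F] by simp
  then have P: "left_module (op_ring R) ?P"
    by (intro left_module_power_module left_module_regular)
  interpret P: left_module "op_ring R" ?P by fact
  \<comment> \<open>R^q is copied into \<open>'u\<close>, where flatness of \<open>F\<close> can be
    applied to its submodules.\<close>
  obtain h :: "(nat \<Rightarrow> 'a) \<Rightarrow> 'u" where h: "inj_on h (carrier ?P)"
    using embed_power_module[OF inf(1), of e "op_ring R" q] inf(2) by auto
  let ?B = "image_module h ?P"
  have B: "left_module (op_ring R) ?B"
    by (rule left_module_image_module[OF P h])
  define v where "v i = restrict (\<beta> i) {..<q}" for i
  have v: "v i \<in> carrier ?P" if "i < n" for i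
    using \<beta>[OF that] by (auto simp: v_def power_module_simps)
  note hom = image_module_hom[OF P h]
  have u: "unit_vector (op_ring R) q j \<in> carrier ?P" for j
    by (rule unit_vector_closed[OF ring])
  have hv: "h (v i) = lincomb ?B q (\<beta> i) (\<lambda>j. h (unit_vector (op_ring R) q j))" if "i < n" for i
  proof -
    have "h (v i) = restrict h (carrier ?P) (lincomb ?P q (v i) (unit_vector (op_ring R) q))"
      using lincomb_unit_vector[OF ring v[OF that]] v[OF that] by simp
    also have "\<dots> = lincomb ?B q (v i) (\<lambda>j. restrict h (carrier ?P) (unit_vector (op_ring R) q j))"
      using \<beta>[OF that] u by (intro mod_hom_lincomb[OF hom P B]) (auto simp: v_def)
    also have "\<dots> = lincomb ?B q (\<beta> i) (\<lambda>j. h (unit_vector (op_ring R) q j))"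
      by (rule lincomb_cong) (use u in \<open>auto simp: v_def\<close>)
    finally show ?thesis .
  qed
  have "(\<Sum>i<n. frag_of (lincomb ?B q (\<beta> i) (\<lambda>j. h (unit_vector (op_ring R) q j)), x i)) \<in> tensor_relations R ?B F"
    by (rule tensor_relation_of_relations[OF B F _ x \<beta> rel]) (auto intro: imageI u)
  then have "(\<Sum>i<n. frag_of (h (v i), x i)) \<in> tensor_relations R ?B F"
    using hv by simp
  then have "relation_span F n {s. (\<forall>i<n. s i \<in> carrier R) \<and> lincomb ?B n s (\<lambda>i. h (v i)) = \<zero>\<^bsub>?B\<^esub>} x"
    by (intro flat_relation_span[OF flat B _ x]) (auto intro: imageI v)
  then show ?thesis
  proof (rule relation_span_mono, safe)
    fix s j assume s: "\<forall>i<n. s i \<in> carrier R" "lincomb ?B n s (\<lambda>i. h (v i)) = \<zero>\<^bsub>?B\<^esub>" and j: "j < q"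
    have l: "lincomb ?P n s v \<in> carrier ?P"
      using s(1) v by (intro P.lincomb_closed) auto
    have "h (lincomb ?P n s v) = restrict h (carrier ?P) (lincomb ?P n s v)"
      using l by simp
    also have "\<dots> = lincomb ?B n s (\<lambda>i. restrict h (carrier ?P) (v i))"
      using s(1) v by (intro mod_hom_lincomb[OF hom P B]) auto
    also have "\<dots> = lincomb ?B n s (\<lambda>i. h (v i))"
      by (rule lincomb_cong) (use v in auto)
    also have "\<dots> = h \<zero>\<^bsub>?P\<^esub>"
      using s(2) by simp
    finally have "lincomb ?P n s v = \<zero>\<^bsub>?P\<^esub>"
      using h l P.M.zero_closed by (simp add: inj_on_eq_iff)
    then have "lincomb ?P n s v j = \<zero>\<^bsub>?P\<^esub> j"
      by simp
    then have "lincomb (regular_module (op_ring R)) n s (\<lambda>i. v i j) = \<zero>\<^bsub>R\<^esub>"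
      using j by (simp add: lincomb_power_module) (simp add: power_module_simps)
    moreover have "lincomb (regular_module (op_ring R)) n s (\<lambda>i. v i j) =
        lincomb (regular_module (op_ring R)) n s (\<lambda>i. \<beta> i j)"
      by (rule lincomb_cong) (use j in \<open>auto simp: v_def\<close>)
    ultimately show "lincomb (regular_module (op_ring R)) n s (\<lambda>i. \<beta> i j) = \<zero>\<^bsub>R\<^esub>"
      by simp
  qed
qed


section \<open>Vanishing on duals of kernels\<close>

text \<open>The dictionary between matrix equations over the two rings: changing sides exchanges
  coefficients and vectors.\<close>

lemma lincomb_regular_op:
  "lincomb (regular_module (op_ring R)) n r s = lincomb (regular_module R) n s r"
  by (induction n) auto

lemma (in left_module) lincomb_smult_right:
  assumes "\<And>i. i < n \<Longrightarrow> r i \<in> carrier R" "\<And>i. i < n \<Longrightarrow> t i \<in> carrier R" "x \<in> carrier M"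
  shows "lincomb M n r (\<lambda>i. t i \<odot>\<^bsub>M\<^esub> x) = lincomb (regular_module R) n r t \<odot>\<^bsub>M\<^esub> x"
proof -
  interpret RR: left_module R "regular_module R"
    by (rule left_module_regular) (rule R.ring_axioms)
  have "lincomb (regular_module R) m r t \<in> carrier R" if "m \<le> n" for m
    using RR.lincomb_closed[of m r t] assms that by simp
  then have "lincomb M m r (\<lambda>i. t i \<odot>\<^bsub>M\<^esub> x) = lincomb (regular_module R) m r t \<odot>\<^bsub>M\<^esub> x" if "m \<le> n" for m
    using that assms by (induction m) (auto simp: smult_l_distr smult_assoc)
  then show ?thesis by simp
qed

text \<open>If every member of \<open>L\<close> is in the image of the matrix \<alpha>, then so is
  every tuple spanned by \<open>L\<close>: a summand \<open>s\<close> times \<open>x\<close> is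
  \<alpha> applied to the tuple \<open>t\<close> times \<open>x\<close>.\<close>

lemma relation_span_factor:
  assumes F: "left_module R F" and rel: "relation_span F n L z"
    and \<alpha>: "\<And>i k. i < m \<Longrightarrow> k < n \<Longrightarrow> \<alpha> i k \<in> carrier R"
    and L: "\<And>s. s \<in> L \<Longrightarrow> \<exists>t. (\<forall>i<m. t i \<in> carrier R) \<and>
      (\<forall>k<n. s k = lincomb (regular_module R) m (\<lambda>i. \<alpha> i k) t)"
  shows "\<exists>w. (\<forall>i<m. w i \<in> carrier F) \<and> (\<forall>k<n. z k = lincomb F m (\<lambda>i. \<alpha> i k) w)"
proof -
  interpret F: left_module R F by fact
  show ?thesis
    using rel
  proof induction
    case (zero v)
    then show ?case
      using \<alpha> by (intro exI[of _ "\<lambda>_. \<zero>\<^bsub>F\<^esub>"]) auto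
  next
    case (step v x s w)
    obtain u where u: "\<forall>i<m. u i \<in> carrier F" "\<forall>k<n. v k = lincomb F m (\<lambda>i. \<alpha> i k) u"
      using step.IH by blast
    obtain t where t: "\<forall>i<m. t i \<in> carrier R"
        "\<forall>k<n. s k = lincomb (regular_module R) m (\<lambda>i. \<alpha> i k) t"
      using L[OF step(3)] by blast
    have "w k = lincomb F m (\<lambda>i. \<alpha> i k) (\<lambda>i. u i \<oplus>\<^bsub>F\<^esub> t i \<odot>\<^bsub>F\<^esub> x)" if k: "k < n" for k
      using step(2,4) u t \<alpha> k
      by (simp add: F.lincomb_add_right F.lincomb_smult_right F.smult_closed)
    then show ?case
      using u t step(2) by (intro exI[of _ "\<lambda>i. u i \<oplus>\<^bsub>F\<^esub> t i \<odot>\<^bsub>F\<^esub> x"]) (auto simp: F.smult_closed)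
  qed
qed

lemma relation_span_image:
  assumes p: "p \<in> mod_hom R M N" and M: "left_module R M" and "left_module R N"
    and L: "\<forall>s\<in>L. \<forall>i<n. s i \<in> carrier R" and v: "relation_span M n L v"
  shows "relation_span N n L (\<lambda>i. p (v i))"
proof -
  interpret M: left_module R M by fact
  show ?thesis
    using v
  proof induction
    case (zero v)
    then show ?case
      by (intro relation_span.zero) (simp add: mod_hom_zero[OF assms(1-3)])
  next
    case (step v x s w)
    show ?case
    proof (rule relation_span.step[OF step(5) mod_hom_closed[OF p step(2)] step(3)])
      fix i assume i: "i < n"
      then show "p (w i) = p (v i) \<oplus>\<^bsub>N\<^esub> s i \<odot>\<^bsub>N\<^esub> p x"
        using step(2-4) L M.relation_span_closed[OF step(1) L i] 
        by (simp add: mod_hom_add[OF p] mod_hom_smult[OF p] M.smult_closed)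
    qed
  qed
qed

text \<open>
  This is the vanishing of Tor in degree two between \<open>J\<close> and the cokernel of \<open>\<beta>\<close>, in terms of the
  presentation matrices.
\<close>

lemma flat_dim_exactness:
  fixes J :: "('a, 'u) module" and e :: "'a \<Rightarrow> 'u"
  assumes inf: "infinite (UNIV :: 'u set)" "inj_on e (carrier R)"
    and J: "flat_dim_less R J 2"
    and \<alpha>: "\<And>i k. i < m \<Longrightarrow> k < n \<Longrightarrow> \<alpha> i k \<in> carrier R"
    and \<beta>: "\<And>k j. k < n \<Longrightarrow> j < (q::nat) \<Longrightarrow> \<beta> k j \<in> carrier R"
    and complex: "\<And>i j. i < m \<Longrightarrow> j < q \<Longrightarrow>
      lincomb (regular_module R) n (\<lambda>k. \<beta> k j) (\<alpha> i) = \<zero>\<^bsub>R\<^esub>"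
    and exact: "\<And>s. (\<And>k. k < n \<Longrightarrow> s k \<in> carrier R) \<Longrightarrow>
      (\<And>j. j < q \<Longrightarrow> lincomb (regular_module R) n (\<lambda>k. \<beta> k j) s = \<zero>\<^bsub>R\<^esub>) \<Longrightarrow>
      \<exists>t. (\<forall>i<m. t i \<in> carrier R) \<and> (\<forall>k<n. s k = lincomb (regular_module R) m (\<lambda>i. \<alpha> i k) t)"
    and c: "\<And>i. i < m \<Longrightarrow> c i \<in> carrier J"
    and rel: "\<And>k. k < n \<Longrightarrow> lincomb J m (\<lambda>i. \<alpha> i k) c = \<zero>\<^bsub>J\<^esub>"
  shows "relation_span J m {t. (\<forall>i<m. t i \<in> carrier R) \<and>
    (\<forall>k<n. lincomb (regular_module R) m (\<lambda>i. \<alpha> i k) t = \<zero>\<^bsub>R\<^esub>)} c"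
    (is "relation_span J m ?L c")
proof -
  have Jm: "left_module R J"
    using J by (simp add: flat_dim_less_def)
  obtain F :: "nat \<Rightarrow> ('a, 'u) module" and p d where
    "\<forall>k. flat_module R (F k)" "\<forall>k\<ge>2. carrier (F k) = {\<zero>\<^bsub>F k\<^esub>}"
    and p: "p \<in> mod_hom R (F 0) J" "p ` carrier (F 0) = carrier J"
    and "\<forall>k. d k \<in> mod_hom R (F (Suc k)) (F k)" and im0: "d 0 ` carrier (F 1) = a_kernel (F 0) J p"
    and "\<forall>k. d (Suc k) ` carrier (F (Suc (Suc k))) = a_kernel (F (Suc k)) (F k) (d k)"
    using J unfolding flat_dim_less_def by (elim conjE exE)
  then have flat: "\<And>k. flat_module R (F k)" and F2: "carrier (F 2) = {\<zero>\<^bsub>F 2\<^esub>}"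
    and d: "\<And>k. d k \<in> mod_hom R (F (Suc k)) (F k)"
    and im1: "d 1 ` carrier (F 2) = a_kernel (F 1) (F 0) (d 0)"
    by (auto simp: numeral_2_eq_2)
  have d0: "d 0 \<in> mod_hom R (F 1) (F 0)" and d1: "d 1 \<in> mod_hom R (F 2) (F 1)"
    using d[of 0] d[of 1] by (auto simp: numeral_2_eq_2)
  have Fm: "left_module R (F k)" for k
    using flat[of k] by (simp add: flat_module_def)
  interpret J: left_module R J by fact
  interpret F0: left_module R "F 0" by (rule Fm)
  interpret F1: left_module R "F 1" by (rule Fm)
  \<comment> \<open>The bound on the flat dimension enters here: \<open>F 2\<close> is zero, so
    \<open>d 0\<close> is injective.\<close>
  have d0_inj: "x = \<zero>\<^bsub>F 1\<^esub>" if "x \<in> carrier (F 1)" "d 0 x = \<zero>\<^bsub>F 0\<^esub>" for x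
  proof -
    have "x \<in> d 1 ` carrier (F 2)"
      unfolding im1 using that by (simp add: a_kernel_iff)
    then show ?thesis
      using F2 mod_hom_zero[OF d1 Fm Fm] by auto
  qed
  have "\<exists>x. x \<in> carrier (F 0) \<and> p x = c i" if "i < m" for i
    using c[OF that] unfolding p(2)[symmetric] by auto
  then obtain c' where c': "\<And>i. i < m \<Longrightarrow> c' i \<in> carrier (F 0)" "\<And>i. i < m \<Longrightarrow> p (c' i) = c i"
    by metis
  \<comment> \<open>The lifts \<open>c'\<close> need not satisfy the equations; the errors
    \<open>y k\<close> lie in the kernel of \<open>p\<close> and hence come from
    \<open>F 1\<close>.\<close>
  define y where "y k = lincomb (F 0) m (\<lambda>i. \<alpha> i k) c'" for k
  have y: "y k \<in> carrier (F 0)" if "k < n" for k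
    unfolding y_def using \<alpha> c' that by (intro F0.lincomb_closed) auto
  have "p (y k) = \<zero>\<^bsub>J\<^esub>" if k: "k < n" for k
  proof -
    have "p (y k) = lincomb J m (\<lambda>i. \<alpha> i k) (\<lambda>i. p (c' i))"
      unfolding y_def using \<alpha> c' k by (intro mod_hom_lincomb[OF p(1) Fm Jm]) auto
    also have "\<dots> = lincomb J m (\<lambda>i. \<alpha> i k) c"
      by (rule lincomb_cong) (use c' in auto)
    finally show ?thesis
      using rel[OF k] by simp
  qed
  then have "y k \<in> d 0 ` carrier (F 1)" if "k < n" for k
    unfolding im0 using y that by (simp add: a_kernel_iff)
  then have "\<exists>x. x \<in> carrier (F 1) \<and> d 0 x = y k" if "k < n" for k
    using that by fastforce
  then obtain z where z: "\<And>k. k < n \<Longrightarrow> z k \<in> carrier (F 1)" "\<And>k. k < n \<Longrightarrow> d 0 (z k) = y k"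
    by metis
  \<comment> \<open>Under \<open>d 0\<close> this becomes \<beta> applied to \<alpha> applied to
    \<open>c'\<close>, which is zero because the matrices form a complex.\<close>
  have "lincomb (F 1) n (\<lambda>k. \<beta> k j) z = \<zero>\<^bsub>F 1\<^esub>" if j: "j < q" for j
  proof (rule d0_inj)
    show "lincomb (F 1) n (\<lambda>k. \<beta> k j) z \<in> carrier (F 1)"
      using \<beta> z j by (intro F1.lincomb_closed) auto
    have "d 0 (lincomb (F 1) n (\<lambda>k. \<beta> k j) z) = lincomb (F 0) n (\<lambda>k. \<beta> k j) (\<lambda>k. d 0 (z k))"
      using \<beta> z j by (intro mod_hom_lincomb[OF d0 Fm Fm]) auto
    also have "\<dots> = lincomb (F 0) n (\<lambda>k. \<beta> k j) (\<lambda>k. lincomb (F 0) m (\<lambda>i. \<alpha> i k) c')"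
      by (rule lincomb_cong) (auto simp: z y_def)
    also have "\<dots> = lincomb (F 0) m (\<lambda>i. lincomb (regular_module R) n (\<lambda>k. \<beta> k j) (\<alpha> i)) c'"
      using \<alpha> \<beta> j c' by (subst F0.lincomb_lincomb) auto
    also have "\<dots> = lincomb (F 0) m (\<lambda>i. \<zero>\<^bsub>R\<^esub>) c'"
      by (rule lincomb_cong) (use complex j in auto)
    also have "\<dots> = \<zero>\<^bsub>F 0\<^esub>"
      using c' by simp
    finally show "d 0 (lincomb (F 1) n (\<lambda>k. \<beta> k j) z) = \<zero>\<^bsub>F 0\<^esub>" .
  qed
  \<comment> \<open>Flatness of \<open>F 1\<close> writes \<open>z\<close> through solutions over
    \<open>R\<close>, and by exactness these lie in the image of \<alpha>.\<close>
  then have "relation_span (F 1) n {s. (\<forall>i<n. s i \<in> carrier R) \<and>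
      (\<forall>j<q. lincomb (regular_module (op_ring R)) n s (\<lambda>i. \<beta> i j) = \<zero>\<^bsub>R\<^esub>)} z"
    using z \<beta> by (intro flat_equational[OF inf flat]) auto
  then have "\<exists>w. (\<forall>i<m. w i \<in> carrier (F 1)) \<and> (\<forall>k<n. z k = lincomb (F 1) m (\<lambda>i. \<alpha> i k) w)"
    using \<alpha> exact by (rule relation_span_factor[OF Fm]) (auto simp: lincomb_regular_op)
  then obtain w where w: "\<And>i. i < m \<Longrightarrow> w i \<in> carrier (F 1)"
      "\<And>k. k < n \<Longrightarrow> z k = lincomb (F 1) m (\<lambda>i. \<alpha> i k) w"
    by blast
  have dw: "d 0 (w i) \<in> carrier (F 0)" if "i < m" for i
    using mod_hom_closed[OF d0 w(1)[OF that]] .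
  \<comment> \<open>Subtracting a boundary corrects the lift without changing its image in
    \<open>J\<close>. The equations now hold in \<open>F 0\<close>, whose flatness gives the claim
    after applying \<open>p\<close>.\<close>
  define u where "u i = c' i \<ominus>\<^bsub>F 0\<^esub> d 0 (w i)" for i
  have u: "u i \<in> carrier (F 0)" if "i < m" for i
    using dw c' that by (simp add: u_def)
  have "lincomb (F 0) m (\<lambda>i. \<alpha> i k) u = \<zero>\<^bsub>F 0\<^esub>" if k: "k < n" for k
  proof -
    have "lincomb (F 0) m (\<lambda>i. \<alpha> i k) (\<lambda>i. d 0 (w i)) = d 0 (lincomb (F 1) m (\<lambda>i. \<alpha> i k) w)"
      using \<alpha> w k by (intro mod_hom_lincomb[OF d0 Fm Fm, symmetric]) auto
    then have eq: "lincomb (F 0) m (\<lambda>i. \<alpha> i k) (\<lambda>i. d 0 (w i)) = y k"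
      using w(2)[OF k] z(2)[OF k] by simp
    have "lincomb (F 0) m (\<lambda>i. \<alpha> i k) u \<oplus>\<^bsub>F 0\<^esub> lincomb (F 0) m (\<lambda>i. \<alpha> i k) (\<lambda>i. d 0 (w i)) =
        lincomb (F 0) m (\<lambda>i. \<alpha> i k) (\<lambda>i. u i \<oplus>\<^bsub>F 0\<^esub> d 0 (w i))"
      using \<alpha> u dw k by (intro F0.lincomb_add_right[symmetric]) auto
    also have "\<dots> = y k"
      unfolding y_def
      by (rule lincomb_cong) (use dw c' in \<open>auto simp: u_def a_minus_def F0.M.a_assoc F0.M.l_neg\<close>)
    finally have *: "lincomb (F 0) m (\<lambda>i. \<alpha> i k) u \<oplus>\<^bsub>F 0\<^esub> y k = y k"
      unfolding eq .
    have "lincomb (F 0) m (\<lambda>i. \<alpha> i k) u \<in> carrier (F 0)"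
      using \<alpha> u k by (intro F0.lincomb_closed) auto
    with * y[OF k] show ?thesis
      by simp
  qed
  then have "relation_span (F 0) m {t. (\<forall>i<m. t i \<in> carrier R) \<and>
      (\<forall>k<n. lincomb (regular_module (op_ring R)) m t (\<lambda>i. \<alpha> i k) = \<zero>\<^bsub>R\<^esub>)} u"
    using u \<alpha> by (intro flat_equational[OF inf flat]) auto
  then have "relation_span J m ?L (\<lambda>i. p (u i))"
    by (intro relation_span_image[OF p(1) Fm Jm]) (auto simp: lincomb_regular_op)
  then show ?thesis
  proof (rule relation_span_cong)
    fix i assume i: "i < m"
    have "p (d 0 (w i)) = \<zero>\<^bsub>J\<^esub>"
      using im0 w(1)[OF i] by (auto simp: a_kernel_iff set_eq_iff)
    then have "p (u i) = c i \<ominus>\<^bsub>J\<^esub> \<zero>\<^bsub>J\<^esub>"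
      using mod_hom_diff[OF p(1) Fm Jm c'(1)[OF i] dw[OF i]] c'(2)[OF i] by (simp add: u_def)
    also have "\<dots> = c i"
      using c[OF i] J.M.minus_equality[of "\<zero>\<^bsub>J\<^esub>" "\<zero>\<^bsub>J\<^esub>"] by (simp add: a_minus_def)
    finally show "c i = p (u i)" by simp
  qed
qed

lemma hom_factor_surj:
  assumes M: "left_module R M" and N: "left_module R N" and X: "left_module R X"
    and p: "p \<in> mod_hom R M N" "p ` carrier M = carrier N" and g: "g \<in> mod_hom R M X"
    and ker: "\<And>x. x \<in> carrier M \<Longrightarrow> p x = \<zero>\<^bsub>N\<^esub> \<Longrightarrow> g x = \<zero>\<^bsub>X\<^esub>"
  shows "\<exists>f\<in>mod_hom R N X. \<forall>x\<in>carrier M. f (p x) = g x"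
proof -
  interpret M: left_module R M by fact
  interpret N: left_module R N by fact
  interpret X: left_module R X by fact
  \<comment> \<open>An arbitrary section of \<open>p\<close>. Linearity of the factored map comes
    from \<open>eq\<close>, since \<open>g\<close> takes the same value on all preimages of a
    point.\<close>
  let ?s = "inv_into (carrier M) p"
  have s: "?s y \<in> carrier M" "p (?s y) = y" if "y \<in> carrier N" for y
    using that p(2) by (auto simp: inv_into_into f_inv_into_f)
  have eq: "g x = g x'" if x: "x \<in> carrier M" "x' \<in> carrier M" "p x = p x'" for x x'
  proof -
    have "p (x \<ominus>\<^bsub>M\<^esub> x') = \<zero>\<^bsub>N\<^esub>"
      using x mod_hom_closed[OF p(1)] by (simp add: mod_hom_diff[OF p(1) M N] N.minus_eq_zero_iff)
    then have "g x \<ominus>\<^bsub>X\<^esub> g x' = \<zero>\<^bsub>X\<^esub>"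
      using ker[of "x \<ominus>\<^bsub>M\<^esub> x'"] x by (simp add: mod_hom_diff[OF g M X])
    then show ?thesis
      using x mod_hom_closed[OF g] by (simp add: X.minus_eq_zero_iff)
  qed
  have "(\<lambda>y\<in>carrier N. g (?s y)) \<in> mod_hom R N X"
  proof (rule mod_hom_restrictI[OF N])
    show "g (?s y) \<in> carrier X" if "y \<in> carrier N" for y
      using s[OF that] mod_hom_closed[OF g] by simp
    show "g (?s (x \<oplus>\<^bsub>N\<^esub> y)) = g (?s x) \<oplus>\<^bsub>X\<^esub> g (?s y)" if "x \<in> carrier N" "y \<in> carrier N" for x y
      using s[OF that(1)] s[OF that(2)] s[of "x \<oplus>\<^bsub>N\<^esub> y"] that
        eq[of "?s (x \<oplus>\<^bsub>N\<^esub> y)" "?s x \<oplus>\<^bsub>M\<^esub> ?s y"] mod_hom_add[OF p(1)] mod_hom_add[OF g] by simp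
    show "g (?s (a \<odot>\<^bsub>N\<^esub> x)) = a \<odot>\<^bsub>X\<^esub> g (?s x)" if "a \<in> carrier R" "x \<in> carrier N" for a x
      using s[OF that(2)] s[of "a \<odot>\<^bsub>N\<^esub> x"] that N.smult_closed M.smult_closed
        eq[of "?s (a \<odot>\<^bsub>N\<^esub> x)" "a \<odot>\<^bsub>M\<^esub> ?s x"] mod_hom_smult[OF p(1)] mod_hom_smult[OF g] by simp
  qed
  moreover have "(\<lambda>y\<in>carrier N. g (?s y)) (p x) = g x" if "x \<in> carrier M" for x
    using eq[OF s(1) that s(2)] mod_hom_closed[OF p(1) that] by simp
  ultimately show ?thesis
    by blast
qed


section \<open>Functoriality of the dual\<close>

lemma dual_map_apply:
  "g \<in> carrier (dual R N) \<Longrightarrow> x \<in> carrier M \<Longrightarrow> dual_map R M N f g x = g (f x)"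
  by (simp add: dual_map_def compose_def)

lemma dual_map_closed:
  assumes "f \<in> mod_hom R M N" "left_module R M" "g \<in> carrier (dual R N)"
  shows "dual_map R M N f g \<in> carrier (dual R M)"
  using mod_hom_compose[OF assms(1) _ assms(2), of g "regular_module R"] assms(3)
  by (simp add: dual_map_def dual_simps(1))

lemma dual_map_hom:
  assumes "f \<in> mod_hom R M N" "left_module R M" "left_module R N"
  shows "dual_map R M N f \<in> mod_hom (op_ring R) (dual R N) (dual R M)"
proof -
  interpret M: left_module R M by fact
  interpret N: left_module R N by fact
  interpret D: left_module "op_ring R" "dual R N"
    by (rule left_module_dual) fact
  note fc = mod_hom_closed[OF assms(1)]
  show ?thesis
  proof (rule mod_homI)
    show "dual_map R M N f \<in> carrier (dual R N) \<rightarrow>\<^sub>E carrier (dual R M)"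
      using dual_map_closed[OF assms(1,2)] by (auto simp: dual_map_def)
    show "dual_map R M N f (g \<oplus>\<^bsub>dual R N\<^esub> h) = dual_map R M N f g \<oplus>\<^bsub>dual R M\<^esub> dual_map R M N f h"
      if "g \<in> carrier (dual R N)" "h \<in> carrier (dual R N)" for g h
    proof (rule ext)
      fix x show "dual_map R M N f (g \<oplus>\<^bsub>dual R N\<^esub> h) x =
          (dual_map R M N f g \<oplus>\<^bsub>dual R M\<^esub> dual_map R M N f h) x"
        using that D.M.a_closed[OF that] fc
        by (cases "x \<in> carrier M") (simp_all add: dual_map_def compose_def dual_simps(3))
    qed
    show "dual_map R M N f (a \<odot>\<^bsub>dual R N\<^esub> g) = a \<odot>\<^bsub>dual R M\<^esub> dual_map R M N f g"
      if "a \<in> carrier (op_ring R)" "g \<in> carrier (dual R N)" for a g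
    proof (rule ext)
      fix x show "dual_map R M N f (a \<odot>\<^bsub>dual R N\<^esub> g) x = (a \<odot>\<^bsub>dual R M\<^esub> dual_map R M N f g) x"
        using that D.smult_closed[OF that] fc
        by (cases "x \<in> carrier M") (simp_all add: dual_map_def compose_def dual_simps(4))
    qed
  qed
qed

lemma dual_minus:
  assumes "left_module R M" "f \<in> carrier (dual R M)" "x \<in> carrier M"
  shows "(\<ominus>\<^bsub>dual R M\<^esub> f) x = \<ominus>\<^bsub>R\<^esub> f x"
proof -
  interpret M: left_module R M by fact
  interpret D: left_module "op_ring R" "dual R M"
    by (rule left_module_dual) fact
  have "(\<ominus>\<^bsub>dual R M\<^esub> f \<oplus>\<^bsub>dual R M\<^esub> f) x = \<zero>\<^bsub>dual R M\<^esub> x"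
    using assms(2) by (simp add: D.M.l_neg)
  then have "(\<ominus>\<^bsub>dual R M\<^esub> f) x \<oplus>\<^bsub>R\<^esub> f x = \<zero>\<^bsub>R\<^esub>"
    using assms(3) by (simp add: dual_simps(2,3))
  then show ?thesis
    using dual_closed[OF assms(2,3)] dual_closed[OF D.M.a_inv_closed[OF assms(2)] assms(3)]
    by (simp add: M.R.minus_equality)
qed

lemma dual_lincomb:
  assumes "left_module R M" "f \<in> carrier (dual R M)"
    and "\<And>i. i < n \<Longrightarrow> r i \<in> carrier R" "\<And>i. i < n \<Longrightarrow> w i \<in> carrier M"
  shows "f (lincomb M n r w) = lincomb (regular_module R) n r (\<lambda>i. f (w i))"
  using assms
  by (intro mod_hom_lincomb[OF _ assms(1) left_module_regular[OF left_module_ring[OF assms(1)]]])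
    (auto simp: dual_simps(1))

lemma projection_dual:
  assumes "ring R" "k < n"
  shows "(\<lambda>v\<in>carrier (free_module R n). v k)
    \<in> carrier (dual R (free_module R n))"
  using assms
  by (intro dual_restrictI left_module_power_module left_module_regular)
    (auto simp: power_module_simps)

text \<open>\<open>K\<close> is the kernel of the map W -> R^q with components \<open>f j\<close>.
  Functionals in place of a map to a free module suit all uses: kernels of maps into a torsionless
  module, where the \<open>f j\<close> come from generators of its dual, and duals, which are
  solution sets of linear equations. The types of \<open>K\<close> and \<open>W\<close> are
  independent of the universe.\<close>

locale functional_kernel =
  fixes R :: "'a ring" and K :: "('a, 'k) module" and W :: "('a, 'w) module"
    and \<iota> :: "'k \<Rightarrow> 'w" and q :: nat and f :: "nat \<Rightarrow> 'w \<Rightarrow> 'a" and n :: nat and w :: "nat \<Rightarrow> 'w"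
  assumes noeth: "left_noetherian R"
    and K: "left_module R K" and W: "left_module R W"
    and \<iota>: "\<iota> \<in> mod_hom R K W" "inj_on \<iota> (carrier K)"
    and f: "\<And>j. j < q \<Longrightarrow> f j \<in> carrier (dual R W)"
    and ker: "\<iota> ` carrier K = {x \<in> carrier W. \<forall>j<q. f j x = \<zero>\<^bsub>R\<^esub>}"
    and gen: "generates R W n w"
begin

sublocale K: left_module R K by (rule K)
sublocale W: left_module R W by (rule W)

abbreviation "P \<equiv> free_module R n"
abbreviation "\<pi> \<equiv> free_map R W n w"

lemma P: "left_module R P"
  by (intro left_module_power_module left_module_regular K.R.ring_axioms)

lemma RR: "left_module R (regular_module R)"
  by (intro left_module_regular K.R.ring_axioms)

lemma RO: "left_module (op_ring R) (regular_module (op_ring R))"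
  by (intro left_module_regular) (simp add: K.R.ring_axioms)

lemma wW: "i < n \<Longrightarrow> w i \<in> carrier W"
  by (rule generates_closed[OF gen])

lemma \<pi>: "\<pi> \<in> mod_hom R P W"
  by (rule free_map_hom[OF W wW])

lemma \<pi>_surj: "\<pi> ` carrier P = carrier W"
  by (rule free_map_surj[OF W gen])

lemma f_\<pi>:
  assumes "s \<in> carrier P" "j < q"
  shows "f j (\<pi> s) = lincomb (regular_module R) n s (\<lambda>k. f j (w k))"
  using assms(1) wW dual_lincomb[OF W f[OF assms(2)], of n s w]
  by (auto simp: free_map_def power_module_simps)

text \<open>The \<open>a i\<close> generate the kernel of the composite R^n -> W -> R^q, whose
  elements are mapped into the image of \<open>K\<close>; the \<open>k i\<close> are the
  corresponding elements of \<open>K\<close>. With the values of the \<open>f j\<close> on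
  generators as second matrix, this is the exact chain R^m -> R^n -> R^q.\<close>

lemma relations:
  obtains m a k where "\<And>i. i < m \<Longrightarrow> a i \<in> carrier P" "\<And>i. i < m \<Longrightarrow> k i \<in> carrier K"
    "\<And>i. i < m \<Longrightarrow> \<iota> (k i) = \<pi> (a i)"
    "\<And>s. s \<in> carrier P \<Longrightarrow> \<forall>j<q. f j (\<pi> s) = \<zero>\<^bsub>R\<^esub> \<Longrightarrow>
      \<exists>t. (\<forall>i<m. t i \<in> carrier R) \<and> s = lincomb P m t a"
proof -
  interpret P: left_module R P by (rule P)
  define N where "N = {s \<in> carrier P. \<forall>j<q. f j (\<pi> s) = \<zero>\<^bsub>R\<^esub>}"
  have "submodule N R P"
  proof (rule P.submoduleI)
    show "N \<subseteq> carrier P"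
      by (auto simp: N_def)
    have "f j \<zero>\<^bsub>W\<^esub> = \<zero>\<^bsub>R\<^esub>" if "j < q" for j
      using mod_hom_zero[OF _ W RR, of "f j"] f[OF that] by (simp add: dual_simps(1))
    then show "\<zero>\<^bsub>P\<^esub> \<in> N"
      using mod_hom_zero[OF \<pi> P W] by (simp add: N_def)
    show "x \<oplus>\<^bsub>P\<^esub> y \<in> N" if "x \<in> N" "y \<in> N" for x y
      using that mod_hom_closed[OF \<pi>] f by (simp add: N_def mod_hom_add[OF \<pi>] dual_add[OF f])
    show "a \<odot>\<^bsub>P\<^esub> x \<in> N" if "a \<in> carrier R" "x \<in> N" for a x
      using that mod_hom_closed[OF \<pi>] f by (simp add: N_def mod_hom_smult[OF \<pi>] dual_smult[OF f] P.smult_closed)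
  qed
  moreover have "\<exists>r. (\<forall>i<n. r i \<in> carrier R) \<and> x = lincomb P n r (unit_vector R n)" if "x \<in> N" for x
    using that generates_unit_vector[OF K.R.ring_axioms, of n] by (auto simp: generates_def N_def)
  ultimately obtain m a where g: "generates R (P\<lparr>carrier := N\<rparr>) m a"
    using noetherian_submodule_generators[OF noeth P, of N n "unit_vector R n"]
      unit_vector_closed[OF K.R.ring_axioms] by blast
  have aN: "a i \<in> N" if "i < m" for i
    using generates_closed[OF g that] by simp
  have "\<exists>k. k \<in> carrier K \<and> \<iota> k = \<pi> (a i)" if "i < m" for i
  proof -
    have "\<pi> (a i) \<in> \<iota> ` carrier K"
      unfolding ker using aN[OF that] mod_hom_closed[OF \<pi>] by (auto simp: N_def)
    then show ?thesis by auto
  qed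
  then obtain k where k: "\<And>i. i < m \<Longrightarrow> k i \<in> carrier K" "\<And>i. i < m \<Longrightarrow> \<iota> (k i) = \<pi> (a i)"
    by metis
  have rel: "\<exists>t. (\<forall>i<m. t i \<in> carrier R) \<and> s = lincomb P m t a"
    if "s \<in> carrier P" "\<forall>j<q. f j (\<pi> s) = \<zero>\<^bsub>R\<^esub>" for s
  proof -
    have "s \<in> carrier (P\<lparr>carrier := N\<rparr>)"
      using that by (simp add: N_def)
    then obtain t where "\<And>i. i < m \<Longrightarrow> t i \<in> carrier R" "s = lincomb (P\<lparr>carrier := N\<rparr>) m t a"
      using generatesE[OF g] by blast
    then show ?thesis
      by (intro exI[of _ t]) simp
  qed
  show thesis
  proof (rule that[of m a k])
    show "a i \<in> carrier P" if "i < m" for i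
      using aN[OF that] by (simp add: N_def)
  qed (fact k rel)+
qed

text \<open>
  Enlarging the domain from \<open>Hom(K, R)\<close> to \<open>Hom(K, R) \<times> Hom(P, R)\<close>, with \<open>\<chi>\<close> zero on the second
  factor, forces the row \<open>c\<close> that represents \<open>\<chi>\<close> to be annihilated by the relations \<open>a\<close>; then
  flatness makes \<open>c\<close> a combination of relations among the generators \<open>k\<close> of \<open>K\<close>.
\<close>

theorem functional_vanishes:
  fixes J :: "('a, 'u) module" and e :: "'a \<Rightarrow> 'u"
  assumes inf: "infinite (UNIV :: 'u set)" "inj_on e (carrier R)"
    and J: "injective_module (op_ring R) J" "flat_dim_less (op_ring R) J 2"
    and \<chi>: "\<chi> \<in> mod_hom (op_ring R) (dual R K) J"
    and zero: "\<And>\<psi>. \<psi> \<in> carrier (dual R W) \<Longrightarrow> \<chi> (dual_map R K W \<iota> \<psi>) = \<zero>\<^bsub>J\<^esub>"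
    and \<phi>: "\<phi> \<in> carrier (dual R K)"
  shows "\<chi> \<phi> = \<zero>\<^bsub>J\<^esub>"
proof -
  have Jm: "left_module (op_ring R) J"
    using J(1) by (simp add: injective_module_def)
  interpret J: left_module "op_ring R" J by fact
  interpret P: left_module R P by (rule P)
  have DK: "left_module (op_ring R) (dual R K)" and DP: "left_module (op_ring R) (dual R P)"
    by (intro left_module_dual K P)+
  interpret DK: left_module "op_ring R" "dual R K" by fact
  interpret DP: left_module "op_ring R" "dual R P" by fact
  obtain m a k where a: "\<And>i. i < m \<Longrightarrow> a i \<in> carrier P" and k: "\<And>i. i < m \<Longrightarrow> k i \<in> carrier K"
    and ka: "\<And>i. i < m \<Longrightarrow> \<iota> (k i) = \<pi> (a i)"
    and rel: "\<And>s. s \<in> carrier P \<Longrightarrow> \<forall>j<q. f j (\<pi> s) = \<zero>\<^bsub>R\<^esub> \<Longrightarrow>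
      \<exists>t. (\<forall>i<m. t i \<in> carrier R) \<and> s = lincomb P m t a"
    by (rule relations, rule that)
  have \<iota>k: "\<iota> (lincomb K m t k) = \<pi> (lincomb P m t a)" if t: "\<forall>i<m. t i \<in> carrier R" for t
  proof -
    have "\<iota> (lincomb K m t k) = lincomb W m t (\<lambda>i. \<iota> (k i))"
      using t k by (intro mod_hom_lincomb[OF \<iota>(1) K W]) auto
    also have "\<dots> = lincomb W m t (\<lambda>i. \<pi> (a i))"
      by (rule lincomb_cong) (use ka in auto)
    also have "\<dots> = \<pi> (lincomb P m t a)"
      using t a by (intro mod_hom_lincomb[OF \<pi> P W, symmetric]) auto
    finally show ?thesis .
  qed
  let ?Q = "free_module (op_ring R) m"
  define \<Gamma> where "\<Gamma> = {(\<lambda>i\<in>{..<m}. \<phi> (k i) \<oplus>\<^bsub>R\<^esub> \<rho> (a i), \<chi> \<phi>) | \<phi> \<rho>.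
    \<phi> \<in> carrier (dual R K) \<and> \<rho> \<in> carrier (dual R P)}"
  have \<Gamma>I: "(\<lambda>i\<in>{..<m}. \<phi> (k i) \<oplus>\<^bsub>R\<^esub> \<rho> (a i), \<chi> \<phi>) \<in> \<Gamma>"
    if "\<phi> \<in> carrier (dual R K)" "\<rho> \<in> carrier (dual R P)" for \<phi> \<rho>
    unfolding \<Gamma>_def using that by blast
  have inf': "inj_on e (carrier (op_ring R))"
    using inf(2) by simp
  have "\<exists>c. (\<forall>i<m. c i \<in> carrier J) \<and> (\<forall>(v, x)\<in>\<Gamma>. x = lincomb J m v c)"
  proof (rule injective_extend_relation[OF inf(1) inf' J(1)])
    show "\<Gamma> \<subseteq> carrier ?Q \<times> carrier J"
      using mod_hom_closed[OF \<chi>] dual_closed[OF _ k] dual_closed[OF _ a]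
      by (auto simp: \<Gamma>_def power_module_simps split: if_splits)
    show "(\<zero>\<^bsub>?Q\<^esub>, \<zero>\<^bsub>J\<^esub>) \<in> \<Gamma>"
    proof -
      have "(\<lambda>i\<in>{..<m}. \<zero>\<^bsub>dual R K\<^esub> (k i) \<oplus>\<^bsub>R\<^esub> \<zero>\<^bsub>dual R P\<^esub> (a i)) = \<zero>\<^bsub>?Q\<^esub>"
        using a k by (auto simp: power_module_simps(2) dual_simps(2))
      then show ?thesis
        using \<Gamma>I[OF DK.M.zero_closed DP.M.zero_closed] mod_hom_zero[OF \<chi> DK Jm] by simp
    qed
  next
    fix v x v' x' assume "(v, x) \<in> \<Gamma>" "(v', x') \<in> \<Gamma>"
    then obtain \<phi> \<rho> \<phi>' \<rho>' where *: "\<phi> \<in> carrier (dual R K)" "\<rho> \<in> carrier (dual R P)"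
      "\<phi>' \<in> carrier (dual R K)" "\<rho>' \<in> carrier (dual R P)" "x = \<chi> \<phi>" "x' = \<chi> \<phi>'"
      "v = (\<lambda>i\<in>{..<m}. \<phi> (k i) \<oplus>\<^bsub>R\<^esub> \<rho> (a i))" "v' = (\<lambda>i\<in>{..<m}. \<phi>' (k i) \<oplus>\<^bsub>R\<^esub> \<rho>' (a i))"
      unfolding \<Gamma>_def by blast
    have "(\<lambda>i\<in>{..<m}. (\<phi> \<oplus>\<^bsub>dual R K\<^esub> \<phi>') (k i) \<oplus>\<^bsub>R\<^esub> (\<rho> \<oplus>\<^bsub>dual R P\<^esub> \<rho>') (a i)) = v \<oplus>\<^bsub>?Q\<^esub> v'"
      using a k dual_closed[OF *(1) k] dual_closed[OF *(2) a] dual_closed[OF *(3) k] dual_closed[OF *(4) a]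
      by (auto simp: power_module_simps(3) dual_simps(3) *(7,8) K.R.a_ac)
    then show "(v \<oplus>\<^bsub>?Q\<^esub> v', x \<oplus>\<^bsub>J\<^esub> x') \<in> \<Gamma>"
      using \<Gamma>I[OF DK.M.a_closed[OF *(1,3)] DP.M.a_closed[OF *(2,4)]] mod_hom_add[OF \<chi> *(1,3)] *(5,6)
      by simp
  next
    fix b v x assume b: "b \<in> carrier (op_ring R)" and "(v, x) \<in> \<Gamma>"
    then obtain \<phi> \<rho> where *: "\<phi> \<in> carrier (dual R K)" "\<rho> \<in> carrier (dual R P)"
      "x = \<chi> \<phi>" "v = (\<lambda>i\<in>{..<m}. \<phi> (k i) \<oplus>\<^bsub>R\<^esub> \<rho> (a i))"
      unfolding \<Gamma>_def by blast
    have "(\<lambda>i\<in>{..<m}. (b \<odot>\<^bsub>dual R K\<^esub> \<phi>) (k i) \<oplus>\<^bsub>R\<^esub> (b \<odot>\<^bsub>dual R P\<^esub> \<rho>) (a i)) = b \<odot>\<^bsub>?Q\<^esub> v"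
      using a k b dual_closed[OF *(1) k] dual_closed[OF *(2) a]
      by (auto simp: power_module_simps(4) dual_simps(4) *(4) K.R.l_distr)
    then show "(b \<odot>\<^bsub>?Q\<^esub> v, b \<odot>\<^bsub>J\<^esub> x) \<in> \<Gamma>"
      using \<Gamma>I[OF DK.smult_closed[OF b *(1)] DP.smult_closed[OF b *(2)]] mod_hom_smult[OF \<chi> b *(1)] *(3)
      by simp
  next
    fix x assume "(\<zero>\<^bsub>?Q\<^esub>, x) \<in> \<Gamma>"
    then obtain \<phi> \<rho> where *: "\<phi> \<in> carrier (dual R K)" "\<rho> \<in> carrier (dual R P)"
      "x = \<chi> \<phi>" "\<zero>\<^bsub>?Q\<^esub> = (\<lambda>i\<in>{..<m}. \<phi> (k i) \<oplus>\<^bsub>R\<^esub> \<rho> (a i))"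
      unfolding \<Gamma>_def by blast
    \<comment> \<open>If the first entry of a pair is zero, then \<open>\<sigma>\<close> at
      \<open>a i\<close> equals \<phi> at \<open>k i\<close>. So \<open>\<sigma>\<close> kills the
      kernel of \<open>\<pi>\<close>, descends to a functional on \<open>W\<close> and restricts to
      \<phi>; hence \<chi> vanishes at \<phi> by hypothesis.\<close>
    define \<sigma> where "\<sigma> = \<ominus>\<^bsub>dual R P\<^esub> \<rho>"
    have \<sigma>: "\<sigma> \<in> carrier (dual R P)"
      using *(2) by (simp add: \<sigma>_def)
    have \<sigma>a: "\<sigma> (a i) = \<phi> (k i)" if i: "i < m" for i
    proof -
      have "\<phi> (k i) \<oplus>\<^bsub>R\<^esub> \<rho> (a i) = \<zero>\<^bsub>R\<^esub>"
        using fun_cong[OF *(4), of i] i by (simp add: power_module_simps(2))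
      then show ?thesis
        using dual_minus[OF P *(2) a[OF i]] dual_closed[OF *(1) k[OF i]] dual_closed[OF *(2) a[OF i]]
        by (simp add: \<sigma>_def K.R.minus_equality)
    qed
    have \<sigma>\<phi>: "\<exists>y. y \<in> carrier K \<and> \<iota> y = \<pi> s \<and> \<sigma> s = \<phi> y"
      if s: "s \<in> carrier P" "\<forall>j<q. f j (\<pi> s) = \<zero>\<^bsub>R\<^esub>" for s
    proof -
      obtain t where t: "\<forall>i<m. t i \<in> carrier R" "s = lincomb P m t a"
        using rel[OF s] by blast
      have "\<sigma> s = lincomb (regular_module R) m t (\<lambda>i. \<sigma> (a i))"
        unfolding t(2) using t(1) a by (intro dual_lincomb[OF P \<sigma>]) auto
      also have "\<dots> = lincomb (regular_module R) m t (\<lambda>i. \<phi> (k i))"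
        by (rule lincomb_cong) (use \<sigma>a in auto)
      also have "\<dots> = \<phi> (lincomb K m t k)"
        using t(1) k by (intro dual_lincomb[OF K *(1), symmetric]) auto
      finally show ?thesis
        using \<iota>k[OF t(1)] t k by (intro exI[of _ "lincomb K m t k"]) auto
    qed
    have "\<exists>\<psi>\<in>mod_hom R W (regular_module R). \<forall>s\<in>carrier P. \<psi> (\<pi> s) = \<sigma> s"
    proof (rule hom_factor_surj[OF P W RR \<pi> \<pi>_surj])
      show "\<sigma> \<in> mod_hom R P (regular_module R)"
        using \<sigma> by (simp add: dual_simps(1))
      fix s assume s: "s \<in> carrier P" "\<pi> s = \<zero>\<^bsub>W\<^esub>"
      have "f j \<zero>\<^bsub>W\<^esub> = \<zero>\<^bsub>R\<^esub>" if "j < q" for j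
        using mod_hom_zero[OF _ W RR, of "f j"] f[OF that] by (simp add: dual_simps(1))
      then obtain y where y: "y \<in> carrier K" "\<iota> y = \<zero>\<^bsub>W\<^esub>" "\<sigma> s = \<phi> y"
        using \<sigma>\<phi>[OF s(1)] s(2) by auto
      then have "y = \<zero>\<^bsub>K\<^esub>"
        by (intro mod_hom_kernel_trivial[OF \<iota>(1) K W \<iota>(2)])
      then show "\<sigma> s = \<zero>\<^bsub>regular_module R\<^esub>"
        using y(3) mod_hom_zero[OF _ K RR, of \<phi>] *(1) by (simp add: dual_simps(1))
    qed
    then obtain \<psi> where \<psi>: "\<psi> \<in> carrier (dual R W)" "\<And>s. s \<in> carrier P \<Longrightarrow> \<psi> (\<pi> s) = \<sigma> s"
      by (auto simp: dual_simps(1))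
    have "dual_map R K W \<iota> \<psi> = \<phi>"
    proof (rule dual_eqI[OF dual_map_closed[OF \<iota>(1) K \<psi>(1)] *(1)])
      fix y assume y: "y \<in> carrier K"
      then have "\<iota> y \<in> {x \<in> carrier W. \<forall>j<q. f j x = \<zero>\<^bsub>R\<^esub>}"
        unfolding ker[symmetric] by simp
      then have \<iota>y: "\<iota> y \<in> carrier W" "\<And>j. j < q \<Longrightarrow> f j (\<iota> y) = \<zero>\<^bsub>R\<^esub>"
        by auto
      then obtain s where s: "s \<in> carrier P" "\<pi> s = \<iota> y"
        unfolding \<pi>_surj[symmetric] by auto
      then obtain y' where y': "y' \<in> carrier K" "\<iota> y' = \<pi> s" "\<sigma> s = \<phi> y'"
        using \<sigma>\<phi>[OF s(1)] \<iota>y(2) by auto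
      then have "y' = y"
        using s(2) inj_onD[OF \<iota>(2) _ y'(1) y] by simp
      then show "dual_map R K W \<iota> \<psi> y = \<phi> y"
        using \<psi>(2)[OF s(1)] y'(3) s(2) dual_map_apply[OF \<psi>(1) y] by simp
    qed
    then show "x = \<zero>\<^bsub>J\<^esub>"
      using zero[OF \<psi>(1)] *(3) by simp
  qed
  then obtain c where c: "\<And>i. i < m \<Longrightarrow> c i \<in> carrier J"
      and \<Gamma>c: "\<And>v x. (v, x) \<in> \<Gamma> \<Longrightarrow> x = lincomb J m v c"
    by blast
  have \<chi>c: "\<chi> \<phi> = lincomb J m (\<lambda>i. \<phi> (k i) \<oplus>\<^bsub>R\<^esub> \<rho> (a i)) c"
    if "\<phi> \<in> carrier (dual R K)" "\<rho> \<in> carrier (dual R P)" for \<phi> \<rho>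
    unfolding \<Gamma>c[OF \<Gamma>I[OF that]] by (rule lincomb_cong) auto
  have aR: "a i l \<in> carrier R" if "i < m" "l < n" for i l
    using a[OF that(1)] that(2) by (auto simp: power_module_simps)
  have "lincomb J m (\<lambda>i. a i l) c = \<zero>\<^bsub>J\<^esub>" if l: "l < n" for l
  proof -
    \<comment> \<open>With zero in place of \<phi> and the coordinate \<open>l\<close> in place of
      \<rho>, the formula for \<chi> reads off column \<open>l\<close> of the relation
      matrix.\<close>
    let ?p = "\<lambda>v\<in>carrier P. v l"
    have "lincomb J m (\<lambda>i. a i l) c = lincomb J m (\<lambda>i. \<zero>\<^bsub>dual R K\<^esub> (k i) \<oplus>\<^bsub>R\<^esub> ?p (a i)) c"
      by (rule lincomb_cong) (use a k aR l in \<open>auto simp: dual_simps(2)\<close>)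
    also have "\<dots> = \<chi> \<zero>\<^bsub>dual R K\<^esub>"
      by (rule \<chi>c[OF DK.M.zero_closed projection_dual[OF K.R.ring_axioms l], symmetric])
    finally show ?thesis
      using mod_hom_zero[OF \<chi> DK Jm] by simp
  qed
  then have "relation_span J m {t. (\<forall>i<m. t i \<in> carrier (op_ring R)) \<and>
      (\<forall>l<n. lincomb (regular_module (op_ring R)) m (\<lambda>i. a i l) t = \<zero>\<^bsub>op_ring R\<^esub>)} c"
  \<comment> \<open>The second matrix holds the values of the functionals at the generators of
    \<open>W\<close>; exactness is the generating property of the \<open>a i\<close>, read over the
    opposite ring.\<close>
  proof (rule flat_dim_exactness[OF inf(1) inf' J(2), where q = q and \<beta> = "\<lambda>l j. f j (w l)", rotated -1])
    show "a i l \<in> carrier (op_ring R)" if "i < m" "l < n" for i l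
      using aR that by simp
    show "f j (w l) \<in> carrier (op_ring R)" if "l < n" "j < q" for l j
      using dual_closed[OF f wW] that by simp
    show "c i \<in> carrier J" if "i < m" for i
      using c that .
    show "lincomb (regular_module (op_ring R)) n (\<lambda>l. f j (w l)) (a i) = \<zero>\<^bsub>op_ring R\<^esub>"
      if i: "i < m" and j: "j < q" for i j
    proof -
      have "\<pi> (a i) \<in> {x \<in> carrier W. \<forall>j<q. f j x = \<zero>\<^bsub>R\<^esub>}"
        unfolding ker[symmetric] ka[OF i, symmetric] using k[OF i] by simp
      then show ?thesis
        using f_\<pi>[OF a[OF i] j] j by (simp add: lincomb_regular_op)
    qed
    fix s assume sR: "\<And>l. l < n \<Longrightarrow> s l \<in> carrier (op_ring R)"
      and s0: "\<And>j. j < q \<Longrightarrow> lincomb (regular_module (op_ring R)) n (\<lambda>l. f j (w l)) s = \<zero>\<^bsub>op_ring R\<^esub>"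
    define s' where "s' = restrict s {..<n}"
    have s': "s' \<in> carrier P"
      using sR by (auto simp: s'_def power_module_simps)
    have "lincomb (regular_module R) n s' (\<lambda>l. f j (w l)) = lincomb (regular_module R) n s (\<lambda>l. f j (w l))" for j
      by (rule lincomb_cong) (auto simp: s'_def)
    then have "f j (\<pi> s') = \<zero>\<^bsub>R\<^esub>" if "j < q" for j
      using f_\<pi>[OF s' that] s0[OF that] by (simp add: lincomb_regular_op)
    then obtain t where t: "\<forall>i<m. t i \<in> carrier R" "s' = lincomb P m t a"
      using rel[OF s'] by blast
    have "s l = lincomb (regular_module R) m t (\<lambda>i. a i l)" if l: "l < n" for l
    proof -
      have "s l = s' l"
        using l by (simp add: s'_def)
      then show ?thesis
        unfolding t(2) using l by (simp add: lincomb_power_module)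
    qed
    then show "\<exists>t. (\<forall>i<m. t i \<in> carrier (op_ring R)) \<and>
        (\<forall>l<n. s l = lincomb (regular_module (op_ring R)) m (\<lambda>i. a i l) t)"
      using t(1) by (intro exI[of _ t]) (auto simp: lincomb_regular_op)
  qed
  then have "lincomb J m (\<lambda>i. \<phi> (k i)) c = \<zero>\<^bsub>J\<^esub>"
  proof induction
    case (zero v)
    have "lincomb J m (\<lambda>i. \<phi> (k i)) v = lincomb J m (\<lambda>i. \<phi> (k i)) (\<lambda>i. \<zero>\<^bsub>J\<^esub>)"
      by (rule lincomb_cong) (use zero in auto)
    then show ?case
      using dual_closed[OF \<phi> k] by simp
  next
    case (step v x t v')
    have t: "\<forall>i<m. t i \<in> carrier R" "\<And>l. l < n \<Longrightarrow> lincomb (regular_module R) m t (\<lambda>i. a i l) = \<zero>\<^bsub>R\<^esub>"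
      using step(3) by (auto simp: lincomb_regular_op)
    have vJ: "v i \<in> carrier J" if "i < m" for i
      by (rule J.relation_span_closed[OF step(1) _ that]) auto
    \<comment> \<open>A tuple that annihilates every column gives the zero combination of the
      \<open>a i\<close>, hence of the \<open>k i\<close> because \<open>\<iota>\<close> is
      injective. So it annihilates the values of \<phi>, and each summand of \<open>c\<close>
      contributes zero.\<close>
    have "lincomb P m t a = \<zero>\<^bsub>P\<^esub>"
    proof
      fix l
      have "lincomb P m t a \<in> carrier P"
        using t a by (intro P.lincomb_closed) auto
      then show "lincomb P m t a l = \<zero>\<^bsub>P\<^esub> l"
        by (cases "l < n")
          (auto simp: lincomb_power_module t(2) power_module_simps(2), auto simp: power_module_simps(1))
    qed
    then have "\<iota> (lincomb K m t k) = \<zero>\<^bsub>W\<^esub>"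
      using \<iota>k[OF t(1)] mod_hom_zero[OF \<pi> P W] by simp
    then have tk: "lincomb K m t k = \<zero>\<^bsub>K\<^esub>"
      using t k by (intro mod_hom_kernel_trivial[OF \<iota>(1) K W \<iota>(2)]) auto
    have "lincomb (regular_module R) m t (\<lambda>i. \<phi> (k i)) = \<phi> (lincomb K m t k)"
      using t k by (intro dual_lincomb[OF K \<phi>, symmetric]) auto
    also have "\<dots> = \<zero>\<^bsub>R\<^esub>"
      using tk mod_hom_zero[OF _ K RR, of \<phi>] \<phi> by (simp add: dual_simps(1))
    finally have 0: "lincomb (regular_module (op_ring R)) m (\<lambda>i. \<phi> (k i)) t = \<zero>\<^bsub>R\<^esub>"
      by (simp add: lincomb_regular_op)
    have "lincomb J m (\<lambda>i. \<phi> (k i)) v' = lincomb J m (\<lambda>i. \<phi> (k i)) (\<lambda>i. v i \<oplus>\<^bsub>J\<^esub> t i \<odot>\<^bsub>J\<^esub> x)"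
      by (rule lincomb_cong) (use step(4) in auto)
    also have "\<dots> = lincomb J m (\<lambda>i. \<phi> (k i)) v \<oplus>\<^bsub>J\<^esub> lincomb J m (\<lambda>i. \<phi> (k i)) (\<lambda>i. t i \<odot>\<^bsub>J\<^esub> x)"
      using dual_closed[OF \<phi> k] vJ t(1) step(2) J.smult_closed by (intro J.lincomb_add_right) auto
    also have "lincomb J m (\<lambda>i. \<phi> (k i)) (\<lambda>i. t i \<odot>\<^bsub>J\<^esub> x) =
        lincomb (regular_module (op_ring R)) m (\<lambda>i. \<phi> (k i)) t \<odot>\<^bsub>J\<^esub> x"
      using dual_closed[OF \<phi> k] t(1) step(2) by (intro J.lincomb_smult_right) auto
    also have "\<dots> = \<zero>\<^bsub>J\<^esub>"
      unfolding 0 using J.smult_zero_left[OF step(2)] by simp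
    finally show ?case
      using step(5) by simp
  qed
  moreover have "lincomb J m (\<lambda>i. \<phi> (k i)) c = lincomb J m (\<lambda>i. \<phi> (k i) \<oplus>\<^bsub>R\<^esub> \<zero>\<^bsub>dual R P\<^esub> (a i)) c"
    by (rule lincomb_cong) (use a dual_closed[OF \<phi> k] in \<open>auto simp: dual_simps(2)\<close>)
  ultimately show ?thesis
    using \<chi>c[OF \<phi> DP.M.zero_closed] by simp
qed

end


section \<open>Reflexivity of kernels and extensions\<close>

text \<open>Besides the exact start of the resolution, \<open>e\<close> supplies the injection of
  the ring into \<open>'u\<close> along which free modules are copied.\<close>

lemma flat_dim_conditionE:
  assumes "flat_dim_condition TYPE('u) S 2 2"
  obtains J\<^sub>0 J\<^sub>1 :: "('a, 'u) module" and e d where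
    "injective_module S J\<^sub>0" "flat_dim_less S J\<^sub>0 2" "injective_module S J\<^sub>1" "flat_dim_less S J\<^sub>1 2"
    "e \<in> mod_hom S (regular_module S) J\<^sub>0" "inj_on e (carrier S)"
    "d \<in> mod_hom S J\<^sub>0 J\<^sub>1" "e ` carrier S = a_kernel J\<^sub>0 J\<^sub>1 d"
proof -
  obtain I :: "nat \<Rightarrow> ('a, 'u) module" and e d where
    res: "minimal_injective_resolution S (regular_module S) I e d"
    and fd: "\<forall>i<2. flat_dim_less S (I i) 2"
    using assms unfolding flat_dim_condition_def by blast
  show thesis
  proof (rule that[of "I 0" "I 1" e "d 0"])
    show "flat_dim_less S (I 0) 2" "flat_dim_less S (I 1) 2"
      using fd by auto
    show "injective_module S (I 0)" "injective_module S (I 1)"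
      "e \<in> mod_hom S (regular_module S) (I 0)"
      using res by (simp_all only: minimal_injective_resolution_def)
    show "inj_on e (carrier S)" "e ` carrier S = a_kernel (I 0) (I 1) (d 0)"
      using res by (simp_all add: minimal_injective_resolution_def)
    have "d 0 \<in> mod_hom S (I 0) (I (Suc 0))"
      using res unfolding minimal_injective_resolution_def by blast
    then show "d 0 \<in> mod_hom S (I 0) (I 1)"
      by simp
  qed
qed

lemma evaluation_eqI:
  assumes "left_module R M" "\<xi> \<in> carrier (double_dual R M)" "x \<in> carrier M"
    and "\<And>f. f \<in> carrier (dual R M) \<Longrightarrow> \<xi> f = f x"
  shows "\<xi> = evaluation R M x"
proof (rule dual_eqI[of _ "op_ring R" "dual R M"])
  show "\<xi> \<in> carrier (dual (op_ring R) (dual R M))"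
    using assms(2) by (simp add: double_dual_def)
  show "evaluation R M x \<in> carrier (dual (op_ring R) (dual R M))"
    using mod_hom_closed[OF evaluation_hom[OF assms(1)] assms(3)] by (simp add: double_dual_def)
qed (use assms in simp)

lemma double_dual_zero:
  assumes "left_module R M" "\<xi> \<in> carrier (double_dual R M)"
  shows "\<xi> \<zero>\<^bsub>dual R M\<^esub> = \<zero>\<^bsub>R\<^esub>"
proof -
  have "ring (op_ring R)"
    using left_module_ring[OF assms(1)] by simp
  then show ?thesis
    using mod_hom_zero[OF _ left_module_dual[OF assms(1)] left_module_regular, of \<xi>] assms(2)
    by (simp add: double_dual_def dual_simps(1)[of "op_ring R"])
qed

context functional_kernel
begin

abbreviation "res \<equiv> dual_map R K W \<iota>"

lemma res_hom: "res \<in> mod_hom (op_ring R) (dual R W) (dual R K)"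
  by (rule dual_map_hom[OF \<iota>(1) K W])

text \<open>The difference of the two elements, followed by \<open>e\<close>, is a map into
  \<open>J\<^sub>0\<close> that vanishes on restrictions. It vanishes altogether by
  \<open>functional_vanishes\<close>, and \<open>e\<close> is injective.\<close>

lemma double_dual_eqI:
  assumes inf: "infinite (UNIV :: 'u set)" and cond: "flat_dim_condition TYPE('u) (op_ring R) 2 2"
    and \<xi>: "\<xi> \<in> carrier (double_dual R K)" "\<xi>' \<in> carrier (double_dual R K)"
    and eq: "\<And>\<psi>. \<psi> \<in> carrier (dual R W) \<Longrightarrow> \<xi> (res \<psi>) = \<xi>' (res \<psi>)"
  shows "\<xi> = \<xi>'"
proof -
  obtain J\<^sub>0 J\<^sub>1 :: "('a, 'u) module" and e d where
    J\<^sub>0: "injective_module (op_ring R) J\<^sub>0" "flat_dim_less (op_ring R) J\<^sub>0 2"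
    and e: "e \<in> mod_hom (op_ring R) (regular_module (op_ring R)) J\<^sub>0" "inj_on e (carrier (op_ring R))"
    using flat_dim_conditionE[OF cond] by metis
  have J\<^sub>0m: "left_module (op_ring R) J\<^sub>0"
    using J\<^sub>0(1) by (simp add: injective_module_def)
  have DK: "left_module (op_ring R) (dual R K)"
    by (rule left_module_dual[OF K])
  interpret DD: left_module R "double_dual R K"
    by (rule left_module_double_dual[OF K])
  define \<zeta> where "\<zeta> = \<xi> \<ominus>\<^bsub>double_dual R K\<^esub> \<xi>'"
  have \<zeta>: "\<zeta> \<in> carrier (double_dual R K)"
    using \<xi> by (simp add: \<zeta>_def)
  have \<zeta>_apply: "\<zeta> \<phi> = \<xi> \<phi> \<ominus>\<^bsub>R\<^esub> \<xi>' \<phi>" if "\<phi> \<in> carrier (dual R K)" for \<phi>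
    using that \<xi> dual_minus[OF DK, of \<xi>' \<phi>]
    by (simp add: \<zeta>_def a_minus_def double_dual_def dual_simps(3))
  have c: "\<xi> \<phi> \<in> carrier R" "\<xi>' \<phi> \<in> carrier R" if "\<phi> \<in> carrier (dual R K)" for \<phi>
    using that \<xi> dual_closed[of _ "op_ring R" "dual R K" \<phi>] by (auto simp: double_dual_def)
  define \<chi> where "\<chi> = compose (carrier (dual R K)) e \<zeta>"
  have \<chi>: "\<chi> \<in> mod_hom (op_ring R) (dual R K) J\<^sub>0"
    unfolding \<chi>_def using \<zeta> by (intro mod_hom_compose[OF _ e(1) DK]) (simp add: double_dual_def dual_simps(1))
  have vanish: "\<chi> (res \<psi>) = \<zero>\<^bsub>J\<^sub>0\<^esub>" if "\<psi> \<in> carrier (dual R W)" for \<psi>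
  proof -
    have r: "res \<psi> \<in> carrier (dual R K)"
      using mod_hom_closed[OF res_hom that] .
    then have "\<zeta> (res \<psi>) = \<zero>\<^bsub>R\<^esub>"
      using eq[OF that] c(2)[OF r] by (simp add: \<zeta>_apply a_minus_def K.R.r_neg)
    then show ?thesis
      using r mod_hom_zero[OF e(1) RO J\<^sub>0m] by (simp add: \<chi>_def compose_def)
  qed
  show ?thesis
  proof (rule dual_eqI[of _ "op_ring R" "dual R K"])
    fix \<phi> assume \<phi>: "\<phi> \<in> carrier (dual R K)"
    have "\<chi> \<phi> = \<zero>\<^bsub>J\<^sub>0\<^esub>"
      by (rule functional_vanishes[OF inf _ J\<^sub>0 \<chi> vanish \<phi>]) (use e(2) in auto)
    then have "\<zeta> \<phi> = \<zero>\<^bsub>R\<^esub>"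
      using mod_hom_kernel_trivial[OF e(1) RO J\<^sub>0m, of "\<zeta> \<phi>"] e(2) c[OF \<phi>] \<phi>
      by (simp add: \<chi>_def compose_def \<zeta>_apply)
    then show "\<xi> \<phi> = \<xi>' \<phi>"
      using \<zeta>_apply[OF \<phi>] c[OF \<phi>] K.R.minus_eq_zero_iff by simp
  qed (use \<xi> in \<open>auto simp: double_dual_def\<close>)
qed

text \<open>Injectivity of \<open>J\<^sub>0\<close> extends \<open>e\<close> after \<eta> from the
  restrictions to the whole dual of \<open>K\<close>. Followed by \<open>d\<close>, the extension
  kills restrictions and hence vanishes, by the flat dimension of \<open>J\<^sub>1\<close>. So its
  values lie in the image of \<open>e\<close> and can be read in the ring.\<close>

lemma double_dual_extend:
  assumes inf: "infinite (UNIV :: 'u set)" and cond: "flat_dim_condition TYPE('u) (op_ring R) 2 2"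
    and \<eta>: "\<eta> \<in> carrier (double_dual R W)"
    and zero: "\<And>\<psi>. \<psi> \<in> carrier (dual R W) \<Longrightarrow> res \<psi> = \<zero>\<^bsub>dual R K\<^esub> \<Longrightarrow> \<eta> \<psi> = \<zero>\<^bsub>R\<^esub>"
  shows "\<exists>\<xi>\<in>carrier (double_dual R K). \<forall>\<psi>\<in>carrier (dual R W). \<xi> (res \<psi>) = \<eta> \<psi>"
proof -
  obtain J\<^sub>0 J\<^sub>1 :: "('a, 'u) module" and e d where
    J\<^sub>0: "injective_module (op_ring R) J\<^sub>0" 
    and J\<^sub>1: "injective_module (op_ring R) J\<^sub>1" "flat_dim_less (op_ring R) J\<^sub>1 2"
    and e: "e \<in> mod_hom (op_ring R) (regular_module (op_ring R)) J\<^sub>0" "inj_on e (carrier (op_ring R))"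
    and d: "d \<in> mod_hom (op_ring R) J\<^sub>0 J\<^sub>1" and ed: "e ` carrier (op_ring R) = a_kernel J\<^sub>0 J\<^sub>1 d"
    using flat_dim_conditionE[OF cond] by metis
  have J\<^sub>0m: "left_module (op_ring R) J\<^sub>0" and J\<^sub>1m: "left_module (op_ring R) J\<^sub>1"
    using J\<^sub>0(1) J\<^sub>1(1) by (simp_all add: injective_module_def)
  have DK: "left_module (op_ring R) (dual R K)" and DW: "left_module (op_ring R) (dual R W)"
    by (intro left_module_dual K W)+
  interpret DK: left_module "op_ring R" "dual R K" by fact
  interpret DW: left_module "op_ring R" "dual R W" by fact
  obtain m k where k: "generates R K m k"
    using generates_of_inj[OF noeth K W gen \<iota>] by blast
  note kK = generates_closed[OF k]
  \<comment> \<open>Coordinates put the dual of \<open>K\<close> into a free module, from which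
    \<open>injective_extend_relation\<close> extends maps into \<open>J\<^sub>0\<close>.\<close>
  let ?c = "coordinates R K m k" and ?Q = "free_module (op_ring R) m"
  have Q: "left_module (op_ring R) ?Q"
    by (intro left_module_power_module RO)
  interpret Q: left_module "op_ring R" ?Q by fact
  have c_hom: "?c \<in> mod_hom (op_ring R) (dual R K) ?Q"
    by (rule coordinates_hom[OF K kK])
  note c_inj = coordinates_inj[OF K k]
  have \<eta>h: "\<eta> \<in> mod_hom (op_ring R) (dual R W) (regular_module (op_ring R))"
    using \<eta> by (simp add: double_dual_def dual_simps(1))
  note ch = mod_hom_compose[OF res_hom c_hom DW] and eh = mod_hom_compose[OF \<eta>h e(1) DW]
  define \<Gamma> where "\<Gamma> = (\<lambda>\<psi>. (?c (res \<psi>), e (\<eta> \<psi>))) ` carrier (dual R W)"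
  have ch': "?c (res \<psi>) = compose (carrier (dual R W)) ?c res \<psi>"
    and eh': "e (\<eta> \<psi>) = compose (carrier (dual R W)) e \<eta> \<psi>" if "\<psi> \<in> carrier (dual R W)" for \<psi>
    using that by (simp_all add: compose_def)
  have "\<exists>c. (\<forall>i<m. c i \<in> carrier J\<^sub>0) \<and> (\<forall>(v, x)\<in>\<Gamma>. x = lincomb J\<^sub>0 m v c)"
  proof (rule injective_extend_relation[OF inf e(2) J\<^sub>0])
    show "\<Gamma> \<subseteq> carrier ?Q \<times> carrier J\<^sub>0"
      using mod_hom_closed[OF ch] mod_hom_closed[OF eh] by (auto simp: \<Gamma>_def ch' eh')
    show "(\<zero>\<^bsub>?Q\<^esub>, \<zero>\<^bsub>J\<^sub>0\<^esub>) \<in> \<Gamma>"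
      unfolding \<Gamma>_def using mod_hom_zero[OF ch DW Q] mod_hom_zero[OF eh DW J\<^sub>0m] DW.M.zero_closed
      by (intro image_eqI[of _ _ "\<zero>\<^bsub>dual R W\<^esub>"]) (simp_all add: ch' eh')
  next
    fix v x v' x' assume "(v, x) \<in> \<Gamma>" "(v', x') \<in> \<Gamma>"
    then obtain \<psi> \<psi>' where *: "\<psi> \<in> carrier (dual R W)" "\<psi>' \<in> carrier (dual R W)"
      "v = ?c (res \<psi>)" "x = e (\<eta> \<psi>)" "v' = ?c (res \<psi>')" "x' = e (\<eta> \<psi>')"
      by (auto simp: \<Gamma>_def)
    then show "(v \<oplus>\<^bsub>?Q\<^esub> v', x \<oplus>\<^bsub>J\<^sub>0\<^esub> x') \<in> \<Gamma>"
      unfolding \<Gamma>_def using mod_hom_add[OF ch *(1,2)] mod_hom_add[OF eh *(1,2)] DW.M.a_closed[OF *(1,2)]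
      by (intro image_eqI[of _ _ "\<psi> \<oplus>\<^bsub>dual R W\<^esub> \<psi>'"]) (simp_all add: ch' eh')
  next
    fix b v x assume b: "b \<in> carrier (op_ring R)" and "(v, x) \<in> \<Gamma>"
    then obtain \<psi> where *: "\<psi> \<in> carrier (dual R W)" "v = ?c (res \<psi>)" "x = e (\<eta> \<psi>)"
      by (auto simp: \<Gamma>_def)
    then show "(b \<odot>\<^bsub>?Q\<^esub> v, b \<odot>\<^bsub>J\<^sub>0\<^esub> x) \<in> \<Gamma>"
      unfolding \<Gamma>_def using mod_hom_smult[OF ch b *(1)] mod_hom_smult[OF eh b *(1)] DW.smult_closed[OF b *(1)]
      by (intro image_eqI[of _ _ "b \<odot>\<^bsub>dual R W\<^esub> \<psi>"]) (simp_all add: ch' eh')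
  next
    fix x assume "(\<zero>\<^bsub>?Q\<^esub>, x) \<in> \<Gamma>"
    then obtain \<psi> where *: "\<psi> \<in> carrier (dual R W)" "?c (res \<psi>) = \<zero>\<^bsub>?Q\<^esub>" "x = e (\<eta> \<psi>)"
      by (auto simp: \<Gamma>_def)
    \<comment> \<open>Coordinates are injective, so \<psi> restricts to zero and the hypothesis on
      \<eta> makes the relation single-valued.\<close>
    then have "res \<psi> = \<zero>\<^bsub>dual R K\<^esub>"
      by (intro mod_hom_kernel_trivial[OF c_hom DK Q c_inj] mod_hom_closed[OF res_hom])
    then show "x = \<zero>\<^bsub>J\<^sub>0\<^esub>"
      using zero[OF *(1)] *(3) mod_hom_zero[OF e(1) RO J\<^sub>0m] by simp
  qed
  then obtain c where c: "\<And>i. i < m \<Longrightarrow> c i \<in> carrier J\<^sub>0"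
      and \<Gamma>c: "\<And>v x. (v, x) \<in> \<Gamma> \<Longrightarrow> x = lincomb J\<^sub>0 m v c"
    by blast
  define g where "g = compose (carrier (dual R K)) (free_map (op_ring R) J\<^sub>0 m c) ?c"
  have g: "g \<in> mod_hom (op_ring R) (dual R K) J\<^sub>0"
    unfolding g_def by (rule mod_hom_compose[OF c_hom free_map_hom[OF J\<^sub>0m c] DK])
  have g_res: "g (res \<psi>) = e (\<eta> \<psi>)" if \<psi>: "\<psi> \<in> carrier (dual R W)" for \<psi>
    using mod_hom_closed[OF res_hom \<psi>] mod_hom_closed[OF c_hom] \<Gamma>c[of "?c (res \<psi>)" "e (\<eta> \<psi>)"] \<psi>
    by (simp add: g_def compose_def free_map_def \<Gamma>_def)
  have \<eta>R: "\<eta> \<psi> \<in> carrier R" if "\<psi> \<in> carrier (dual R W)" for \<psi>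
    using mod_hom_closed[OF \<eta>h that] by simp
  have "d (g \<phi>) = \<zero>\<^bsub>J\<^sub>1\<^esub>" if \<phi>: "\<phi> \<in> carrier (dual R K)" for \<phi>
  proof -
    have "compose (carrier (dual R K)) d g \<phi> = \<zero>\<^bsub>J\<^sub>1\<^esub>"
    proof (rule functional_vanishes[OF inf _ J\<^sub>1 mod_hom_compose[OF g d DK] _ \<phi>])
      show "inj_on e (carrier R)" using e(2) by simp
      fix \<psi> assume \<psi>: "\<psi> \<in> carrier (dual R W)"
      have "e (\<eta> \<psi>) \<in> a_kernel J\<^sub>0 J\<^sub>1 d"
        unfolding ed[symmetric] using \<eta>R[OF \<psi>] by simp
      then show "compose (carrier (dual R K)) d g (res \<psi>) = \<zero>\<^bsub>J\<^sub>1\<^esub>"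
        using g_res[OF \<psi>] mod_hom_closed[OF res_hom \<psi>] by (simp add: compose_def a_kernel_iff)
    qed
    then show ?thesis
      using \<phi> by (simp add: compose_def)
  qed
  then have g_im: "g \<phi> \<in> e ` carrier R" if "\<phi> \<in> carrier (dual R K)" for \<phi>
    using that mod_hom_closed[OF g that] ed by (simp add: a_kernel_iff)
  let ?i = "inv_into (carrier R) e"
  have i: "?i (g \<phi>) \<in> carrier R" "e (?i (g \<phi>)) = g \<phi>" if "\<phi> \<in> carrier (dual R K)" for \<phi>
    using g_im[OF that] by (auto simp: inv_into_into f_inv_into_f)
  have e_eq: "x = y" if "e x = e y" "x \<in> carrier R" "y \<in> carrier R" for x y
    using inj_onD[OF e(2) that(1)] that(2,3) by simp
  have "(\<lambda>\<phi>\<in>carrier (dual R K). ?i (g \<phi>)) \<in> carrier (dual (op_ring R) (dual R K))"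
  proof (rule dual_restrictI[OF DK])
    show "?i (g \<phi>) \<in> carrier (op_ring R)" if "\<phi> \<in> carrier (dual R K)" for \<phi>
      using i(1)[OF that] by simp
    show "?i (g (\<phi> \<oplus>\<^bsub>dual R K\<^esub> \<phi>')) = ?i (g \<phi>) \<oplus>\<^bsub>op_ring R\<^esub> ?i (g \<phi>')"
      if "\<phi> \<in> carrier (dual R K)" "\<phi>' \<in> carrier (dual R K)" for \<phi> \<phi>'
      using i[OF that(1)] i[OF that(2)] i[OF DK.M.a_closed[OF that]] mod_hom_add[OF g that]
        mod_hom_add[OF e(1), of "?i (g \<phi>)" "?i (g \<phi>')"]
      by (intro e_eq) auto
    show "?i (g (a \<odot>\<^bsub>dual R K\<^esub> \<phi>)) = a \<otimes>\<^bsub>op_ring R\<^esub> ?i (g \<phi>)"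
      if "a \<in> carrier (op_ring R)" "\<phi> \<in> carrier (dual R K)" for a \<phi>
      using i[OF that(2)] i[OF DK.smult_closed[OF that]] mod_hom_smult[OF g that]
        mod_hom_smult[OF e(1), of a "?i (g \<phi>)"] that(1)
      by (intro e_eq) auto
  qed
  then show ?thesis
  proof (intro bexI ballI)
    fix \<psi> assume \<psi>: "\<psi> \<in> carrier (dual R W)"
    have "?i (g (res \<psi>)) = \<eta> \<psi>"
      using i[OF mod_hom_closed[OF res_hom \<psi>]] g_res[OF \<psi>] \<eta>R[OF \<psi>] by (intro e_eq) auto
    then show "(\<lambda>\<phi>\<in>carrier (dual R K). ?i (g \<phi>)) (res \<psi>) = \<eta> \<psi>"
      using mod_hom_closed[OF res_hom \<psi>] by simp
  qed (simp only: double_dual_def)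
qed

lemma res_functional: "j < q \<Longrightarrow> res (f j) = \<zero>\<^bsub>dual R K\<^esub>"
proof (rule dual_eqI[of _ R K])
  assume j: "j < q"
  show "res (f j) \<in> carrier (dual R K)"
    by (rule mod_hom_closed[OF res_hom f[OF j]])
  show "\<zero>\<^bsub>dual R K\<^esub> \<in> carrier (dual R K)"
    using left_module_dual[OF K] by (simp add: left_module_def abelian_group_def abelian_monoid.zero_closed)
  fix x assume x: "x \<in> carrier K"
  then have "\<iota> x \<in> {x \<in> carrier W. \<forall>j<q. f j x = \<zero>\<^bsub>R\<^esub>}"
    unfolding ker[symmetric] by simp
  then show "res (f j) x = \<zero>\<^bsub>dual R K\<^esub> x"
    using f[OF j] x j by (simp add: dual_map_apply dual_simps(2))
qed

text \<open>An element \<open>\<xi>\<close> of the double dual of \<open>K\<close> induces one for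
  \<open>W\<close>, so on restrictions it is evaluation at some \<open>x\<close> in
  \<open>W\<close>. Every \<open>f j\<close> restricts to zero, which puts \<open>x\<close> into the
  image of \<open>K\<close>. Agreement on restrictions then gives agreement on all
  functionals.\<close>

theorem kernel_reflexive:
  assumes inf: "infinite (UNIV :: 'u set)" and cond: "flat_dim_condition TYPE('u) (op_ring R) 2 2"
    and bij: "bij_betw (evaluation R W) (carrier W) (carrier (double_dual R W))"
  shows "K \<in> reflexive_modules R"
proof -
  have DW: "left_module (op_ring R) (dual R W)"
    by (rule left_module_dual[OF W])
  have "inj_on (evaluation R K) (carrier K)"
  proof (rule inj_onI)
    fix x y assume xy: "x \<in> carrier K" "y \<in> carrier K" "evaluation R K x = evaluation R K y"
    have \<iota>xy: "\<iota> x \<in> carrier W" "\<iota> y \<in> carrier W"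
      using xy mod_hom_closed[OF \<iota>(1)] by auto
    have "\<psi> (\<iota> x) = \<psi> (\<iota> y)" if \<psi>: "\<psi> \<in> carrier (dual R W)" for \<psi>
      using fun_cong[OF xy(3), of "res \<psi>"] xy(1,2) mod_hom_closed[OF res_hom \<psi>] \<psi>
      by (simp add: dual_map_apply)
    then have "evaluation R W (\<iota> x) = evaluation R W (\<iota> y)"
      using \<iota>xy by (simp add: evaluation_def fun_eq_iff)
    then have "\<iota> x = \<iota> y"
      using bij \<iota>xy by (meson bij_betw_imp_inj_on inj_onD)
    then show "x = y"
      using \<iota>(2) xy(1,2) by (meson inj_onD)
  qed
  moreover have "evaluation R K ` carrier K = carrier (double_dual R K)"
  proof
    show "evaluation R K ` carrier K \<subseteq> carrier (double_dual R K)"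
      using mod_hom_closed[OF evaluation_hom[OF K]] by auto
    show "carrier (double_dual R K) \<subseteq> evaluation R K ` carrier K"
    proof
      fix \<xi> assume \<xi>: "\<xi> \<in> carrier (double_dual R K)"
      have "compose (carrier (dual R W)) \<xi> res \<in> mod_hom (op_ring R) (dual R W) (regular_module (op_ring R))"
        using \<xi> by (intro mod_hom_compose[OF res_hom _ DW]) (simp add: double_dual_def dual_simps(1))
      then have "compose (carrier (dual R W)) \<xi> res \<in> carrier (double_dual R W)"
        by (simp add: double_dual_def dual_simps(1))
      then obtain x where x: "x \<in> carrier W" "evaluation R W x = compose (carrier (dual R W)) \<xi> res"
        using bij by (metis bij_betw_imp_surj_on imageE)
      have x_eval: "\<psi> x = \<xi> (res \<psi>)" if "\<psi> \<in> carrier (dual R W)" for \<psi>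
        using fun_cong[OF x(2), of \<psi>] x(1) that by (simp add: compose_def)
      have "f j x = \<zero>\<^bsub>R\<^esub>" if "j < q" for j
        using x_eval[OF f[OF that]] double_dual_zero[OF K \<xi>] by (simp add: res_functional[OF that])
      then have "x \<in> \<iota> ` carrier K"
        unfolding ker using x(1) by simp
      then obtain y where y: "y \<in> carrier K" "x = \<iota> y"
        by blast
      have "\<xi> = evaluation R K y"
      proof (rule double_dual_eqI[OF inf cond \<xi>])
        show "evaluation R K y \<in> carrier (double_dual R K)"
          by (rule mod_hom_closed[OF evaluation_hom[OF K] y(1)])
        show "\<xi> (res \<psi>) = evaluation R K y (res \<psi>)" if "\<psi> \<in> carrier (dual R W)" for \<psi>
          using x_eval[OF that] y mod_hom_closed[OF res_hom that] that by (simp add: dual_map_apply)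
      qed
      then show "\<xi> \<in> evaluation R K ` carrier K"
        using y(1) by blast
    qed
  qed
  ultimately show ?thesis
    using generates_of_inj[OF noeth K W gen \<iota>] K
    by (simp add: reflexive_modules_def fg_modules_def bij_betw_def K.fin_gen_iff)
qed

end

section \<open>Kernels of maps into torsionless modules\<close>

lemma lincomb_dual:
  "x \<in> carrier M \<Longrightarrow> lincomb (dual R M) n r g x = lincomb (regular_module R) n (\<lambda>j. g j x) r"
  by (induction n) (auto simp: dual_simps)

text \<open>All functionals on \<open>Y\<close> are combinations of the \<open>g j\<close> and hence
  vanish at \<open>y\<close>. Kernels of maps into \<open>Y\<close> thereby become zero sets of
  finitely many functionals.\<close>

lemma torsionless_zero:
  assumes Y: "left_module R Y" "inj_on (evaluation R Y) (carrier Y)"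
    and g: "generates (op_ring R) (dual R Y) q g"
    and y: "y \<in> carrier Y" "\<And>j. j < q \<Longrightarrow> g j y = \<zero>\<^bsub>R\<^esub>"
  shows "y = \<zero>\<^bsub>Y\<^esub>"
proof -
  interpret Y: left_module R Y by fact
  have RO: "left_module (op_ring R) (regular_module (op_ring R))"
    by (intro left_module_regular) (simp add: Y.R.ring_axioms)
  have "h y = h \<zero>\<^bsub>Y\<^esub>" if h: "h \<in> carrier (dual R Y)" for h
  proof -
    obtain r where r: "\<And>j. j < q \<Longrightarrow> r j \<in> carrier (op_ring R)" "h = lincomb (dual R Y) q r g"
      using generatesE[OF g h] by blast
    have "h y = lincomb (regular_module (op_ring R)) q r (\<lambda>j. g j y)"
      using r(2) y(1) by (simp add: lincomb_dual lincomb_regular_op)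
    also have "\<dots> = lincomb (regular_module (op_ring R)) q r (\<lambda>j. \<zero>\<^bsub>regular_module (op_ring R)\<^esub>)"
      by (rule lincomb_cong) (use y(2) in auto)
    also have "\<dots> = \<zero>\<^bsub>R\<^esub>"
      using left_module.lincomb_zero_right[OF RO r(1)] by simp
    finally show ?thesis
      using mod_hom_zero[OF _ Y(1) left_module_regular[OF Y.R.ring_axioms], of h] h
      by (simp add: dual_simps(1))
  qed
  then have "evaluation R Y y = evaluation R Y \<zero>\<^bsub>Y\<^esub>"
    using y(1) by (simp add: evaluation_def fun_eq_iff)
  then show ?thesis
    using Y(2) y(1) Y.M.zero_closed by (meson inj_onD)
qed

text \<open>The functionals are generators of the dual of \<open>Y\<close> pulled back along
  \<open>h\<close>; since \<open>Y\<close> is torsionless, their common zeros are exactly the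
  kernel.\<close>

lemma functional_kernel_of_hom:
  assumes R: "left_noetherian R" "left_noetherian (op_ring R)"
    and K: "left_module R K" and X: "X \<in> fg_modules R"
    and Y: "Y \<in> fg_modules R" "inj_on (evaluation R Y) (carrier Y)"
    and h: "h \<in> mod_hom R X Y"
    and \<iota>: "\<iota> \<in> mod_hom R K X" "inj_on \<iota> (carrier K)" "\<iota> ` carrier K = a_kernel X Y h"
  obtains q g n w where "functional_kernel R K X \<iota> q (\<lambda>j. dual_map R X Y h (g j)) n w"
    "generates (op_ring R) (dual R Y) q g"
proof -
  have Xm: "left_module R X" and Ym: "left_module R Y"
    using X Y(1) by (simp_all add: fg_modules_def)
  obtain n w where w: "generates R X n w"
    using X left_module.fin_gen_iff[OF Xm] by (auto simp: fg_modules_def)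
  obtain n' w' where w': "generates R Y n' w'"
    using Y left_module.fin_gen_iff[OF Ym] by (auto simp: fg_modules_def)
  obtain q g where g: "generates (op_ring R) (dual R Y) q g"
    using generates_dual[OF R(2) Ym w'] by blast
  note gY = generates_closed[OF g]
  have zero: "\<psi> \<zero>\<^bsub>Y\<^esub> = \<zero>\<^bsub>R\<^esub>" if "\<psi> \<in> carrier (dual R Y)" for \<psi>
    using that mod_hom_zero[OF _ Ym left_module_regular[OF left_module_ring[OF Xm]], of \<psi>]
    by (simp add: dual_simps(1))
  have "functional_kernel R K X \<iota> q (\<lambda>j. dual_map R X Y h (g j)) n w"
  proof (rule functional_kernel.intro)
    show "dual_map R X Y h (g j) \<in> carrier (dual R X)" if "j < q" for j
      using dual_map_closed[OF h Xm gY[OF that]] .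
    show "\<iota> ` carrier K = {x \<in> carrier X. \<forall>j<q. dual_map R X Y h (g j) x = \<zero>\<^bsub>R\<^esub>}"
      unfolding \<iota>(3)
    proof (intro equalityI subsetI)
      fix x assume "x \<in> a_kernel X Y h"
      then show "x \<in> {x \<in> carrier X. \<forall>j<q. dual_map R X Y h (g j) x = \<zero>\<^bsub>R\<^esub>}"
        using gY zero by (auto simp: a_kernel_iff dual_map_apply)
    next
      fix x assume "x \<in> {x \<in> carrier X. \<forall>j<q. dual_map R X Y h (g j) x = \<zero>\<^bsub>R\<^esub>}"
      then have x: "x \<in> carrier X" "\<And>j. j < q \<Longrightarrow> g j (h x) = \<zero>\<^bsub>R\<^esub>"
        using gY by (auto simp: dual_map_apply)
      then show "x \<in> a_kernel X Y h"
        using torsionless_zero[OF Ym Y(2) g mod_hom_closed[OF h x(1)]] by (simp add: a_kernel_iff)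
    qed
  qed (fact R(1) K Xm \<iota>(1,2) w)+
  then show thesis
    using g by (rule that)
qed


lemma fg_modulesE:
  assumes "M \<in> fg_modules R"
  obtains n w where "left_module R M" "generates R M n w"
proof -
  have M: "left_module R M"
    using assms by (simp add: fg_modules_def)
  then show thesis
    using assms that left_module.fin_gen_iff[OF M] by (auto simp: fg_modules_def)
qed

lemma fg_modulesI:
  assumes "left_module R M" "generates R M n w"
  shows "M \<in> fg_modules R"
  using assms left_module.fin_gen_iff[OF assms(1)] by (auto simp: fg_modules_def)

lemma reflexive_modulesD:
  assumes "M \<in> reflexive_modules R"
  shows "M \<in> fg_modules R" "left_module R M" "inj_on (evaluation R M) (carrier M)"
    "evaluation R M ` carrier M = carrier (double_dual R M)"
    "bij_betw (evaluation R M) (carrier M) (carrier (double_dual R M))"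
  using assms by (auto simp: reflexive_modules_def fg_modules_def bij_betw_def)

text \<open>\<open>X\<close> is cut out of \<open>E\<close> by functionals pulled back from
  \<open>Z\<close>. An element of the double dual of \<open>E\<close> is first matched over
  \<open>Z\<close> by evaluation at a lift \<open>x\<close> of a point of \<open>Z\<close>. The
  remainder kills all functionals coming from \<open>Z\<close> and is therefore evaluation at a
  point of \<open>X\<close>.\<close>

theorem extension_reflexive:
  assumes R: "left_noetherian R" "left_noetherian (op_ring R)"
    and inf: "infinite (UNIV :: 'u set)" and cond: "flat_dim_condition TYPE('u) (op_ring R) 2 2"
    and X: "X \<in> reflexive_modules R" and E: "E \<in> fg_modules R" and Z: "Z \<in> reflexive_modules R"
    and i: "i \<in> mod_hom R X E" "inj_on i (carrier X)"
    and p: "p \<in> mod_hom R E Z" "p ` carrier E = carrier Z"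
    and ip: "i ` carrier X = a_kernel E Z p"
  shows "E \<in> reflexive_modules R"
proof -
  note X = reflexive_modulesD[OF X] and Z = reflexive_modulesD[OF Z]
  have Em: "left_module R E"
    using E by (simp add: fg_modules_def)
  obtain q g n w where "functional_kernel R X E i q (\<lambda>j. dual_map R E Z p (g j)) n w"
      and g: "generates (op_ring R) (dual R Z) q g"
    by (rule functional_kernel_of_hom[OF R X(2) E Z(1,3) p(1) i ip])
  then interpret functional_kernel R X E i q "\<lambda>j. dual_map R E Z p (g j)" n w
    by simp
  have RR: "left_module R (regular_module R)"
    by (rule left_module_regular[OF K.R.ring_axioms])
  have DE: "left_module (op_ring R) (dual R E)" and DZ: "left_module (op_ring R) (dual R Z)"
    by (intro left_module_dual Em Z(2))+
  have zeroE: "\<psi> \<zero>\<^bsub>E\<^esub> = \<zero>\<^bsub>R\<^esub>" if "\<psi> \<in> carrier (dual R E)" for \<psi>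
    using that mod_hom_zero[OF _ Em RR, of \<psi>] by (simp add: dual_simps(1))
  have pdual: "dual_map R E Z p h \<in> carrier (dual R E)" if "h \<in> carrier (dual R Z)" for h
    using dual_map_closed[OF p(1) Em that] .
  have "inj_on (evaluation R E) (carrier E)"
  proof (rule mod_hom_inj_onI[OF evaluation_hom[OF Em] Em left_module_double_dual[OF Em]])
    fix x assume x: "x \<in> carrier E" "evaluation R E x = \<zero>\<^bsub>double_dual R E\<^esub>"
    have \<psi>x: "\<psi> x = \<zero>\<^bsub>R\<^esub>" if "\<psi> \<in> carrier (dual R E)" for \<psi>
      using fun_cong[OF x(2), of \<psi>] that x(1) by (simp add: double_dual_def dual_simps(2))
    have "p x = \<zero>\<^bsub>Z\<^esub>"
    proof (rule torsionless_zero[OF Z(2,3) g mod_hom_closed[OF p(1) x(1)]])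
      fix j assume "j < q"
      then have gj: "g j \<in> carrier (dual R Z)"
        by (rule generates_closed[OF g])
      show "g j (p x) = \<zero>\<^bsub>R\<^esub>"
        using \<psi>x[OF pdual[OF gj]] dual_map_apply[OF gj x(1)] by simp
    qed
    then have "x \<in> i ` carrier X"
      unfolding ip using x(1) by (simp add: a_kernel_iff)
    then obtain y where y: "y \<in> carrier X" "x = i y"
      by blast
    \<comment> \<open>Both sides are zero on restrictions of functionals of \<open>E\<close>, and
      restrictions suffice.\<close>
    have "evaluation R X y = evaluation R X \<zero>\<^bsub>X\<^esub>"
    proof (rule double_dual_eqI[OF inf cond])
      fix \<psi> assume \<psi>: "\<psi> \<in> carrier (dual R E)"
      show "evaluation R X y (res \<psi>) = evaluation R X \<zero>\<^bsub>X\<^esub> (res \<psi>)"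
        using y \<psi>x[OF \<psi>] zeroE[OF \<psi>] mod_hom_closed[OF res_hom \<psi>] mod_hom_zero[OF i(1) X(2) Em]
        by (simp add: dual_map_apply[OF \<psi>])
    qed (use y mod_hom_closed[OF evaluation_hom[OF X(2)]] in auto)
    then have "y = \<zero>\<^bsub>X\<^esub>"
      using inj_onD[OF X(3)] y(1) by simp
    then show "x = \<zero>\<^bsub>E\<^esub>"
      using y(2) mod_hom_zero[OF i(1) X(2) Em] by simp
  qed
  moreover have "evaluation R E ` carrier E = carrier (double_dual R E)"
  proof
    show "evaluation R E ` carrier E \<subseteq> carrier (double_dual R E)"
      using mod_hom_closed[OF evaluation_hom[OF Em]] by auto
    show "carrier (double_dual R E) \<subseteq> evaluation R E ` carrier E"
    proof
      interpret DD: left_module R "double_dual R E"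
        by (rule left_module_double_dual[OF Em])
      fix \<zeta> assume \<zeta>: "\<zeta> \<in> carrier (double_dual R E)"
      have "compose (carrier (dual R Z)) \<zeta> (dual_map R E Z p)
          \<in> mod_hom (op_ring R) (dual R Z) (regular_module (op_ring R))"
        using \<zeta> by (intro mod_hom_compose[OF dual_map_hom[OF p(1) Em Z(2)] _ DZ])
          (simp add: double_dual_def dual_simps(1))
      then have "compose (carrier (dual R Z)) \<zeta> (dual_map R E Z p) \<in> evaluation R Z ` carrier Z"
        unfolding Z(4) by (simp add: double_dual_def dual_simps(1))
      then obtain z where z: "z \<in> carrier Z"
          "compose (carrier (dual R Z)) \<zeta> (dual_map R E Z p) = evaluation R Z z"
        by blast
      have \<zeta>p: "\<zeta> (dual_map R E Z p h) = h z" if "h \<in> carrier (dual R Z)" for h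
        using fun_cong[OF z(2), of h] that z(1) by (simp add: compose_def)
      obtain x where x: "x \<in> carrier E" "z = p x"
        using z(1) unfolding p(2)[symmetric] by blast
      have ev: "evaluation R E x \<in> carrier (double_dual R E)"
        by (rule mod_hom_closed[OF evaluation_hom[OF Em] x(1)])
      define \<eta> where "\<eta> = \<zeta> \<ominus>\<^bsub>double_dual R E\<^esub> evaluation R E x"
      have \<eta>: "\<eta> \<in> carrier (double_dual R E)"
        using \<zeta> ev by (simp add: \<eta>_def)
      have \<zeta>R: "\<zeta> \<psi> \<in> carrier R" if "\<psi> \<in> carrier (dual R E)" for \<psi>
        using \<zeta> dual_closed[of \<zeta> "op_ring R" "dual R E" \<psi>] that by (simp add: double_dual_def)
      have \<eta>_apply: "\<eta> \<psi> = \<zeta> \<psi> \<ominus>\<^bsub>R\<^esub> \<psi> x" if "\<psi> \<in> carrier (dual R E)" for \<psi>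
        using that x(1) dual_minus[OF DE, of "evaluation R E x" \<psi>] ev
        by (simp add: \<eta>_def a_minus_def double_dual_def dual_simps(3))
      have "\<eta> \<psi> = \<zero>\<^bsub>R\<^esub>" if \<psi>: "\<psi> \<in> carrier (dual R E)" and r: "res \<psi> = \<zero>\<^bsub>dual R X\<^esub>" for \<psi>
      proof -
        \<comment> \<open>A functional that vanishes on \<open>X\<close> factors through
          \<open>p\<close>, so it comes from \<open>Z\<close>, where \<open>\<zeta>\<close> is
          evaluation at \<open>z\<close>.\<close>
        have "\<exists>h\<in>mod_hom R Z (regular_module R). \<forall>y\<in>carrier E. h (p y) = \<psi> y"
        proof (rule hom_factor_surj[OF Em Z(2) RR p])
          show "\<psi> \<in> mod_hom R E (regular_module R)"
            using \<psi> by (simp add: dual_simps(1))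
          fix y assume "y \<in> carrier E" "p y = \<zero>\<^bsub>Z\<^esub>"
          then have "y \<in> i ` carrier X"
            unfolding ip by (simp add: a_kernel_iff)
          then obtain y' where "y' \<in> carrier X" "y = i y'"
            by blast
          then show "\<psi> y = \<zero>\<^bsub>regular_module R\<^esub>"
            using fun_cong[OF r, of y'] dual_map_apply[OF \<psi>, of y' X i] by (simp add: dual_simps(2))
        qed
        then obtain h where h: "h \<in> carrier (dual R Z)" "\<And>y. y \<in> carrier E \<Longrightarrow> h (p y) = \<psi> y"
          by (auto simp: dual_simps(1))
        have "\<psi> = dual_map R E Z p h"
          by (rule dual_eqI[OF \<psi> pdual[OF h(1)]]) (use h in \<open>simp add: dual_map_apply\<close>)
        then have "\<zeta> \<psi> = \<psi> x"
          using \<zeta>p[OF h(1)] x h(2) by simp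
        then show ?thesis
          using \<eta>_apply[OF \<psi>] dual_closed[OF \<psi> x(1)] by (simp add: K.R.minus_eq_zero_iff)
      qed
      then obtain \<xi> where \<xi>: "\<xi> \<in> carrier (double_dual R X)"
          "\<And>\<psi>. \<psi> \<in> carrier (dual R E) \<Longrightarrow> \<xi> (res \<psi>) = \<eta> \<psi>"
        using double_dual_extend[OF inf cond \<eta>] by blast
      obtain y where y: "y \<in> carrier X" "\<xi> = evaluation R X y"
        using \<xi>(1) unfolding X(4)[symmetric] by blast
      have iy: "i y \<in> carrier E"
        by (rule mod_hom_closed[OF i(1) y(1)])
      \<comment> \<open>\<open>x\<close> accounts for the part seen by \<open>Z\<close>,
        \<open>i y\<close> for the remainder.\<close>
      have "\<zeta> = evaluation R E (i y \<oplus>\<^bsub>E\<^esub> x)"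
      proof (rule evaluation_eqI[OF Em \<zeta>])
        show "i y \<oplus>\<^bsub>E\<^esub> x \<in> carrier E"
          using iy x(1) by simp
        fix \<psi> assume \<psi>: "\<psi> \<in> carrier (dual R E)"
        have "\<psi> (i y) = \<zeta> \<psi> \<ominus>\<^bsub>R\<^esub> \<psi> x"
          using \<xi>(2)[OF \<psi>] y mod_hom_closed[OF res_hom \<psi>] dual_map_apply[OF \<psi> y(1)] \<eta>_apply[OF \<psi>]
          by simp
        then show "\<zeta> \<psi> = \<psi> (i y \<oplus>\<^bsub>E\<^esub> x)"
          using dual_add[OF \<psi> iy x(1)] \<zeta>R[OF \<psi>] dual_closed[OF \<psi> x(1)]
          by (simp add: a_minus_def K.R.a_assoc K.R.l_neg)
      qed
      then show "\<zeta> \<in> evaluation R E ` carrier E"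
        using iy x(1) by simp
    qed
  qed
  ultimately show ?thesis
    using E by (simp add: reflexive_modules_def bij_betw_def)
qed

section \<open>Duals and second syzygies\<close>

text \<open>Left exactness of Hom: a presentation R^q -> R^n -> M -> 0 identifies the dual of
  \<open>M\<close> with the solutions of the linear equations whose coefficients are the relations
  \<open>s j\<close>.\<close>

lemma coordinates_image:
  assumes R: "left_noetherian R" and M: "left_module R M" and w: "generates R M n w"
  obtains q :: nat and s where "\<And>j. j < q \<Longrightarrow> s j \<in> carrier (free_module R n)"
    "coordinates R M n w ` carrier (dual R M) =
      {v \<in> carrier (free_module (op_ring R) n).
        \<forall>j<q. lincomb (regular_module R) n (s j) v = \<zero>\<^bsub>R\<^esub>}"
proof -
  have ring: "ring R"
    using R by (simp add: left_noetherian_def)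
  have RR: "left_module R (regular_module R)"
    by (rule left_module_regular[OF ring])
  let ?P = "free_module R n" and ?Q = "free_module (op_ring R) n"
  let ?\<pi> = "free_map R M n w"
  have P: "left_module R ?P"
    by (rule left_module_power_module[OF RR])
  interpret M: left_module R M by fact
  interpret P: left_module R ?P by fact
  note wM = generates_closed[OF w]
  have \<pi>: "?\<pi> \<in> mod_hom R ?P M"
    by (rule free_map_hom[OF M wM])
  define N where "N = a_kernel ?P M ?\<pi>"
  have "\<exists>r. (\<forall>i<n. r i \<in> carrier R) \<and> x = lincomb ?P n r (unit_vector R n)" if "x \<in> N" for x
    using that generates_unit_vector[OF ring, of n] by (auto simp: generates_def N_def a_kernel_iff)
  then obtain q s where g: "generates R (?P\<lparr>carrier := N\<rparr>) q s"
    using noetherian_submodule_generators[OF R P submodule_a_kernel[OF \<pi> P M], of n "unit_vector R n"]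
      unit_vector_closed[OF ring] unfolding N_def by blast
  have sN: "s j \<in> carrier ?P" "?\<pi> (s j) = \<zero>\<^bsub>M\<^esub>" if "j < q" for j
    using generates_closed[OF g that] by (auto simp: N_def a_kernel_iff)
  have Q_iff: "v \<in> carrier ?Q \<longleftrightarrow> v \<in> carrier ?P" for v
    by (simp add: power_module_simps)
  have "coordinates R M n w ` carrier (dual R M) =
      {v \<in> carrier ?Q. \<forall>j<q. lincomb (regular_module R) n (s j) v = \<zero>\<^bsub>R\<^esub>}"
  proof (intro equalityI subsetI)
    fix v assume "v \<in> coordinates R M n w ` carrier (dual R M)"
    then obtain \<phi> where \<phi>: "\<phi> \<in> carrier (dual R M)" "v = coordinates R M n w \<phi>"
      by blast
    have "lincomb (regular_module R) n (s j) v = \<zero>\<^bsub>R\<^esub>" if j: "j < q" for j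
    proof -
      have "lincomb (regular_module R) n (s j) v = lincomb (regular_module R) n (s j) (\<lambda>i. \<phi> (w i))"
        by (rule lincomb_cong) (auto simp: \<phi> coordinates_def)
      also have "\<dots> = \<phi> (lincomb M n (s j) w)"
        using sN(1)[OF j] wM by (intro dual_lincomb[OF M \<phi>(1), symmetric]) (auto simp: power_module_simps)
      also have "lincomb M n (s j) w = \<zero>\<^bsub>M\<^esub>"
        using sN[OF j] by (simp add: free_map_def)
      also have "\<phi> \<zero>\<^bsub>M\<^esub> = \<zero>\<^bsub>R\<^esub>"
        using mod_hom_zero[OF _ M RR, of \<phi>] \<phi>(1) by (simp add: dual_simps(1))
      finally show ?thesis .
    qed
    then show "v \<in> {v \<in> carrier ?Q. \<forall>j<q. lincomb (regular_module R) n (s j) v = \<zero>\<^bsub>R\<^esub>}"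
      using mod_hom_closed[OF coordinates_hom[OF M wM] \<phi>(1)] \<phi>(2) by simp
  next
    fix v assume v: "v \<in> {v \<in> carrier ?Q. \<forall>j<q. lincomb (regular_module R) n (s j) v = \<zero>\<^bsub>R\<^esub>}"
    then have vR: "v i \<in> carrier (regular_module R)" if "i < n" for i
      using that by (auto simp: power_module_simps)
    \<comment> \<open>A solution \<open>v\<close> defines a functional on R^n that kills the
      relations and so descends to \<open>M\<close>.\<close>
    let ?g = "free_map R (regular_module R) n v"
    have g_hom: "?g \<in> mod_hom R ?P (regular_module R)"
      by (rule free_map_hom[OF RR vR])
    have "\<exists>\<phi>\<in>mod_hom R M (regular_module R). \<forall>r\<in>carrier ?P. \<phi> (?\<pi> r) = ?g r"
    proof (rule hom_factor_surj[OF P M RR \<pi> free_map_surj[OF M w] g_hom])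
      fix r assume "r \<in> carrier ?P" "?\<pi> r = \<zero>\<^bsub>M\<^esub>"
      then have "r \<in> carrier (?P\<lparr>carrier := N\<rparr>)"
        by (simp add: N_def a_kernel_iff)
      then obtain t where t: "\<And>j. j < q \<Longrightarrow> t j \<in> carrier R" "r = lincomb (?P\<lparr>carrier := N\<rparr>) q t s"
        using generatesE[OF g] by blast
      have "?g r = lincomb (regular_module R) q t (\<lambda>j. ?g (s j))"
        unfolding t(2) lincomb_carrier_update using t(1) sN(1) by (intro mod_hom_lincomb[OF g_hom P RR])
      also have "\<dots> = lincomb (regular_module R) q t (\<lambda>j. \<zero>\<^bsub>regular_module R\<^esub>)"
        by (rule lincomb_cong) (use v sN in \<open>auto simp: free_map_def\<close>)
      finally show "?g r = \<zero>\<^bsub>regular_module R\<^esub>"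
        using left_module.lincomb_zero_right[OF RR t(1)] by simp
    qed
    then obtain \<phi> where \<phi>: "\<phi> \<in> carrier (dual R M)" "\<And>r. r \<in> carrier ?P \<Longrightarrow> \<phi> (?\<pi> r) = ?g r"
      by (auto simp: dual_simps(1))
    have unit: "lincomb L n (unit_vector R n i) x = x i" if "left_module R L" "i < n" "\<And>i. i < n \<Longrightarrow> x i \<in> carrier L"
      for i x and L :: "('a, 'x) module"
    proof -
      have "lincomb L n (unit_vector R n i) x = lincomb L n (\<lambda>j. if j = i then \<one>\<^bsub>R\<^esub> else \<zero>\<^bsub>R\<^esub>) x"
        by (rule lincomb_cong) auto
      then show ?thesis
        using left_module.lincomb_unit_left[OF that] by simp
    qed
    have "\<phi> (w i) = v i" if i: "i < n" for i
    proof -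
      have u: "unit_vector R n i \<in> carrier ?P"
        by (rule unit_vector_closed[OF ring])
      have "?\<pi> (unit_vector R n i) = w i"
        using u unit[OF M i wM] by (simp add: free_map_def)
      moreover have "?g (unit_vector R n i) = v i"
        using u unit[OF RR i vR] by (simp add: free_map_def)
      ultimately show ?thesis
        using \<phi>(2)[OF u] by simp
    qed
    then have "coordinates R M n w \<phi> = v"
      using \<phi>(1) v by (auto simp: coordinates_def power_module_simps fun_eq_iff)
    then show "v \<in> coordinates R M n w ` carrier (dual R M)"
      using \<phi>(1) by blast
  qed
  from that[OF sN(1) this] show thesis
    by simp
qed

section \<open>Reflexivity of free modules and of duals\<close>

lemma power_module_evaluation_bij:
  assumes "ring R"
  shows "bij_betw (evaluation R (free_module R n))
    (carrier (free_module R n))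
    (carrier (double_dual R (free_module R n)))"
proof (rule evaluation_bij_of_dual_basis)
  let ?P = "free_module R n"
  show "left_module R ?P"
    by (intro left_module_power_module left_module_regular assms)
  show "unit_vector R n i \<in> carrier ?P" for i
    by (rule unit_vector_closed[OF assms])
  show "(\<lambda>v\<in>carrier ?P. v i) \<in> carrier (dual R ?P)" if "i < n" for i
    by (rule projection_dual[OF assms that])
  show "x = lincomb ?P n (\<lambda>i. (\<lambda>v\<in>carrier ?P. v i) x) (unit_vector R n)" if "x \<in> carrier ?P" for x
    using lincomb_unit_vector[OF assms that] that by simp
qed

text \<open>The dual is a zero set of functionals on a free module over the opposite ring, and free
  modules are reflexive. The kernel theorem is applied over \<open>op_ring R\<close>, so the
  condition it consumes is the one over \<open>R\<close>.\<close>

theorem dual_reflexive: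
  assumes R: "left_noetherian R" "left_noetherian (op_ring R)"
    and inf: "infinite (UNIV :: 'u set)" and cond: "flat_dim_condition TYPE('u) R 2 2"
    and M: "M \<in> fg_modules R"
  shows "dual R M \<in> reflexive_modules (op_ring R)"
proof -
  obtain n w where Mm: "left_module R M" and w: "generates R M n w"
    by (rule fg_modulesE[OF M])
  have ring: "ring (op_ring R)"
    using R(2) by (simp add: left_noetherian_def)
  have RO: "left_module (op_ring R) (regular_module (op_ring R))"
    by (rule left_module_regular[OF ring])
  let ?Q = "free_module (op_ring R) n"
  obtain q :: nat and s where s: "\<And>j. j < q \<Longrightarrow> s j \<in> carrier (free_module R n)"
    and im: "coordinates R M n w ` carrier (dual R M) =
      {v \<in> carrier ?Q. \<forall>j<q. lincomb (regular_module R) n (s j) v = \<zero>\<^bsub>R\<^esub>}"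
    by (rule coordinates_image[OF R(1) Mm w], rule that)
  have sR: "s j i \<in> carrier (regular_module (op_ring R))" if "j < q" "i < n" for i j
    using s[OF that(1)] that(2) by (auto simp: power_module_simps)
  let ?f = "\<lambda>j. free_map (op_ring R) (regular_module (op_ring R)) n (s j)"
  have "functional_kernel (op_ring R) (dual R M) ?Q (coordinates R M n w) q ?f n (unit_vector (op_ring R) n)"
  proof (rule functional_kernel.intro)
    show "left_module (op_ring R) (dual R M)"
      by (rule left_module_dual[OF Mm])
    show "left_module (op_ring R) ?Q"
      by (rule left_module_power_module[OF RO])
    show "coordinates R M n w \<in> mod_hom (op_ring R) (dual R M) ?Q"
      by (rule coordinates_hom[OF Mm generates_closed[OF w]])
    show "inj_on (coordinates R M n w) (carrier (dual R M))"
      by (rule coordinates_inj[OF Mm w])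
    show "?f j \<in> carrier (dual (op_ring R) ?Q)" if "j < q" for j
      unfolding dual_simps(1) by (rule free_map_hom[OF RO sR[OF that]])
    show "coordinates R M n w ` carrier (dual R M) =
        {x \<in> carrier ?Q. \<forall>j<q. ?f j x = \<zero>\<^bsub>op_ring R\<^esub>}"
      unfolding im by (auto simp: free_map_def lincomb_regular_op)
    show "generates (op_ring R) ?Q n (unit_vector (op_ring R) n)"
      by (rule generates_unit_vector[OF ring])
  qed (rule R(2))
  from functional_kernel.kernel_reflexive[OF this inf _ power_module_evaluation_bij[OF ring]] cond
  show ?thesis
    by simp
qed


lemma kernel_of_hom_reflexive:
  assumes R: "left_noetherian R" "left_noetherian (op_ring R)"
    and inf: "infinite (UNIV :: 'u set)" and cond: "flat_dim_condition TYPE('u) (op_ring R) 2 2"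
    and K: "left_module R K" and X: "X \<in> reflexive_modules R" and Y: "Y \<in> reflexive_modules R"
    and h: "h \<in> mod_hom R X Y"
    and \<iota>: "\<iota> \<in> mod_hom R K X" "inj_on \<iota> (carrier K)" "\<iota> ` carrier K = a_kernel X Y h"
  shows "K \<in> reflexive_modules R"
proof -
  note X = reflexive_modulesD[OF X] and Y = reflexive_modulesD[OF Y]
  obtain q g n w where "functional_kernel R K X \<iota> q (\<lambda>j. dual_map R X Y h (g j)) n w"
    by (rule functional_kernel_of_hom[OF R K X(1) Y(1,3) h \<iota>])
  from functional_kernel.kernel_reflexive[OF this inf cond X(5)] show ?thesis .
qed

text \<open>Second syzygies ask for projective modules with carriers in \<open>'u\<close>, so free
  modules are needed there as copies. A lift is given by preimages of the images of the unit
  vectors.\<close>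

lemma projective_image_power_module:
  fixes h :: "(nat \<Rightarrow> 'a) \<Rightarrow> 'u"
  assumes ring: "ring R" and h: "inj_on h (carrier (free_module R n))"
  shows "projective_module R (image_module h (free_module R n))"
  unfolding projective_module_def
proof (intro conjI allI impI)
  let ?F = "free_module R n"
  let ?H = "image_module h ?F"
  have F: "left_module R ?F"
    by (intro left_module_power_module left_module_regular ring)
  show H: "left_module R ?H"
    by (rule left_module_image_module[OF F h])
  fix A B :: "('a, 'u) module" and p f
  assume "left_module R A \<and> left_module R B \<and> p \<in> mod_hom R A B \<and> p ` carrier A = carrier B \<and>
    f \<in> mod_hom R ?H B"
  then have A: "left_module R A" and B: "left_module R B" 
    and p: "p \<in> mod_hom R A B" "p ` carrier A = carrier B" and f: "f \<in> mod_hom R ?H B"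
    by simp_all
  have u: "unit_vector R n i \<in> carrier ?F" for i
    by (rule unit_vector_closed[OF ring])
  have "\<exists>a. a \<in> carrier A \<and> p a = f (h (unit_vector R n i))" for i
  proof -
    have "f (h (unit_vector R n i)) \<in> p ` carrier A"
      unfolding p(2) using u by (intro mod_hom_closed[OF f]) simp
    then show ?thesis
      by (auto simp: image_iff)
  qed
  then obtain a where a: "\<And>i. a i \<in> carrier A" "\<And>i. p (a i) = f (h (unit_vector R n i))"
    by metis
  have g0: "free_map R A n a \<in> mod_hom R ?F A"
    by (rule free_map_hom[OF A a(1)])
  let ?g = "compose (carrier ?H) (free_map R A n a) (restrict (inv_into (carrier ?F) h) (h ` carrier ?F))"
  have g: "?g \<in> mod_hom R ?H A"
    by (rule mod_hom_compose[OF image_module_inv_hom[OF F h] g0 H])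
  note fh = mod_hom_compose[OF image_module_hom[OF F h] f F]
  have "p (?g x) = f x" if x: "x \<in> carrier ?H" for x
  proof -
    obtain v where v: "v \<in> carrier ?F" "x = h v"
      using x by auto
    have vR: "v i \<in> carrier R" if "i < n" for i
      using v(1) that by (auto simp: power_module_simps)
    have "p (?g x) = p (lincomb A n v a)"
      using v h by (simp add: compose_def free_map_def)
    also have "\<dots> = lincomb B n v (\<lambda>i. p (a i))"
      using vR a(1) by (intro mod_hom_lincomb[OF p(1) A B])
    also have "\<dots> = lincomb B n v (\<lambda>i. compose (carrier ?F) f (restrict h (carrier ?F)) (unit_vector R n i))"
      by (rule lincomb_cong) (use a(2) u in \<open>auto simp: compose_def\<close>)
    also have "\<dots> = compose (carrier ?F) f (restrict h (carrier ?F)) (lincomb ?F n v (unit_vector R n))"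
      using vR u by (intro mod_hom_lincomb[OF fh F B, symmetric])
    also have "\<dots> = f x"
      using v lincomb_unit_vector[OF ring v(1)] by (simp add: compose_def)
    finally show ?thesis .
  qed
  then show "\<exists>g\<in>mod_hom R ?H A. \<forall>x\<in>carrier ?H. p (g x) = f x"
    using g by blast
qed

lemma projective_moduleD:
  fixes P A B :: "('a, 'u) module"
  assumes "projective_module R P" "left_module R A" "left_module R B"
    and "p \<in> mod_hom R A B" "p ` carrier A = carrier B" "f \<in> mod_hom R P B"
  shows "\<exists>g\<in>mod_hom R P A. \<forall>x\<in>carrier P. p (g x) = f x"
  using assms unfolding projective_module_def by blast

text \<open>Projectivity splits the cover of \<open>P\<close> by a copy of a free module, and the
  coordinates of the splitting form a dual basis with the generators.\<close>

lemma projective_reflexive: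
  fixes P :: "('a, 'u) module" and e :: "'a \<Rightarrow> 'u"
  assumes inf: "infinite (UNIV :: 'u set)" "inj_on e (carrier R)"
    and P: "P \<in> fg_modules R" "projective_module R P"
  shows "P \<in> reflexive_modules R"
proof -
  obtain n w where Pm: "left_module R P" and w: "generates R P n w"
    by (rule fg_modulesE[OF P(1)])
  have ring: "ring R"
    by (rule left_module_ring[OF Pm])
  let ?F = "free_module R n"
  have F: "left_module R ?F"
    by (intro left_module_power_module left_module_regular ring)
  obtain h :: "(nat \<Rightarrow> 'a) \<Rightarrow> 'u" where h: "inj_on h (carrier ?F)"
    using embed_power_module[OF inf] by blast
  let ?H = "image_module h ?F"
  have H: "left_module R ?H"
    by (rule left_module_image_module[OF F h])
  note inv = image_module_inv_hom[OF F h]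
  let ?inv = "restrict (inv_into (carrier ?F) h) (h ` carrier ?F)"
  note \<pi> = free_map_hom[OF Pm generates_closed[OF w]]
  let ?p = "compose (carrier ?H) (free_map R P n w) ?inv"
  have p: "?p \<in> mod_hom R ?H P"
    by (rule mod_hom_compose[OF inv \<pi> H])
  have "?p ` carrier ?H = free_map R P n w ` carrier ?F"
    using h by (force simp: compose_def)
  then have p_surj: "?p ` carrier ?H = carrier P"
    using free_map_surj[OF Pm w] by simp
  obtain s where s: "s \<in> mod_hom R P ?H" "\<And>x. x \<in> carrier P \<Longrightarrow> ?p (s x) = x"
    using projective_moduleD[OF P(2) H Pm p p_surj mod_hom_id[OF Pm]] by auto
  \<comment> \<open>The splitting with its values moved back to actual tuples; its components are
    the functionals of the dual basis.\<close>
  let ?s = "compose (carrier P) ?inv s"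
  have s': "?s \<in> mod_hom R P ?F"
    by (rule mod_hom_compose[OF s(1) inv Pm])
  have "bij_betw (evaluation R P) (carrier P) (carrier (double_dual R P))"
  proof (rule evaluation_bij_of_dual_basis[OF Pm generates_closed[OF w]])
    show "compose (carrier P) (\<lambda>v\<in>carrier ?F. v i) ?s \<in> carrier (dual R P)" if "i < n" for i
      using mod_hom_compose[OF s' _ Pm] projection_dual[OF ring that] by (simp add: dual_simps(1))
    show "x = lincomb P n (\<lambda>i. compose (carrier P) (\<lambda>v\<in>carrier ?F. v i) ?s x) w" if x: "x \<in> carrier P" for x
    proof -
      have sx: "s x \<in> carrier ?H" "?s x \<in> carrier ?F"
        using mod_hom_closed[OF s(1) x] mod_hom_closed[OF s' x] by auto
      have "x = ?p (s x)"
        using s(2)[OF x] by simp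
      also have "\<dots> = free_map R P n w (?s x)"
        using sx(1) x by (simp add: compose_def)
      also have "\<dots> = lincomb P n (?s x) w"
        using sx(2) by (simp add: free_map_def)
      also have "\<dots> = lincomb P n (\<lambda>i. compose (carrier P) (\<lambda>v\<in>carrier ?F. v i) ?s x) w"
        using sx(2) x by (simp add: compose_def)
      finally show ?thesis .
    qed
  qed auto
  then show ?thesis
    using P(1) by (simp add: reflexive_modules_def)
qed

text \<open>\<open>X\<close> is the dual of its dual, and a dual is the kernel of a matrix between
  free modules. The matrix consists of relations among generators of the dual of \<open>X\<close>;
  both free modules are then moved into \<open>'u\<close>.\<close>

lemma second_syzygy_of_reflexive:
  fixes X :: "('a, 'u) module" and e :: "'a \<Rightarrow> 'u"
  assumes R: "left_noetherian R" "left_noetherian (op_ring R)"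
    and inf: "infinite (UNIV :: 'u set)" "inj_on e (carrier R)"
    and X: "X \<in> reflexive_modules R"
  shows "X \<in> second_syzygies R"
proof -
  note X = reflexive_modulesD[OF X]
  obtain n0 w0 where "generates R X n0 w0"
    by (rule fg_modulesE[OF X(1)])
  then obtain n \<phi> where \<phi>: "generates (op_ring R) (dual R X) n \<phi>"
    using generates_dual[OF R(2) X(2)] by blast
  have ring: "ring R"
    using R(1) by (simp add: left_noetherian_def)
  have RR: "left_module R (regular_module R)"
    by (rule left_module_regular[OF ring])
  have DX: "left_module (op_ring R) (dual R X)" and DDX: "left_module R (double_dual R X)"
    using left_module_dual[OF X(2)] left_module_double_dual[OF X(2)] by auto
  let ?F = "\<lambda>n. free_module R n"
  have F: "left_module R (?F m)" for m
    by (rule left_module_power_module[OF RR])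
  obtain q :: nat and s where s: "\<And>j. j < q \<Longrightarrow> s j \<in> carrier (free_module (op_ring R) n)"
    and im: "coordinates (op_ring R) (dual R X) n \<phi> ` carrier (double_dual R X) =
      {v \<in> carrier (?F n). \<forall>j<q. lincomb (regular_module (op_ring R)) n (s j) v = \<zero>\<^bsub>R\<^esub>}"
    by (rule coordinates_image[OF R(2) DX \<phi>], rule that) (simp_all add: double_dual_def)
  let ?c = "coordinates (op_ring R) (dual R X) n \<phi>"
  have c: "?c \<in> mod_hom R (double_dual R X) (?F n)"
    using coordinates_hom[OF DX generates_closed[OF \<phi>]] by (simp add: double_dual_def)
  have c_inj: "inj_on ?c (carrier (double_dual R X))"
    using coordinates_inj[OF DX \<phi>] by (simp add: double_dual_def)
  let ?a = "compose (carrier X) ?c (evaluation R X)"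
  have i0: "?a \<in> mod_hom R X (?F n)"
    by (rule mod_hom_compose[OF evaluation_hom[OF X(2)] c X(2)])
  have i0_inj: "inj_on ?a (carrier X)"
  proof (rule inj_onI)
    fix x y assume xy: "x \<in> carrier X" "y \<in> carrier X" "?a x = ?a y"
    then have "?c (evaluation R X x) = ?c (evaluation R X y)"
      by (simp add: compose_def)
    then have "evaluation R X x = evaluation R X y"
      using mod_hom_closed[OF evaluation_hom[OF X(2)]] xy(1,2) by (intro inj_onD[OF c_inj])
    then show "x = y"
      using inj_onD[OF X(3)] xy(1,2) by simp
  qed
  have i0_im: "?a ` carrier X = ?c ` carrier (double_dual R X)"
    unfolding X(4)[symmetric] by (auto simp: compose_def)
  \<comment> \<open>The transpose of \<open>s\<close>: \<open>t i\<close> is the image of the unit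
    vector \<open>i\<close> under the map whose component \<open>j\<close> is the left side of
    equation \<open>j\<close>.\<close>
  define t where "t i = (\<lambda>j\<in>{..<q}. s j i)" for i
  have t: "t i \<in> carrier (?F q)" if "i < n" for i
    using s that by (auto simp: t_def power_module_simps)
  let ?b = "free_map R (?F q) n t"
  have f0: "?b \<in> mod_hom R (?F n) (?F q)"
    by (rule free_map_hom[OF F t])
  have f0_ker: "?b v = \<zero>\<^bsub>?F q\<^esub> \<longleftrightarrow> (\<forall>j<q. lincomb (regular_module (op_ring R)) n (s j) v = \<zero>\<^bsub>R\<^esub>)"
    if v: "v \<in> carrier (?F n)" for v
  proof -
    have *: "?b v j = lincomb (regular_module (op_ring R)) n (s j) v" if j: "j < q" for j
    proof -
      have "?b v j = lincomb (regular_module R) n v (\<lambda>i. t i j)"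
        using v j by (simp add: free_map_def lincomb_power_module)
      also have "\<dots> = lincomb (regular_module R) n v (s j)"
        by (rule lincomb_cong) (use j in \<open>auto simp: t_def\<close>)
      finally show ?thesis
        by (simp add: lincomb_regular_op)
    qed
    show ?thesis
    proof
      assume "?b v = \<zero>\<^bsub>?F q\<^esub>"
      then show "\<forall>j<q. lincomb (regular_module (op_ring R)) n (s j) v = \<zero>\<^bsub>R\<^esub>"
        using * by (simp add: power_module_simps(2))
    next
      assume 0: "\<forall>j<q. lincomb (regular_module (op_ring R)) n (s j) v = \<zero>\<^bsub>R\<^esub>"
      show "?b v = \<zero>\<^bsub>?F q\<^esub>"
      proof
        fix j show "?b v j = \<zero>\<^bsub>?F q\<^esub> j"
          using * 0 mod_hom_closed[OF f0 v]
          by (cases "j < q") (simp_all add: power_module_simps(2), auto simp: power_module_simps(1))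
      qed
    qed
  qed
  obtain h :: "(nat \<Rightarrow> 'a) \<Rightarrow> 'u" where h: "inj_on h (carrier (?F n))"
    using embed_power_module[OF inf] by blast
  obtain h' :: "(nat \<Rightarrow> 'a) \<Rightarrow> 'u" where h': "inj_on h' (carrier (?F q))"
    using embed_power_module[OF inf] by blast
  let ?P = "image_module h (?F n)" and ?Q = "image_module h' (?F q)"
  have P: "left_module R ?P" and Q: "left_module R ?Q"
    by (intro left_module_image_module F h h')+
  have fg: "image_module k (?F m) \<in> fg_modules R" if "inj_on k (carrier (?F m))" for k :: "(nat \<Rightarrow> 'a) \<Rightarrow> 'u" and m
    by (rule fg_modulesI[OF left_module_image_module[OF F that]
          generates_surj[OF generates_unit_vector[OF ring] F left_module_image_module[OF F that]
            image_module_hom[OF F that]]]) simp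
  let ?i = "compose (carrier X) (restrict h (carrier (?F n))) ?a"
  have i: "?i \<in> mod_hom R X ?P"
    by (rule mod_hom_compose[OF i0 image_module_hom[OF F h] X(2)])
  let ?inv = "restrict (inv_into (carrier (?F n)) h) (h ` carrier (?F n))"
  let ?d = "compose (carrier ?P) ?b ?inv"
  have f1: "?d \<in> mod_hom R ?P (?F q)"
    by (rule mod_hom_compose[OF image_module_inv_hom[OF F h] f0 P])
  let ?f = "compose (carrier ?P) (restrict h' (carrier (?F q))) ?d"
  have f: "?f \<in> mod_hom R ?P ?Q"
    by (rule mod_hom_compose[OF f1 image_module_hom[OF F h'] P])
  have i_apply: "?i x = h (?a x)" if "x \<in> carrier X" for x
    using mod_hom_closed[OF i0 that] that by (simp add: compose_def)
  have f_apply: "?f (h v) = h' (?b v)" if "v \<in> carrier (?F n)" for v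
    using mod_hom_closed[OF f0 that] that h by (simp add: compose_def)
  have i_inj: "inj_on ?i (carrier X)"
  proof (rule inj_onI)
    fix x y assume xy: "x \<in> carrier X" "y \<in> carrier X" "?i x = ?i y"
    then have "h (?a x) = h (?a y)"
      using i_apply by simp
    then have "?a x = ?a y"
      using mod_hom_closed[OF i0] xy(1,2) by (intro inj_onD[OF h])
    then show "x = y"
      using xy(1,2) by (rule inj_onD[OF i0_inj])
  qed
  have "?i ` carrier X = h ` ?a ` carrier X"
    unfolding image_image using i_apply by (intro image_cong refl)
  also have "\<dots> = h ` {v \<in> carrier (?F n). ?b v = \<zero>\<^bsub>?F q\<^esub>}"
    unfolding i0_im im using f0_ker by (intro arg_cong[where f = "(`) h"]) blast
  also have "\<dots> = a_kernel ?P ?Q ?f"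
  proof (intro equalityI subsetI)
    fix x assume "x \<in> h ` {v \<in> carrier (?F n). ?b v = \<zero>\<^bsub>?F q\<^esub>}"
    then obtain v where "v \<in> carrier (?F n)" "?b v = \<zero>\<^bsub>?F q\<^esub>" "x = h v"
      by blast
    then show "x \<in> a_kernel ?P ?Q ?f"
      using f_apply[of v] by (simp add: a_kernel_iff)
  next
    fix x assume x: "x \<in> a_kernel ?P ?Q ?f"
    then obtain v where v: "v \<in> carrier (?F n)" "x = h v"
      by (auto simp: a_kernel_iff)
    then have "h' (?b v) = h' \<zero>\<^bsub>?F q\<^esub>"
      using x f_apply[OF v(1)] by (simp add: a_kernel_iff)
    moreover have "\<zero>\<^bsub>?F q\<^esub> \<in> carrier (?F q)"
      using F[of q] by (simp add: left_module_def abelian_group_def abelian_monoid.zero_closed)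
    ultimately have "?b v = \<zero>\<^bsub>?F q\<^esub>"
      using mod_hom_closed[OF f0 v(1)] by (intro inj_onD[OF h'])
    then show "x \<in> h ` {v \<in> carrier (?F n). ?b v = \<zero>\<^bsub>?F q\<^esub>}"
      using v by blast
  qed
  finally have "?i ` carrier X = a_kernel ?P ?Q ?f" .
  then show ?thesis
    unfolding second_syzygies_def
    using X(1) fg[OF h] fg[OF h'] projective_image_power_module[OF ring h]
      projective_image_power_module[OF ring h'] i i_inj f by blast
qed

section \<open>The adjunction\<close>

lemma double_dual_map_apply:
  assumes "left_module R X" "left_module R Y" "f \<in> mod_hom R X Y"
    and "\<xi> \<in> carrier (double_dual R X)" "g \<in> carrier (dual R Y)"
  shows "double_dual_map R X Y f \<xi> g = \<xi> (dual_map R X Y f g)"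
  using assms unfolding double_dual_map_def double_dual_def by (simp add: dual_map_apply)

lemma double_dual_map_hom:
  assumes "left_module R X" "left_module R Y" "f \<in> mod_hom R X Y"
  shows "double_dual_map R X Y f \<in> mod_hom R (double_dual R X) (double_dual R Y)"
  using dual_map_hom[OF dual_map_hom[OF assms(3,1,2)] left_module_dual[OF assms(2)] left_module_dual[OF assms(1)]]
  by (simp add: double_dual_map_def double_dual_def)

text \<open>Naturality of evaluation: both elements send \<open>g\<close> to \<open>g (f x)\<close>.
  It yields naturality of the adjunction in the first variable and surjectivity in the universal
  property.\<close>

lemma double_dual_map_evaluation:
  assumes "left_module R X" "left_module R Y" "f \<in> mod_hom R X Y" "x \<in> carrier X"
  shows "double_dual_map R X Y f (evaluation R X x) = evaluation R Y (f x)"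
proof (rule evaluation_eqI[OF assms(2)])
  have ev: "evaluation R X x \<in> carrier (double_dual R X)"
    by (rule mod_hom_closed[OF evaluation_hom[OF assms(1)] assms(4)])
  show "double_dual_map R X Y f (evaluation R X x) \<in> carrier (double_dual R Y)"
    by (rule mod_hom_closed[OF double_dual_map_hom[OF assms(1-3)] ev])
  show "f x \<in> carrier Y"
    by (rule mod_hom_closed[OF assms(3,4)])
  show "double_dual_map R X Y f (evaluation R X x) g = g (f x)" if "g \<in> carrier (dual R Y)" for g
    using double_dual_map_apply[OF assms(1-3) ev that] dual_map_closed[OF assms(3,1) that] assms(4)
    by (simp add: dual_map_apply[OF that])
qed

lemma double_dual_eq_apply:
  assumes "\<xi> \<in> carrier (double_dual R M)" "\<xi>' \<in> carrier (double_dual R M)"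
    and "\<And>f. f \<in> carrier (dual R M) \<Longrightarrow> \<xi> f = \<xi>' f"
  shows "\<xi> = \<xi>'"
  using dual_eqI[of \<xi> "op_ring R" "dual R M" \<xi>'] assms by (simp add: double_dual_def)

text \<open>Reflexivity of the values is a premise, to be supplied from the flat dimension
  conditions; the functor laws are formal.\<close>

lemma double_dual_functor:
  assumes "\<And>X :: ('a, 'u) module. X \<in> fg_modules R \<Longrightarrow> double_dual R X \<in> reflexive_modules R"
  shows "functor_mod_to_ref R (double_dual R :: ('a, 'u) module \<Rightarrow> _) (double_dual_map R)"
  unfolding functor_mod_to_ref_def
proof (intro conjI ballI)
  fix X :: "('a, 'u) module" assume X: "X \<in> fg_modules R"
  then have Xm: "left_module R X"
    by (simp add: fg_modules_def)
  show "double_dual R X \<in> reflexive_modules R"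
    by (rule assms[OF X])
  let ?id = "\<lambda>x\<in>carrier X. x"
  note id = double_dual_map_hom[OF Xm Xm mod_hom_id[OF Xm]]
  have DD: "left_module R (double_dual R X)"
    by (rule left_module_double_dual[OF Xm])
  show "double_dual_map R X X ?id = (\<lambda>x\<in>carrier (double_dual R X). x)"
  proof (rule mod_hom_eqI[OF id mod_hom_id[OF DD]])
    fix \<xi> assume \<xi>: "\<xi> \<in> carrier (double_dual R X)"
    have "double_dual_map R X X ?id \<xi> = \<xi>"
    proof (rule double_dual_eq_apply[OF mod_hom_closed[OF id \<xi>] \<xi>])
      fix f assume f: "f \<in> carrier (dual R X)"
      have "dual_map R X X ?id f = f"
        by (rule dual_eqI[OF dual_map_closed[OF mod_hom_id[OF Xm] Xm f] f])
          (simp add: dual_map_apply[OF f])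
      then show "double_dual_map R X X ?id \<xi> f = \<xi> f"
        using double_dual_map_apply[OF Xm Xm mod_hom_id[OF Xm] \<xi> f] by simp
    qed
    then show "double_dual_map R X X ?id \<xi> = (\<lambda>x\<in>carrier (double_dual R X). x) \<xi>"
      using \<xi> by simp
  qed
next
  fix X Y :: "('a, 'u) module" and f
  assume "X \<in> fg_modules R" "Y \<in> fg_modules R" "f \<in> mod_hom R X Y"
  then show "double_dual_map R X Y f \<in> mod_hom R (double_dual R X) (double_dual R Y)"
    by (intro double_dual_map_hom) (auto simp: fg_modules_def)
next
  fix X Y Z :: "('a, 'u) module" and f g
  assume X: "X \<in> fg_modules R" and Y: "Y \<in> fg_modules R" and Z: "Z \<in> fg_modules R"
    and f: "f \<in> mod_hom R X Y" and g: "g \<in> mod_hom R Y Z"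
  then have Xm: "left_module R X" and Ym: "left_module R Y" and Zm: "left_module R Z"
    by (simp_all add: fg_modules_def)
  let ?gf = "compose (carrier X) g f"
  have gf: "?gf \<in> mod_hom R X Z"
    by (rule mod_hom_compose[OF f g Xm])
  note hf = double_dual_map_hom[OF Xm Ym f] and hg = double_dual_map_hom[OF Ym Zm g]
    and hgf = double_dual_map_hom[OF Xm Zm gf]
  note hc = mod_hom_compose[OF hf hg left_module_double_dual[OF Xm]]
  show "double_dual_map R X Z ?gf =
      compose (carrier (double_dual R X)) (double_dual_map R Y Z g) (double_dual_map R X Y f)"
  proof (rule mod_hom_eqI[OF hgf hc])
    fix \<xi> assume \<xi>: "\<xi> \<in> carrier (double_dual R X)"
    show "double_dual_map R X Z ?gf \<xi> =
        compose (carrier (double_dual R X)) (double_dual_map R Y Z g) (double_dual_map R X Y f) \<xi>"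
    proof (rule double_dual_eq_apply[OF mod_hom_closed[OF hgf \<xi>] mod_hom_closed[OF hc \<xi>]])
      fix h assume h: "h \<in> carrier (dual R Z)"
      note gh = dual_map_closed[OF g Ym h]
      have "dual_map R X Z ?gf h = dual_map R X Y f (dual_map R Y Z g h)"
        by (rule dual_eqI[OF dual_map_closed[OF gf Xm h] dual_map_closed[OF f Xm gh]])
          (simp add: dual_map_apply[OF h] dual_map_apply[OF gh] mod_hom_closed[OF f] compose_def)
      then show "double_dual_map R X Z ?gf \<xi> h =
          compose (carrier (double_dual R X)) (double_dual_map R Y Z g) (double_dual_map R X Y f) \<xi> h"
        using double_dual_map_apply[OF Xm Zm gf \<xi> h] double_dual_map_apply[OF Xm Ym f \<xi> gh]
          double_dual_map_apply[OF Ym Zm g mod_hom_closed[OF hf \<xi>] h] \<xi>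
        by (simp add: compose_def)
    qed
  qed
qed

text \<open>A functional on \<open>Y\<close> after \<open>g\<close> is a functional on the double
  dual of \<open>X\<close>, hence evaluation at some \<open>u\<close> in the dual of
  \<open>X\<close>, as that dual is reflexive. On the image of evaluation it takes the values of
  \<open>u\<close>, which determine \<open>u\<close>. So \<open>g\<close> and \<open>g'\<close>
  agree after every functional on \<open>Y\<close>, and \<open>Y\<close> is torsionless.\<close>

lemma evaluation_epi:
  assumes X: "left_module R X" and DX: "dual R X \<in> reflexive_modules (op_ring R)"
    and Y: "left_module R Y" "inj_on (evaluation R Y) (carrier Y)"
    and g: "g \<in> mod_hom R (double_dual R X) Y" "g' \<in> mod_hom R (double_dual R X) Y"
    and eq: "\<And>x. x \<in> carrier X \<Longrightarrow> g (evaluation R X x) = g' (evaluation R X x)"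
  shows "g = g'"
proof (rule mod_hom_eqI[OF g])
  have DD: "left_module R (double_dual R X)"
    by (rule left_module_double_dual[OF X])
  have DDD: "double_dual (op_ring R) (dual R X) = dual R (double_dual R X)"
    by (simp add: double_dual_def)
  fix \<xi> assume \<xi>: "\<xi> \<in> carrier (double_dual R X)"
  have "y (g \<xi>) = y (g' \<xi>)" if y: "y \<in> carrier (dual R Y)" for y
  proof -
    have *: "dual_map R (double_dual R X) Y k y \<in> evaluation (op_ring R) (dual R X) ` carrier (dual R X)"
      if "k \<in> mod_hom R (double_dual R X) Y" for k
      using reflexive_modulesD(4)[OF DX] dual_map_closed[OF that DD y] by (simp add: DDD)
    obtain u u' where u: "u \<in> carrier (dual R X)" "u' \<in> carrier (dual R X)"
      "dual_map R (double_dual R X) Y g y = evaluation (op_ring R) (dual R X) u"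
      "dual_map R (double_dual R X) Y g' y = evaluation (op_ring R) (dual R X) u'"
      using *[OF g(1)] *[OF g(2)] by blast
    have ev: "evaluation (op_ring R) (dual R X) v \<zeta> = \<zeta> v"
      if "v \<in> carrier (dual R X)" "\<zeta> \<in> carrier (double_dual R X)" for v \<zeta>
      using that by (simp add: double_dual_def)
    have u_eq: "y (g \<zeta>) = \<zeta> u" "y (g' \<zeta>) = \<zeta> u'" if "\<zeta> \<in> carrier (double_dual R X)" for \<zeta>
      using fun_cong[OF u(3), of \<zeta>] fun_cong[OF u(4), of \<zeta>] ev[OF u(1) that] ev[OF u(2) that]
      by (simp_all add: dual_map_apply[OF y that])
    \<comment> \<open>At the evaluation of \<open>x\<close> the two formulas in \<open>u_eq\<close>
      give \<open>u x\<close> and \<open>u' x\<close>, and there \<open>g\<close> and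
      \<open>g'\<close> agree.\<close>
    have "u = u'"
    proof (rule dual_eqI[OF u(1,2)])
      fix x assume x: "x \<in> carrier X"
      have "evaluation R X x \<in> carrier (double_dual R X)"
        by (rule mod_hom_closed[OF evaluation_hom[OF X] x])
      from u_eq[OF this] show "u x = u' x"
        using eq[OF x] u(1,2) x by simp
    qed
    then show ?thesis
      using u_eq[OF \<xi>] by simp
  qed
  then have "evaluation R Y (g \<xi>) = evaluation R Y (g' \<xi>)"
    using mod_hom_closed[OF g(1) \<xi>] mod_hom_closed[OF g(2) \<xi>] by (simp add: evaluation_def fun_eq_iff)
  then show "g \<xi> = g' \<xi>"
    using mod_hom_closed[OF g(1) \<xi>] mod_hom_closed[OF g(2) \<xi>] by (rule inj_onD[OF Y(2)])
qed

text \<open>The inverse sends \<open>f\<close> to its double dual followed by the inverse of the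
  evaluation of \<open>Y\<close>; uniqueness is \<open>evaluation_epi\<close>.\<close>

lemma evaluation_universal:
  assumes X: "left_module R X" and DX: "dual R X \<in> reflexive_modules (op_ring R)"
    and Y: "Y \<in> reflexive_modules R"
  shows "bij_betw (\<lambda>g. compose (carrier X) g (evaluation R X))
    (mod_hom R (double_dual R X) Y) (mod_hom R X Y)"
proof (rule bij_betw_imageI)
  note Y = reflexive_modulesD[OF Y]
  have DDX: "left_module R (double_dual R X)" and DDY: "left_module R (double_dual R Y)"
    by (intro left_module_double_dual X Y(2))+
  note evX = evaluation_hom[OF X] and evY = evaluation_hom[OF Y(2)]
  show "inj_on (\<lambda>g. compose (carrier X) g (evaluation R X)) (mod_hom R (double_dual R X) Y)"
  proof (rule inj_onI)
    fix g g' assume g: "g \<in> mod_hom R (double_dual R X) Y" "g' \<in> mod_hom R (double_dual R X) Y"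
      and eq: "compose (carrier X) g (evaluation R X) = compose (carrier X) g' (evaluation R X)"
    show "g = g'"
    proof (rule evaluation_epi[OF X DX Y(2,3) g])
      show "g (evaluation R X x) = g' (evaluation R X x)" if "x \<in> carrier X" for x
        using fun_cong[OF eq, of x] that by (simp add: compose_def)
    qed
  qed
  show "(\<lambda>g. compose (carrier X) g (evaluation R X)) ` mod_hom R (double_dual R X) Y = mod_hom R X Y"
  proof (intro equalityI subsetI)
    fix f assume "f \<in> (\<lambda>g. compose (carrier X) g (evaluation R X)) ` mod_hom R (double_dual R X) Y"
    then show "f \<in> mod_hom R X Y"
      using mod_hom_compose[OF evX _ X] by blast
  next
    fix f assume f: "f \<in> mod_hom R X Y"
    note ff = double_dual_map_hom[OF X Y(2) f]
    \<comment> \<open>The inverse of the evaluation of \<open>Y\<close>, obtained by factoring the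
      identity through it, which makes it linear at once.\<close>
    obtain k where k: "k \<in> mod_hom R (double_dual R Y) Y" "\<And>y. y \<in> carrier Y \<Longrightarrow> k (evaluation R Y y) = y"
    proof -
      have "\<exists>k\<in>mod_hom R (double_dual R Y) Y. \<forall>y\<in>carrier Y. k (evaluation R Y y) = (\<lambda>y\<in>carrier Y. y) y"
        by (rule hom_factor_surj[OF Y(2) DDY Y(2) evY Y(4) mod_hom_id[OF Y(2)]])
          (use mod_hom_kernel_trivial[OF evY Y(2) DDY Y(3)] in auto)
      then show thesis
        using that by auto
    qed
    let ?g = "compose (carrier (double_dual R X)) k (double_dual_map R X Y f)"
    have g: "?g \<in> mod_hom R (double_dual R X) Y"
      by (rule mod_hom_compose[OF ff k(1) DDX])
    have "f = compose (carrier X) ?g (evaluation R X)"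
    proof (rule mod_hom_eqI[OF f mod_hom_compose[OF evX g X]])
      fix x assume x: "x \<in> carrier X"
      show "f x = compose (carrier X) ?g (evaluation R X) x"
        using x mod_hom_closed[OF evX x] double_dual_map_evaluation[OF X Y(2) f x] k(2)[OF mod_hom_closed[OF f x]]
        by (simp add: compose_def)
    qed
    then show "f \<in> (\<lambda>g. compose (carrier X) g (evaluation R X)) ` mod_hom R (double_dual R X) Y"
      using g by blast
  qed
qed


theorem proposition1p2:
  fixes R :: "'a ring"
  assumes "infinite (UNIV :: 'u set)"
    and "two_sided_noetherian R"
    and "two_sided_22_condition TYPE('u) R"
  shows "(reflexive_modules R :: ('a, 'u) module set) = second_syzygies R \<and>
    (closed_under_kernels R (reflexive_modules R :: ('a, 'u) module set) \<and>
     closed_under_extensions R (reflexive_modules R :: ('a, 'u) module set)) \<and>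
    left_adjoint_to_ref_inclusion R
      (double_dual R :: ('a, 'u) module \<Rightarrow> ('a, ('u \<Rightarrow> 'a) \<Rightarrow> 'a) module)
      (double_dual_map R)
      (\<lambda>X Y g. compose (carrier X) g (evaluation R X))"
proof -
  note inf = assms(1)
  have R: "left_noetherian R" "left_noetherian (op_ring R)"
    using assms(2) by (simp_all add: two_sided_noetherian_def)
  have cond: "flat_dim_condition TYPE('u) R 2 2" "flat_dim_condition TYPE('u) (op_ring R) 2 2"
    using assms(3) by (simp_all add: two_sided_22_condition_def)
  \<comment> \<open>The resolution contains a copy of the ring, so \<open>'u\<close> is large enough
    for copies of all finite free modules.\<close>
  obtain e :: "'a \<Rightarrow> 'u" where e: "inj_on e (carrier R)"
    using flat_dim_conditionE[OF cond(1)] by metis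
  have dual: "dual R M \<in> reflexive_modules (op_ring R)" if "M \<in> fg_modules R" for M :: "('a, 'm) module"
    by (rule dual_reflexive[OF R inf cond(1) that])
  \<comment> \<open>The theorem on duals is applied over \<open>R\<close> for finite generation of
    the dual and then over \<open>op_ring R\<close> to that dual, so both halves of the two-sided
    condition enter.\<close>
  have ddual: "double_dual R X \<in> reflexive_modules R" if "X \<in> fg_modules R" for X :: "('a, 'u) module"
    using dual_reflexive[of "op_ring R" "dual R X"] R inf cond(2) reflexive_modulesD(1)[OF dual[OF that]]
    by (simp add: double_dual_def)
  have kernel: "K \<in> reflexive_modules R"
    if "left_module R K" "X \<in> reflexive_modules R" "Y \<in> reflexive_modules R" "f \<in> mod_hom R X Y"
      "i \<in> mod_hom R K X" "inj_on i (carrier K)" "i ` carrier K = a_kernel X Y f"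
    for K X Y :: "('a, 'u) module" and i f
    by (rule kernel_of_hom_reflexive[OF R inf cond(2) that])
  have "(reflexive_modules R :: ('a, 'u) module set) = second_syzygies R"
  proof (intro equalityI subsetI)
    fix X :: "('a, 'u) module" assume "X \<in> reflexive_modules R"
    then show "X \<in> second_syzygies R"
      by (rule second_syzygy_of_reflexive[OF R inf e])
  next
    fix X :: "('a, 'u) module" assume "X \<in> second_syzygies R"
    then obtain P Q :: "('a, 'u) module" and i f where X: "left_module R X"
      and P: "P \<in> fg_modules R" "projective_module R P" and Q: "Q \<in> fg_modules R" "projective_module R Q"
      and i: "i \<in> mod_hom R X P" "inj_on i (carrier X)"
      and f: "f \<in> mod_hom R P Q" and im: "i ` carrier X = a_kernel P Q f"
      unfolding second_syzygies_def fg_modules_def by blast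
    show "X \<in> reflexive_modules R"
      \<comment> \<open>A second syzygy is a kernel of a map between finitely generated projectives,
        which are reflexive.\<close>
      by (rule kernel[OF X projective_reflexive[OF inf e P] projective_reflexive[OF inf e Q] f i im])
  qed
  moreover have "closed_under_kernels R (reflexive_modules R :: ('a, 'u) module set)"
    unfolding closed_under_kernels_def by (intro allI impI, elim conjE, rule kernel)
  moreover have "closed_under_extensions R (reflexive_modules R :: ('a, 'u) module set)"
    unfolding closed_under_extensions_def
    by (intro allI impI, elim conjE, rule extension_reflexive[OF R inf cond(2)])
  moreover have "left_adjoint_to_ref_inclusion R
      (double_dual R :: ('a, 'u) module \<Rightarrow> ('a, ('u \<Rightarrow> 'a) \<Rightarrow> 'a) module)
      (double_dual_map R) (\<lambda>X Y g. compose (carrier X) g (evaluation R X))"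
    unfolding left_adjoint_to_ref_inclusion_def
  proof (intro conjI ballI)
    show "functor_mod_to_ref R (double_dual R :: ('a, 'u) module \<Rightarrow> _) (double_dual_map R)"
      by (rule double_dual_functor[OF ddual])
  next
    fix X Y :: "('a, 'u) module" assume X: "X \<in> fg_modules R" and Y: "Y \<in> reflexive_modules R"
    then have "left_module R X"
      by (simp add: fg_modules_def)
    then show "bij_betw (\<lambda>g. compose (carrier X) g (evaluation R X)) (mod_hom R (double_dual R X) Y)
        (mod_hom R X Y)"
      by (rule evaluation_universal[OF _ dual[OF X] Y])
  next
    fix X X' Y :: "('a, 'u) module" and k g
    assume "X \<in> fg_modules R" "X' \<in> fg_modules R" "Y \<in> reflexive_modules R"
      and k: "k \<in> mod_hom R X' X" and g: "g \<in> mod_hom R (double_dual R X) Y"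
    then have X: "left_module R X" and X': "left_module R X'"
      by (simp_all add: fg_modules_def)
    show "compose (carrier X') (compose (carrier (double_dual R X')) g (double_dual_map R X' X k))
        (evaluation R X') = compose (carrier X') (compose (carrier X) g (evaluation R X)) k"
    proof (rule ext)
      fix x
      show "compose (carrier X') (compose (carrier (double_dual R X')) g (double_dual_map R X' X k))
          (evaluation R X') x = compose (carrier X') (compose (carrier X) g (evaluation R X)) k x"
        using mod_hom_closed[OF evaluation_hom[OF X'], of x] mod_hom_closed[OF k, of x]
          double_dual_map_evaluation[OF X' X k, of x]
        by (cases "x \<in> carrier X'") (simp_all add: compose_def)
    qed
  next
    fix X Y Y' :: "('a, 'u) module" and h g
    assume "X \<in> fg_modules R" "Y \<in> reflexive_modules R" "Y' \<in> reflexive_modules R"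
      and h: "h \<in> mod_hom R Y Y'" and g: "g \<in> mod_hom R (double_dual R X) Y"
    then have X: "left_module R X"
      by (simp add: fg_modules_def)
    show "compose (carrier X) (compose (carrier (double_dual R X)) h g) (evaluation R X) =
        compose (carrier X) h (compose (carrier X) g (evaluation R X))"
      using mod_hom_closed[OF evaluation_hom[OF X]] by (auto simp: compose_def fun_eq_iff)
  qed
  ultimately show ?thesis
    by blast
qed

end
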